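(* Let $1\le\varrho<\infty$. The operator that maps $f\in L^1(\gamma_\infty)$ to the function $x\mapsto\|\mathcal H_tf(x)\|_{v(\varrho),[1,+\infty)}$, $x\in\mathbb R^n$, is of weak type $(1,1)$ with respect to the measure $\gamma_\infty$, i.e. there is a constant $C$ with $\gamma_\infty\{x:\|\mathcal H_tf(x)\|_{v(\varrho),[1,\infty)}>\alpha\}\le \frac C\alpha\|f\|_{L^1(\gamma_\infty)}$ for all $\alpha>0$ and all $f\in L^1(\gamma_\infty)$. In fact, the following stronger result holds: there is a constant $C$, depending only on $n$, $Q$ and $B$, such that if $\|f\|_{L^1(\gamma_\infty)}=1$, then $$\gamma_\infty\left\{x\in\mathbb R^n:\ \|\mathcal H_tf(x)\|_{v(\varrho),[1,\infty)}>\alpha\right\}\le\frac{C}{\alpha\sqrt{\log\alpha}},\qquad \alpha>2.$$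
   Context: Let $n\ge1$, let $Q$ be a real, symmetric, positive definite $n\times n$ matrix and $B$ a real $n\times n$ matrix all of whose eigenvalues have negative real parts. For $0<t\le+\infty$ set $Q_t=\int_0^t e^{sB}Qe^{sB^*}\,ds$, and let $\gamma_\infty$ be the Gaussian probability measure on $\mathbb R^n$ with Lebesgue density $(2\pi)^{-n/2}(\det Q_\infty)^{-1/2}\exp(-\frac12\langle Q_\infty^{-1}x,x\rangle)$. Set $R(x)=\frac12\langle Q_\infty^{-1}x,x\rangle$ and $D_t=Q_\infty e^{-tB^*}Q_\infty^{-1}$. The Ornstein--Uhlenbeck semigroup $(\mathcal H_t)_{t>0}$ is given for $f\in L^1(\gamma_\infty)$ by $\mathcal H_tf(x)=\int_{\mathbb R^n}K_t(x,u)f(u)\,d\gamma_\infty(u)$, where $$K_t(x,u)=\Big(\frac{\det Q_\infty}{\det Q_t}\Big)^{1/2}e^{R(x)}\exp\Big[-\tfrac12\big\langle(Q_t^{-1}-Q_\infty^{-1})(u-D_tx),\,u-D_tx\big\rangle\Big].$$ For $1\le\varrho<\infty$ and a continuous real-valued function $\phi$ on an interval $I$, $\|\phi\|_{v(\varrho),I}=\sup\big(\sum_{i=1}^N|\phi(t_i)-\phi(t_{i-1})|^\varrho\big)^{1/\varrho}$, the supremum being over all finite increasing sequences $(t_i)_0^N$ of points in $I$; $\|\mathcal H_tf(x)\|_{v(\varrho),I}$ is this seminorm of $t\mapsto\mathcal H_tf(x)$ for fixed $x$. *)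

theory Defs
  imports "HOL-Analysis.Analysis"
begin

definition symmetric_matrix :: "real ^ 'n ^ 'n \<Rightarrow> bool" where
  "symmetric_matrix A \<longleftrightarrow> transpose A = A"

definition positive_definite :: "real ^ 'n ^ 'n \<Rightarrow> bool" where
  "positive_definite A \<longleftrightarrow> (\<forall>x. x \<noteq> 0 \<longrightarrow> 0 < (A *v x) \<bullet> x)"

definition complex_eigenvalue :: "real ^ 'n ^ 'n \<Rightarrow> complex \<Rightarrow> bool" where
  "complex_eigenvalue A z \<longleftrightarrow>
     (\<exists>v :: complex ^ 'n. v \<noteq> 0 \<and> map_matrix complex_of_real A *v v = z *s v)"

(* Powers are iterated matrix products: the type's own multiplication is entrywise. *)
definition matrix_exp :: "real ^ 'n ^ 'n \<Rightarrow> real ^ 'n ^ 'n" where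
  "matrix_exp A = (\<Sum>k. (1 / fact k) *\<^sub>R (((**) A ^^ k) (mat 1)))"

(* The upper limit is an extended real, so that OU_cov Q B \<infinity> is the integral
   over the whole half-line. The adjoint is the transpose, B being real. *)
definition OU_cov :: "real ^ 'n ^ 'n \<Rightarrow> real ^ 'n ^ 'n \<Rightarrow> ereal \<Rightarrow> real ^ 'n ^ 'n" where
  "OU_cov Q B t = integral {s :: real. 0 \<le> s \<and> ereal s \<le> t}
     (\<lambda>s. matrix_exp (s *\<^sub>R B) ** Q ** matrix_exp (s *\<^sub>R transpose B))"

definition OU_R :: "real ^ 'n ^ 'n \<Rightarrow> real ^ 'n ^ 'n \<Rightarrow> real ^ 'n \<Rightarrow> real" where
  "OU_R Q B x = 1 / 2 * ((matrix_inv (OU_cov Q B \<infinity>) *v x) \<bullet> x)"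

definition OU_D :: "real ^ 'n ^ 'n \<Rightarrow> real ^ 'n ^ 'n \<Rightarrow> real \<Rightarrow> real ^ 'n ^ 'n" where
  "OU_D Q B t =
     OU_cov Q B \<infinity> ** matrix_exp ((- t) *\<^sub>R transpose B) ** matrix_inv (OU_cov Q B \<infinity>)"

definition OU_measure :: "real ^ 'n ^ 'n \<Rightarrow> real ^ 'n ^ 'n \<Rightarrow> (real ^ 'n) measure" where
  "OU_measure Q B = density lborel (\<lambda>x. ennreal
     ((2 * pi) powr (- (real CARD('n) / 2)) * det (OU_cov Q B \<infinity>) powr (- (1 / 2)) *
      exp (- (1 / 2) * ((matrix_inv (OU_cov Q B \<infinity>) *v x) \<bullet> x))))"

definition OU_kernel ::
  "real ^ 'n ^ 'n \<Rightarrow> real ^ 'n ^ 'n \<Rightarrow> real \<Rightarrow> real ^ 'n \<Rightarrow> real ^ 'n \<Rightarrow> real" where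
  "OU_kernel Q B t x u =
     sqrt (det (OU_cov Q B \<infinity>) / det (OU_cov Q B (ereal t))) * exp (OU_R Q B x) *
     exp (- (1 / 2) *
       (((matrix_inv (OU_cov Q B (ereal t)) - matrix_inv (OU_cov Q B \<infinity>)) *v
           (u - OU_D Q B t *v x)) \<bullet> (u - OU_D Q B t *v x)))"

definition OU_semigroup ::
  "real ^ 'n ^ 'n \<Rightarrow> real ^ 'n ^ 'n \<Rightarrow> real \<Rightarrow> (real ^ 'n \<Rightarrow> real) \<Rightarrow> real ^ 'n \<Rightarrow> real" where
  "OU_semigroup Q B t f x = (\<integral>u. OU_kernel Q B t x u * f u \<partial>OU_measure Q B)"

(* An increasing sequence t 0 < ... < t N is given by N and the values of t on {..N}.
   The supremum may be infinite, hence the type ennreal. *)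
definition rho_variation :: "real \<Rightarrow> real set \<Rightarrow> (real \<Rightarrow> real) \<Rightarrow> ennreal" where
  "rho_variation \<rho> I \<phi> =
     (SUP (N, t) \<in> {(N, t :: nat \<Rightarrow> real). strict_mono_on {..N} t \<and> t ` {..N} \<subseteq> I}.
        ennreal ((\<Sum>i=1..N. \<bar>\<phi> (t i) - \<phi> (t (i - 1))\<bar> powr \<rho>) powr (1 / \<rho>)))"

(* emeasure is 0 on non-measurable sets, so the measurability of T f, needed for the
   inequality to have its usual meaning, is an explicit part of the definition. *)
definition weak_type_1_1 :: "'a measure \<Rightarrow> (('a \<Rightarrow> real) \<Rightarrow> 'a \<Rightarrow> ennreal) \<Rightarrow> bool" where
  "weak_type_1_1 M T \<longleftrightarrow>
     (\<forall>f. integrable M f \<longrightarrow> T f \<in> borel_measurable M) \<and>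
     (\<exists>C :: real. \<forall>\<alpha>>0. \<forall>f. integrable M f \<longrightarrow>
        emeasure M {x \<in> space M. T f x > ennreal \<alpha>} \<le> ennreal (C / \<alpha> * (\<integral>x. \<bar>f x\<bar> \<partial>M)))"

end

theory Submission
  imports Defs "HOL-Computational_Algebra.Fundamental_Theorem_Algebra"
begin

text \<open>The \<open>\<rho>\<close>-variation is at most the total variation, so it suffices to bound the total variation in
\<open>t \<ge> 1\<close> of the kernel \<open>K\<^sub>t(x, u)\<close>. Let \<open>cov\<close> be the stationary covariance, \<open>P\<close> its inverse,
\<open>rho x\<close> the norm with \<open>rho x ^ 2 = 2 R(x)\<close>, and \<open>E t = cov exp(t B\<^sup>T) P\<close>, which is the inverse of
\<open>D\<^sub>t\<close>. The Lyapunov equation makes \<open>rho\<close> decrease along the orbits \<open>t \<mapsto> E t u\<close> at a rate comparable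
to \<open>rho\<close> itself. The Woodbury identity turns the kernel into
\<open>K\<^sub>t(x, u) = factor t * exp (R(x)) * exp (- phase / 2)\<close>, where \<open>phase\<close> is a uniformly positive
definite quadratic form in \<open>E t u - x\<close> (\<open>OU_kernel_eq\<close>). So the kernel is a Gaussian bump centred at a
point that moves down the orbit of \<open>u\<close>.

The \<open>t\<close>-derivative of the bump is an exponentially small term plus a term proportional to the speed of
the centre, and the speed is controlled by the rate at which the level \<open>rho (E t u)\<close> decreases. Hence
both terms can be integrated in \<open>t\<close>, with a bound that does not depend on \<open>x\<close> and \<open>u\<close>, while a fixed
part of the Gaussian is kept. The variation is therefore at most a constant times
\<open>exp (R(x)) * Psi x u\<close>, where \<open>Psi x u\<close> is the largest value of \<open>exp (- kappa * rho (E t u - x) ^ 2)\<close>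
over \<open>t \<ge> 1\<close> (\<open>OU_kernel_variation\<close>).

Let \<open>f\<close> have norm one, and let \<open>Phi x\<close> be the integral of \<open>Psi x u * \<bar>f u\<bar>\<close>. It remains to measure
the set where \<open>\<alpha> < C * exp (R(x)) * Phi x\<close>, for large \<open>\<alpha>\<close>. As \<open>Phi \<le> 1\<close>, this set lies outside a
ball of radius \<open>r\<close> of order \<open>sqrt (ln \<alpha>)\<close>, and beyond the radius \<open>2 r\<close> the Gaussian tail is negligible. Two facts
settle the region in between. First, \<open>Phi\<close> does not decrease along the contracting flow
(\<open>Psi_flow\<close>), so on an orbit through a point \<open>y\<close> of the shell \<open>r - 1 \<le> rho \<le> r\<close> the set is contained
in \<open>\<alpha> < C * exp (R) * Phi y\<close>. Along the orbit, \<open>R\<close> grows at rate \<open>r\<^sup>2\<close>, so the Gaussian weight of that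
part is at most \<open>C * Phi y / (\<alpha> * r\<^sup>2)\<close>; an orbit spends a time of order \<open>1 / r\<close> in the shell, which gives
back one factor \<open>r\<close> (\<open>level_set_bound\<close>). Second, \<open>Phi\<close> has bounded integral over the shell uniformly
in \<open>r\<close>, because an orbit crosses the shell transversally and \<open>Psi y u\<close> is there dominated by a single
Gaussian (\<open>Psi_shell_integral\<close>). The result is the bound \<open>C / (\<alpha> * r)\<close>, and the weak type
\<open>(1,1)\<close> estimate follows by scaling.

Measurability of the variation follows from continuity of \<open>t \<mapsto> H\<^sub>t f(x)\<close>: rational partitions
suffice.\<close>

section \<open>The matrix exponential\<close>

lemma bounded_bilinear_matrix_matrix_mult:
  "bounded_bilinear ((**) :: real ^ 'n ^ 'm \<Rightarrow> real ^ 'k ^ 'n \<Rightarrow> real ^ 'k ^ 'm)"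
  unfolding bilinear_conv_bounded_bilinear[symmetric] bilinear_def
  by (auto intro!: linearI simp: vec_eq_iff matrix_matrix_mult_def sum_distrib_left
      sum.distrib algebra_simps)

lemma bounded_bilinear_matrix_vector_mult:
  "bounded_bilinear ((*v) :: real ^ 'n ^ 'm \<Rightarrow> real ^ 'n \<Rightarrow> real ^ 'm)"
  unfolding bilinear_conv_bounded_bilinear[symmetric] bilinear_def
  by (auto intro!: linearI simp: vec_eq_iff matrix_vector_mult_def sum_distrib_left
      sum.distrib algebra_simps)

interpretation mm: bounded_bilinear "(**) :: real ^ 'n ^ 'm \<Rightarrow> real ^ 'k ^ 'n \<Rightarrow> real ^ 'k ^ 'm"
  by (rule bounded_bilinear_matrix_matrix_mult)

interpretation mv: bounded_bilinear "(*v) :: real ^ 'n ^ 'm \<Rightarrow> real ^ 'n \<Rightarrow> real ^ 'm"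
  by (rule bounded_bilinear_matrix_vector_mult)

lemma bounded_linear_transpose: "bounded_linear (transpose :: real ^ 'n ^ 'm \<Rightarrow> real ^ 'm ^ 'n)"
  unfolding linear_conv_bounded_linear[symmetric]
  by (auto intro!: linearI simp: vec_eq_iff transpose_def)

lemma matrix_pow_commute:
  fixes A :: "real ^ 'n ^ 'n"
  shows "((**) A ^^ k) (mat 1) ** A = A ** ((**) A ^^ k) (mat 1)"
  by (induction k) (auto simp: matrix_mul_assoc[symmetric])

lemma matrix_pow_scaleR:
  fixes A :: "real ^ 'n ^ 'n"
  shows "((**) (t *\<^sub>R A) ^^ k) (mat 1) = t ^ k *\<^sub>R ((**) A ^^ k) (mat 1)"
  by (induction k) (auto simp: mm.scaleR_left mm.scaleR_right mult.commute simp del: scaleR_scaleR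
      simp flip: scaleR_scaleR)

lemma matrix_pow_transpose:
  fixes A :: "real ^ 'n ^ 'n"
  shows "((**) (transpose A) ^^ k) (mat 1) = transpose (((**) A ^^ k) (mat 1))"
proof (induction k)
  case (Suc k)
  have "((**) (transpose A) ^^ Suc k) (mat 1) = transpose A ** transpose (((**) A ^^ k) (mat 1))"
    using Suc by simp
  also have "\<dots> = transpose (((**) A ^^ k) (mat 1) ** A)"
    by (simp add: matrix_transpose_mul)
  finally show ?case by (simp add: matrix_pow_commute)
qed simp

text \<open>The Euclidean norm of matrices is submultiplicative up to a factor, which is absorbed into the
  base \<open>c\<close> of the geometric bound for the powers.\<close>

lemma matrix_exp_summable_norm:
  fixes A :: "real ^ 'n ^ 'n"
  shows "summable (\<lambda>k. norm ((1 / fact k) *\<^sub>R ((**) A ^^ k) (mat 1)))"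
proof -
  obtain K where K: "K > 0" "\<And>(A :: real ^ 'n ^ 'n) (B :: real ^ 'n ^ 'n). norm (A ** B) \<le> norm A * norm B * K"
    using mm.pos_bounded by blast
  define c where "c = norm A * K"
  have c0: "c \<ge> 0" using K by (simp add: c_def)
  have bd: "norm (((**) A ^^ k) (mat 1 :: real ^ 'n ^ 'n)) \<le> c ^ k * norm (mat 1 :: real ^ 'n ^ 'n)" for k
  proof (induction k)
    case (Suc k)
    have "norm (((**) A ^^ Suc k) (mat 1)) \<le> norm A * norm (((**) A ^^ k) (mat 1)) * K"
      using K(2)[of A "((**) A ^^ k) (mat 1)"] by simp
    also have "\<dots> = c * norm (((**) A ^^ k) (mat 1))" by (simp add: c_def)
    also have "\<dots> \<le> c * (c ^ k * norm (mat 1 :: real ^ 'n ^ 'n))"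
      using Suc c0 by (intro mult_left_mono) auto
    finally show ?case by simp
  qed simp
  have "summable (\<lambda>k. (1 / fact k * c ^ k) * norm (mat 1 :: real ^ 'n ^ 'n))"
    using summable_mult2[OF summable_exp[of c]] by (simp add: divide_inverse)
  then show ?thesis
    by (rule summable_comparison_test[rotated])
      (auto intro!: exI[of _ 0] divide_right_mono bd simp: divide_simps)
qed

lemmas matrix_exp_summable = summable_norm_cancel[OF matrix_exp_summable_norm]

lemma matrix_exp_0 [simp]: "matrix_exp 0 = (mat 1 :: real ^ 'n ^ 'n)"
proof -
  have z: "((**) (0 :: real ^ 'n ^ 'n) ^^ k) (mat 1) = (if k = 0 then mat 1 else 0)" for k
    by (cases k) (auto simp: mm.zero_left)
  have "matrix_exp (0 :: real ^ 'n ^ 'n) = (\<Sum>k. if k = 0 then mat 1 else 0)"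
    unfolding matrix_exp_def by (intro suminf_cong) (simp add: z)
  also have "\<dots> = mat 1"
    using suminf_finite[of "{0}" "\<lambda>k. if k = 0 then mat 1 else (0::real^'n^'n)"] by simp
  finally show ?thesis .
qed

lemma matrix_exp_transpose: "matrix_exp (transpose A) = transpose (matrix_exp (A :: real ^ 'n ^ 'n))"
  unfolding matrix_exp_def
  by (subst bounded_linear.suminf[OF bounded_linear_transpose matrix_exp_summable])
    (simp add: matrix_pow_transpose linear_cmul[OF bounded_linear.linear[OF bounded_linear_transpose]])

lemma matrix_exp_commute:
  fixes A B :: "real ^ 'n ^ 'n"
  assumes "A ** B = B ** A"
  shows "A ** matrix_exp B = matrix_exp B ** A"
proof -
  have pow: "A ** ((**) B ^^ k) (mat 1) = ((**) B ^^ k) (mat 1) ** A" for k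
  proof (induction k)
    case (Suc k)
    have "A ** ((**) B ^^ Suc k) (mat 1) = B ** (A ** ((**) B ^^ k) (mat 1))"
      by (simp add: matrix_mul_assoc assms)
    then show ?case by (simp add: Suc matrix_mul_assoc)
  qed simp
  show ?thesis
    unfolding matrix_exp_def
    by (simp add: bounded_linear.suminf[OF mm.bounded_linear_right matrix_exp_summable]
        bounded_linear.suminf[OF mm.bounded_linear_left matrix_exp_summable]
        mm.scaleR_left mm.scaleR_right pow)
qed

text \<open>Each entry of the exponential is an everywhere convergent real power series in the time
  parameter, so that termwise differentiation of scalar series applies.\<close>

lemma matrix_exp_has_vector_derivative:
  fixes A :: "real ^ 'n ^ 'n"
  shows "((\<lambda>t. matrix_exp (t *\<^sub>R A)) has_vector_derivative A ** matrix_exp (t *\<^sub>R A)) (at t within S)"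
proof -
  define X where "X = (\<lambda>k. ((**) A ^^ k) (mat 1))"
  have bl: "bounded_linear (\<lambda>M :: real ^ 'n ^ 'n. M $ i $ j)" for i j
    using bounded_linear_compose[OF bounded_linear_vec_nth bounded_linear_vec_nth] .
  have ent: "matrix_exp (s *\<^sub>R A) $ i $ j = (\<Sum>k. (X k $ i $ j / fact k) * s ^ k)" for s i j
    unfolding matrix_exp_def
    by (subst bounded_linear.suminf[OF bl matrix_exp_summable])
      (simp add: matrix_pow_scaleR X_def field_simps)
  have sm: "summable (\<lambda>k. (X k $ i $ j / fact k) * s ^ k)" for s i j
    using bounded_linear.summable[OF bl[of i j] matrix_exp_summable[of "s *\<^sub>R A"]]
    by (simp add: matrix_pow_scaleR X_def field_simps)
  have D: "((\<lambda>s. matrix_exp (s *\<^sub>R A) $ i $ j) has_real_derivative (A ** matrix_exp (t *\<^sub>R A)) $ i $ j) (at t)"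
    for i j
  proof -
    have "((\<lambda>s. matrix_exp (s *\<^sub>R A) $ i $ j) has_real_derivative
        (\<Sum>k. diffs (\<lambda>k. X k $ i $ j / fact k) k * t ^ k)) (at t)"
      unfolding ent by (rule termdiffs_strong_converges_everywhere) (rule sm)
    also have "(\<Sum>k. diffs (\<lambda>k. X k $ i $ j / fact k) k * t ^ k)
        = (\<Sum>k. \<Sum>l\<in>UNIV. A $ i $ l * ((X k $ l $ j / fact k) * t ^ k))"
    proof (intro suminf_cong)
      fix k
      have "X (Suc k) $ i $ j = (\<Sum>l\<in>UNIV. A $ i $ l * X k $ l $ j)"
        by (simp add: X_def matrix_matrix_mult_def)
      then show "diffs (\<lambda>k. X k $ i $ j / fact k) k * t ^ k
          = (\<Sum>l\<in>UNIV. A $ i $ l * ((X k $ l $ j / fact k) * t ^ k))"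
        by (simp add: diffs_def sum_distrib_right sum_divide_distrib sum_distrib_left field_simps
            del: of_nat_Suc)
    qed
    also have "\<dots> = (\<Sum>l\<in>UNIV. A $ i $ l * matrix_exp (t *\<^sub>R A) $ l $ j)"
      unfolding ent
      by (simp only: suminf_sum[OF summable_mult[OF sm]] suminf_mult[OF sm])
    finally show ?thesis by (simp add: matrix_matrix_mult_def)
  qed
  have "((\<lambda>t. matrix_exp (t *\<^sub>R A)) has_vector_derivative A ** matrix_exp (t *\<^sub>R A)) (at t)"
    unfolding has_vector_derivative_def
    by (subst has_derivative_componentwise_within)
      (use D in \<open>auto simp: Basis_vec_def inner_axis has_field_derivative_def mult_commute_abs\<close>)
  then show ?thesis by (rule has_vector_derivative_at_within)
qed

text \<open>The product \<open>f r\<close> below has derivative zero; the law compares \<open>r = 0\<close> with \<open>r = - s\<close>.\<close>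

lemma matrix_exp_add:
  fixes A :: "real ^ 'n ^ 'n"
  shows "matrix_exp ((s + t) *\<^sub>R A) = matrix_exp (s *\<^sub>R A) ** matrix_exp (t *\<^sub>R A)"
proof -
  define f where "f = (\<lambda>r. matrix_exp (r *\<^sub>R (- A)) ** matrix_exp ((s + t + r) *\<^sub>R A))"
  have c: "A ** matrix_exp (r *\<^sub>R (- A)) = matrix_exp (r *\<^sub>R (- A)) ** A" for r
    by (rule matrix_exp_commute) (simp add: mm.scaleR_left mm.scaleR_right mm.minus_left mm.minus_right)
  have "(f has_vector_derivative 0) (at r within UNIV)" for r
  proof -
    have "((\<lambda>x. x + (s + t)) has_vector_derivative 1) (at r)"
      by (auto intro!: derivative_eq_intros)
    from vector_diff_chain_at[OF this matrix_exp_has_vector_derivative[of A]]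
    have 1: "((\<lambda>r. matrix_exp ((s + t + r) *\<^sub>R A)) has_vector_derivative
        A ** matrix_exp ((s + t + r) *\<^sub>R A)) (at r)"
      by (simp add: o_def add_ac)
    have "(f has_vector_derivative
        matrix_exp (r *\<^sub>R (- A)) ** (A ** matrix_exp ((s + t + r) *\<^sub>R A)) +
        ((- A) ** matrix_exp (r *\<^sub>R (- A))) ** matrix_exp ((s + t + r) *\<^sub>R A)) (at r)"
      unfolding f_def by (intro mm.has_vector_derivative 1 matrix_exp_has_vector_derivative)
    also have "matrix_exp (r *\<^sub>R (- A)) ** (A ** matrix_exp ((s + t + r) *\<^sub>R A)) +
        ((- A) ** matrix_exp (r *\<^sub>R (- A))) ** matrix_exp ((s + t + r) *\<^sub>R A) = 0"
      by (simp only: mm.minus_left c matrix_mul_assoc) simp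
    finally show ?thesis by simp
  qed
  then obtain C where C: "\<And>r. f r = C"
    using has_vector_derivative_zero_constant[of UNIV f] by auto
  have "f (- s) = f 0" by (simp only: C)
  then show ?thesis by (simp add: f_def)
qed

section \<open>Exponential decay for matrices with stable spectrum\<close>

interpretation cs: bounded_bilinear "(*s) :: complex \<Rightarrow> complex ^ 'n \<Rightarrow> complex ^ 'n"
  unfolding bilinear_conv_bounded_bilinear[symmetric] bilinear_def
  by (auto intro!: linearI simp: vec_eq_iff algebra_simps scaleR_conv_of_real[where 'a = complex])

lemma norm_cvec_scale: "norm (c *s v) = norm c * norm (v :: complex ^ 'n)"
  by (simp add: norm_vec_def norm_mult L2_set_right_distrib)

lemma cmatrix_vector_bounded_linear: "bounded_linear ((*v) (A :: complex ^ 'n ^ 'm))"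
  by (rule matrix_vector_mul_bounded_linear)

lemma cmatrix_vector_scale: "A *v (c *s v) = c *s (A *v (v :: complex ^ 'n))"
  by (simp add: vec_eq_iff matrix_vector_mult_def sum_distrib_left mult_ac)

text \<open>The vector \<open>p(A) v\<close>, by Horner's scheme.\<close>

definition poly_act :: "complex ^ 'n ^ 'n \<Rightarrow> complex poly \<Rightarrow> complex ^ 'n \<Rightarrow> complex ^ 'n" where
  "poly_act A p v = fold_coeffs (\<lambda>a w. a *s v + A *v w) p 0"

lemma poly_act_0 [simp]: "poly_act A 0 v = 0"
  by (simp add: poly_act_def)

lemma poly_act_pCons [simp]: "poly_act A (pCons a p) v = a *s v + A *v poly_act A p v"
  by (cases "p = 0"; cases "a = 0") (auto simp: poly_act_def vector_smult_lzero)

lemma poly_act_add: "poly_act A (p + q) v = poly_act A p v + poly_act A q v"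
  by (induction p q rule: poly_induct2)
    (auto simp: matrix_vector_right_distrib vector_sadd_rdistrib)

lemma poly_act_smult: "poly_act A (smult c p) v = c *s poly_act A p v"
  by (induction p) (auto simp: vector_add_ldistrib vector_smult_assoc cmatrix_vector_scale vector_smult_rzero)

lemma poly_act_diff: "poly_act A (p - q) v = poly_act A p v - poly_act A q v"
  using poly_act_add[of A "p - q" q v] by (simp add: eq_diff_eq)

lemma poly_act_linear_factor:
  "poly_act A ([:- z, 1:] * p) v = A *v poly_act A p v - z *s poly_act A p v"
  by (simp add: poly_act_diff poly_act_smult)

lemma poly_act_monom: "poly_act A (monom a k) v = a *s ((*v) A ^^ k) v"
  by (induction k) (auto simp: monom_0 monom_Suc cmatrix_vector_scale vector_smult_lzero)

lemma poly_act_sum: "poly_act A (\<Sum>i\<in>I. p i) v = (\<Sum>i\<in>I. poly_act A (p i) v)"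
  by (induction I rule: infinite_finite_induct) (auto simp: poly_act_add)

lemma poly_act_diff_vec: "poly_act A p (v - w) = poly_act A p v - poly_act A p w"
  by (induction p) (auto simp: matrix_vector_mult_diff_distrib cs.diff_right)

lemma poly_act_scale_vec: "poly_act A p (c *s v) = c *s poly_act A p v"
  by (induction p) (auto simp: vector_add_ldistrib vector_smult_assoc cmatrix_vector_scale mult.commute)

lemma poly_act_matrix_vec: "poly_act A p (A *v v) = A *v poly_act A p v"
  by (induction p) (auto simp: matrix_vector_right_distrib cmatrix_vector_scale)

lemma poly_act_powers:
  fixes A :: "complex ^ 'n ^ 'n"
  shows "((*v) A ^^ k) v = ((**) A ^^ k) (mat 1) *v v"
  by (induction k) (auto simp: matrix_vector_mul_assoc[symmetric])

text \<open>The powers of a matrix lie in a finite dimensional space, hence some nonzero polynomial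
  annihilates the matrix.\<close>

lemma annihilating_polynomial_exists:
  fixes A :: "complex ^ 'n ^ 'n"
  obtains p where "p \<noteq> 0" "\<And>v. poly_act A p v = 0"
proof -
  define X where "X = (\<lambda>k. ((**) A ^^ k) (mat 1))"
  define N where "N = DIM(complex ^ 'n ^ 'n)"
  show ?thesis
  proof (cases "inj_on X {..N}")
    case True
    then have "card (X ` {..N}) = Suc N" by (simp add: card_image)
    then have "dependent (X ` {..N})"
      by (intro dependent_biggerset) (simp add: N_def)
    then obtain u where u: "\<exists>v \<in> X ` {..N}. u v \<noteq> 0" "(\<Sum>v\<in>X ` {..N}. u v *\<^sub>R v) = 0"
      by (subst (asm) dependent_finite) auto
    define p where "p = (\<Sum>i\<le>N. monom (complex_of_real (u (X i))) i)"
    have "coeff p i = of_real (u (X i))" if "i \<le> N" for i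
      using that by (simp add: p_def coeff_sum coeff_monom)
    then have "p \<noteq> 0" using u(1) by auto
    moreover have "poly_act A p v = 0" for v
    proof -
      have s: "(r *\<^sub>R M) *v v = of_real r *s (M *v v)" for r and M :: "complex ^ 'n ^ 'n"
        by (simp add: vec_eq_iff matrix_vector_mult_def sum_distrib_left scaleR_conv_of_real[where 'a = complex] mult_ac)
      have su: "(\<Sum>i\<in>I. f i) *v v = (\<Sum>i\<in>I. f i *v v)" if "finite I" for I and f :: "nat \<Rightarrow> complex ^ 'n ^ 'n"
        using that by induction (auto simp: matrix_vector_mult_add_rdistrib)
      have "poly_act A p v = (\<Sum>i\<le>N. (u (X i) *\<^sub>R X i) *v v)"
        by (simp add: p_def poly_act_sum poly_act_monom poly_act_powers s X_def)
      also have "\<dots> = (\<Sum>i\<le>N. u (X i) *\<^sub>R X i) *v v" by (simp add: su)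
      also have "(\<Sum>i\<le>N. u (X i) *\<^sub>R X i) = 0"
        using u(2) by (simp add: sum.reindex[OF True])
      finally show ?thesis by simp
    qed
    ultimately show ?thesis by (rule that)
  next
    case False
    then obtain i j where ij: "X i = X j" "i \<noteq> j" by (auto simp: inj_on_def)
    define p where "p = monom (1::complex) i - monom 1 j"
    have "coeff p i \<noteq> 0" using ij by (simp add: p_def coeff_monom)
    then have "p \<noteq> 0" by auto
    moreover have "poly_act A p v = 0" for v
      using ij(1) by (simp add: p_def poly_act_diff poly_act_monom poly_act_powers X_def)
    ultimately show ?thesis by (rule that)
  qed
qed

text \<open>A decaying forcing term keeps a stable scalar mode decaying: variation of constants.\<close>

lemma stable_mode_decay:
  fixes w y :: "real \<Rightarrow> complex ^ 'n"
  assumes w: "\<And>t. (w has_vector_derivative (z *s w t + y t)) (at t)"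
    and y: "\<And>t. t \<ge> 0 \<Longrightarrow> norm (y t) \<le> C * exp (- c * t)"
    and z: "Re z < 0" and c: "c > 0"
  shows "\<exists>C' c'. c' > 0 \<and> (\<forall>t\<ge>0. norm (w t) \<le> C' * exp (- c' * t))"
proof -
  \<comment> \<open>A rate strictly below \<open>- Re z\<close>, so that the integrand \<open>exp (k t)\<close> below has positive rate.\<close>
  define c' where "c' = min c (- Re z) / 2"
  have c': "c' > 0" "c' \<le> c" "- Re z - c' > 0" using z c by (auto simp: c'_def min_def)
  define \<phi> where "\<phi> = (\<lambda>t. exp (of_real t * (- z)) *s w t)"
  define k where "k = - Re z - c'"
  have k: "k > 0" using c' by (simp add: k_def)
  have C0: "C \<ge> 0" using order_trans[OF norm_ge_zero y[of 0]] by simp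
  have d\<phi>: "(\<phi> has_vector_derivative exp (of_real t * (- z)) *s y t) (at t)" for t
  proof -
    have "((\<lambda>t. exp (complex_of_real t * (- z))) has_vector_derivative exp (of_real t * (- z)) * (- z)) (at t)"
      by (rule has_vector_derivative_real_field) (auto intro!: derivative_eq_intros)
    from cs.has_vector_derivative[OF this w[of t]]
    show ?thesis
      by (simp add: \<phi>_def vector_add_ldistrib vector_smult_assoc vector_smult_lneg)
  qed
  have bd: "norm (w t) \<le> (norm (w 0) + C / k) * exp (- c' * t)" if t: "t > 0" for t
  proof -
    have "norm (\<phi> t - \<phi> 0) \<le> (C / k) * exp (k * t) - (C / k) * exp (k * 0)"
    proof (rule differentiable_bound_general[OF t])
      show "continuous_on {0..t} \<phi>"
        using d\<phi> by (intro continuous_at_imp_continuous_on) (auto intro: has_vector_derivative_continuous)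
      show "continuous_on {0..t} (\<lambda>t. (C / k) * exp (k * t))" by (intro continuous_intros)
      fix s assume s: "0 < s" "s < t"
      show "(\<phi> has_vector_derivative exp (of_real s * (- z)) *s y s) (at s)" by (rule d\<phi>)
      show "((\<lambda>t. (C / k) * exp (k * t)) has_vector_derivative C * exp (k * s)) (at s)"
        unfolding has_real_derivative_iff_has_vector_derivative[symmetric]
        using k by (auto intro!: derivative_eq_intros)
      have "norm (exp (of_real s * (- z)) *s y s) = exp (- (Re z) * s) * norm (y s)"
        by (simp add: norm_cvec_scale mult.commute)
      also have "\<dots> \<le> exp (- (Re z) * s) * (C * exp (- c' * s))"
      proof (intro mult_left_mono)
        have "norm (y s) \<le> C * exp (- c * s)" using y s by simp
        also have "\<dots> \<le> C * exp (- c' * s)"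
          using C0 c' s by (intro mult_left_mono) auto
        finally show "norm (y s) \<le> C * exp (- c' * s)" .
      qed auto
      also have "\<dots> = C * exp (k * s)" by (simp add: k_def exp_add[symmetric] algebra_simps)
      finally show "norm (exp (of_real s * (- z)) *s y s) \<le> C * exp (k * s)" .
    qed
    also have "\<dots> \<le> (C / k) * exp (k * t)" using C0 k by simp
    finally have "norm (\<phi> t) \<le> norm (w 0) + (C / k) * exp (k * t)"
      using norm_triangle_ineq2[of "\<phi> t" "\<phi> 0"] by (simp add: \<phi>_def)
    also have "\<dots> \<le> (norm (w 0) + C / k) * exp (k * t)"
      using mult_left_mono[of 1 "exp (k * t)" "norm (w 0)"] k t by (simp add: algebra_simps)
    finally have 1: "norm (\<phi> t) \<le> (norm (w 0) + C / k) * exp (k * t)" .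
    have "norm (\<phi> t) = exp (- (Re z) * t) * norm (w t)"
      by (simp add: \<phi>_def norm_cvec_scale mult.commute)
    then have "norm (w t) = exp (Re z * t) * norm (\<phi> t)"
      by (simp add: exp_minus)
    also have "\<dots> \<le> exp (Re z * t) * ((norm (w 0) + C / k) * exp (k * t))"
      using 1 by (intro mult_left_mono) auto
    also have "\<dots> = (norm (w 0) + C / k) * exp (- c' * t)"
      by (simp add: k_def exp_add[symmetric] algebra_simps)
    finally show ?thesis .
  qed
  moreover have "norm (w 0) \<le> (norm (w 0) + C / k) * exp (- c' * 0)" using C0 k by simp
  ultimately have "\<forall>t\<ge>0. norm (w t) \<le> (norm (w 0) + C / k) * exp (- c' * t)"
    by (metis less_eq_real_def)
  with c' show ?thesis by blast
qed

text \<open>Roots of an annihilating polynomial are peeled off one at a time. A root that is not an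
  eigenvalue corresponds to an injective factor and can be cancelled; a root that is an eigenvalue
  is a stable mode driven by a solution annihilated by the quotient.\<close>

lemma stable_ode_decay:
  fixes A :: "complex ^ 'n ^ 'n" and w :: "real \<Rightarrow> complex ^ 'n"
  assumes ev: "\<And>z v. v \<noteq> 0 \<Longrightarrow> A *v v = z *s v \<Longrightarrow> Re z < 0"
    and p: "p \<noteq> 0" and w: "\<And>t. (w has_vector_derivative A *v w t) (at t)"
    and pw: "\<And>t. poly_act A p (w t) = 0"
  shows "\<exists>C c. c > 0 \<and> (\<forall>t\<ge>0. norm (w t) \<le> C * exp (- c * t))"
  using p w pw
proof (induction "degree p" arbitrary: p w)
  case 0
  then obtain a where "p = [:a:]" by (metis degree_eq_zeroE)
  with 0 have "w t = 0" for t
    by (metis add.right_neutral poly_act_pCons poly_act_0 mv.zero_right matrix_vector_mult_0_right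
        pCons_eq_0_iff vector_mul_eq_0)
  then show ?case by (intro exI[of _ 0] exI[of _ 1]) auto
next
  case (Suc n)
  have "\<not> constant (poly p)" using Suc(2) by (simp add: constant_degree)
  then obtain z where "poly p z = 0" using fundamental_theorem_of_algebra by blast
  then obtain q where q: "p = [:- z, 1:] * q" by (auto simp: poly_eq_0_iff_dvd)
  have q0: "q \<noteq> 0" using q Suc by auto
  have deg: "degree q = n" using Suc(2) q0 unfolding q by (subst (asm) degree_mult_eq) auto
  show ?case
  proof (cases "\<exists>v. v \<noteq> 0 \<and> A *v v = z *s v")
    case True
    then have z: "Re z < 0" using ev by blast
    define y where "y = (\<lambda>t. A *v w t - z *s w t)"
    have dy: "(y has_vector_derivative A *v y t) (at t)" for t
      unfolding y_def matrix_vector_mult_diff_distrib cmatrix_vector_scale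
      by (intro has_vector_derivative_diff bounded_linear.has_vector_derivative[OF cmatrix_vector_bounded_linear]
          bounded_linear.has_vector_derivative[OF cs.bounded_linear_right] Suc)
    have "poly_act A q (y t) = 0" for t
      using Suc(5)[of t]
      by (simp only: y_def q poly_act_linear_factor poly_act_diff_vec poly_act_scale_vec poly_act_matrix_vec)
    from Suc(1)[OF deg[symmetric] q0 dy this] obtain C c
      where "c > 0" "\<And>t. t \<ge> 0 \<Longrightarrow> norm (y t) \<le> C * exp (- c * t)" by auto
    moreover have "(w has_vector_derivative (z *s w t + y t)) (at t)" for t
      using Suc(4)[of t] by (simp add: y_def)
    ultimately obtain C' c' where "c' > 0 \<and> (\<forall>t\<ge>0. norm (w t) \<le> C' * exp (- c' * t))"
      using stable_mode_decay[of w z y C c] z by auto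
    then show ?thesis by blast
  next
    case False
    have "poly_act A q (w t) = 0" for t
    proof -
      have "A *v poly_act A q (w t) = z *s poly_act A q (w t)"
        using Suc(5)[of t] by (simp only: q poly_act_linear_factor) simp
      then show ?thesis using False by blast
    qed
    from Suc(1)[OF deg[symmetric] q0 Suc(4) this] show ?thesis .
  qed
qed

text \<open>The embedding of real vectors into complex ones is isometric and maps orbits to solutions of the
  complexified equation.\<close>

lemma matrix_exp_vector_decay:
  fixes B :: "real ^ 'n ^ 'n"
  assumes ev: "\<And>z. complex_eigenvalue B z \<Longrightarrow> Re z < 0"
  shows "\<exists>C c. c > 0 \<and> (\<forall>t\<ge>0. norm (matrix_exp (t *\<^sub>R B) *v v) \<le> C * exp (- c * t))"
proof -
  define A where "A = map_matrix complex_of_real B"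
  define cx where "cx = (\<lambda>x :: real ^ 'n. \<chi> i. complex_of_real (x $ i))"
  have bl: "bounded_linear cx"
    unfolding linear_conv_bounded_linear[symmetric]
    by (auto intro!: linearI simp: cx_def vec_eq_iff scaleR_conv_of_real[where 'a = complex])
  have ncx: "norm (cx x) = norm x" for x by (simp add: cx_def norm_vec_def)
  have Acx: "cx (B *v x) = A *v cx x" for x
    by (simp add: cx_def A_def vec_eq_iff matrix_vector_mult_def)
  obtain p where p: "p \<noteq> 0" "\<And>v. poly_act A p v = 0" using annihilating_polynomial_exists by blast
  have "((\<lambda>t. cx (matrix_exp (t *\<^sub>R B) *v v)) has_vector_derivative A *v cx (matrix_exp (t *\<^sub>R B) *v v)) (at t)" for t
    unfolding Acx[symmetric] matrix_vector_mul_assoc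
    by (intro bounded_linear.has_vector_derivative[OF bl]
        bounded_linear.has_vector_derivative[OF mv.bounded_linear_left] matrix_exp_has_vector_derivative)
  from stable_ode_decay[OF _ p(1) this p(2)] show ?thesis
    unfolding ncx using ev by (auto simp: complex_eigenvalue_def A_def)
qed

lemma norm_matrix_le_columns:
  fixes M :: "real ^ 'n ^ 'm"
  shows "norm M \<le> (\<Sum>i\<in>(UNIV :: 'm set). \<Sum>j\<in>UNIV. norm (M *v axis j 1))"
proof -
  have "norm M \<le> (\<Sum>i\<in>UNIV. norm (M $ i))" by (simp add: norm_vec_def L2_set_le_sum)
  also have "\<dots> \<le> (\<Sum>i\<in>UNIV. \<Sum>j\<in>UNIV. norm (M $ i $ j))"
    by (intro sum_mono) (simp add: norm_vec_def[where 'a = real] L2_set_le_sum)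
  also have "\<dots> \<le> (\<Sum>i\<in>(UNIV :: 'm set). \<Sum>j\<in>UNIV. norm (M *v axis j 1))"
  proof (intro sum_mono)
    fix i :: 'm and j :: 'n
    have "(M *v axis j 1) $ i = M $ i $ j" by (simp add: matrix_vector_mult_basis column_def)
    then show "norm (M $ i $ j) \<le> norm (M *v axis j 1)"
      using Finite_Cartesian_Product.norm_nth_le[of "M *v axis j 1" i] by simp
  qed
  finally show ?thesis .
qed

text \<open>Uniformising over the finitely many basis vectors turns the decay of single trajectories
  into decay of the whole matrix.\<close>

lemma matrix_exp_decay:
  fixes B :: "real ^ 'n ^ 'n"
  assumes ev: "\<And>z. complex_eigenvalue B z \<Longrightarrow> Re z < 0"
  obtains C c where "C > 0" "c > 0" "\<And>t. t \<ge> 0 \<Longrightarrow> norm (matrix_exp (t *\<^sub>R B)) \<le> C * exp (- c * t)"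
proof -
  from matrix_exp_vector_decay[OF ev] have
    "\<forall>j. \<exists>C c. c > 0 \<and> (\<forall>t\<ge>0. norm (matrix_exp (t *\<^sub>R B) *v axis (j :: 'n) 1) \<le> C * exp (- c * t))"
    by blast
  then obtain C c where c: "\<And>j. c j > 0"
    and C: "\<And>j t. t \<ge> 0 \<Longrightarrow> norm (matrix_exp (t *\<^sub>R B) *v axis (j :: 'n) 1) \<le> C j * exp (- c j * t)"
    by metis
  define c' where "c' = Min (range c)"
  have c': "c' > 0" "\<And>j. c' \<le> c j" using c by (auto simp: c'_def)
  define K where "K = (\<Sum>i\<in>(UNIV :: 'n set). \<Sum>j\<in>(UNIV :: 'n set). \<bar>C j\<bar>) + 1"
  have K: "K > 0" unfolding K_def by (intro add_nonneg_pos sum_nonneg) auto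
  have "norm (matrix_exp (t *\<^sub>R B)) \<le> K * exp (- c' * t)" if t: "t \<ge> 0" for t
  proof -
    have "norm (matrix_exp (t *\<^sub>R B)) \<le> (\<Sum>i\<in>(UNIV::'n set). \<Sum>j\<in>UNIV. norm (matrix_exp (t *\<^sub>R B) *v axis j 1))"
      by (rule norm_matrix_le_columns)
    also have "\<dots> \<le> (\<Sum>i\<in>(UNIV::'n set). \<Sum>j\<in>(UNIV::'n set). \<bar>C j\<bar> * exp (- c' * t))"
    proof (intro sum_mono)
      fix i j :: 'n
      have "norm (matrix_exp (t *\<^sub>R B) *v axis j 1) \<le> C j * exp (- c j * t)" by (rule C[OF t])
      also have "\<dots> \<le> \<bar>C j\<bar> * exp (- c' * t)"
        using t c'(2)[of j] by (intro mult_mono) (auto intro: mult_right_mono)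
      finally show "norm (matrix_exp (t *\<^sub>R B) *v axis j 1) \<le> \<bar>C j\<bar> * exp (- c' * t)" .
    qed
    also have "\<dots> = (\<Sum>i\<in>(UNIV::'n set). \<Sum>j\<in>(UNIV::'n set). \<bar>C j\<bar>) * exp (- c' * t)"
      by (simp add: sum_distrib_right)
    also have "\<dots> \<le> K * exp (- c' * t)" by (intro mult_right_mono) (auto simp: K_def)
    finally show ?thesis .
  qed
  with K c' show ?thesis by (intro that)
qed

section \<open>The stationary covariance and the Lyapunov equation\<close>

declare transpose_matrix_vector [simp del]

lemma inner_matrix_transpose: "(A *v x) \<bullet> y = x \<bullet> (transpose A *v y)" for A :: "real ^ 'n ^ 'm"
  by (metis dot_lmul_matrix inner_commute vector_transpose_matrix)

lemma inner_symmetric_matrix: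
  "transpose A = A \<Longrightarrow> (A *v x) \<bullet> y = x \<bullet> (A *v y)" for A :: "real ^ 'n ^ 'n"
  by (metis inner_matrix_transpose)

text \<open>The form attains a positive minimum on the unit sphere and is homogeneous.\<close>

lemma positive_definite_lower_bound:
  fixes A :: "real ^ 'n ^ 'n"
  assumes "positive_definite A"
  obtains a where "a > 0" "\<And>x. a * (norm x)\<^sup>2 \<le> (A *v x) \<bullet> x"
proof -
  have "continuous_on (sphere 0 1) (\<lambda>x :: real ^ 'n. (A *v x) \<bullet> x)"
    by (intro continuous_intros mv.continuous_on)
  moreover have "compact (sphere (0 :: real ^ 'n) 1)" by simp
  moreover have "sphere (0 :: real ^ 'n) 1 \<noteq> {}" by simp
  ultimately obtain x0 where x0: "x0 \<in> sphere 0 1"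
    and min: "\<And>x. x \<in> sphere 0 1 \<Longrightarrow> (A *v x0) \<bullet> x0 \<le> (A *v x) \<bullet> x"
    using continuous_attains_inf by (metis (no_types, lifting))
  define a where "a = (A *v x0) \<bullet> x0"
  have "x0 \<noteq> 0" using x0 by auto
  then have "a > 0" using assms by (simp add: a_def positive_definite_def)
  moreover have "a * (norm x)\<^sup>2 \<le> (A *v x) \<bullet> x" for x
  proof (cases "x = 0")
    case False
    then have "a \<le> (A *v ((1 / norm x) *\<^sub>R x)) \<bullet> ((1 / norm x) *\<^sub>R x)"
      unfolding a_def by (intro min) simp
    also have "\<dots> = ((A *v x) \<bullet> x) / (norm x)\<^sup>2"
      by (simp add: mv.scaleR_right power2_eq_square)
    finally show ?thesis using False by (simp add: field_simps)
  qed (simp add: mv.zero_right)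
  ultimately show ?thesis by (rule that)
qed

lemma quadratic_form_upper_bound:
  fixes A :: "real ^ 'n ^ 'n"
  obtains a where "a > 0" "\<And>x. (A *v x) \<bullet> x \<le> a * (norm x)\<^sup>2"
proof -
  obtain K where K: "K > 0" "\<And>(A :: real ^ 'n ^ 'n) x. norm (A *v x) \<le> norm A * norm x * K"
    using mv.pos_bounded by blast
  have "(A *v x) \<bullet> x \<le> ((norm A + 1) * K) * (norm x)\<^sup>2" for x
  proof -
    have "(A *v x) \<bullet> x \<le> norm (A *v x) * norm x" by (rule norm_cauchy_schwarz)
    also have "\<dots> \<le> ((norm A + 1) * norm x * K) * norm x"
    proof (intro mult_right_mono)
      show "norm (A *v x) \<le> (norm A + 1) * norm x * K"
        by (rule order_trans[OF K(2)]) (use K(1) in \<open>intro mult_right_mono; simp\<close>)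
    qed auto
    finally show ?thesis by (simp add: power2_eq_square mult_ac)
  qed
  moreover have "(norm A + 1) * K > 0" using K(1) norm_ge_zero[of A]
    by (intro mult_pos_pos add_nonneg_pos) auto
  ultimately show ?thesis using that by blast
qed

lemma positive_definite_invertible:
  fixes A :: "real ^ 'n ^ 'n"
  assumes "positive_definite A"
  shows "invertible A"
proof -
  have "\<forall>x. A *v x = 0 \<longrightarrow> x = 0"
  proof (intro allI impI)
    fix x assume "A *v x = 0"
    then have "(A *v x) \<bullet> x = 0" by simp
    then show "x = 0" using assms unfolding positive_definite_def by force
  qed
  then show ?thesis
    by (metis invertible_def matrix_left_invertible_ker matrix_left_right_inverse)
qed

lemma matrix_inv_mult:
  fixes A :: "real ^ 'n ^ 'n"
  assumes "invertible A"
  shows "A ** matrix_inv A = mat 1" "matrix_inv A ** A = mat 1"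
proof -
  have "A ** matrix_inv A = mat 1 \<and> matrix_inv A ** A = mat 1"
    unfolding matrix_inv_def using assms[unfolded invertible_def] by (rule someI_ex)
  then show "A ** matrix_inv A = mat 1" "matrix_inv A ** A = mat 1" by auto
qed

lemma matrix_inv_eqI:
  fixes A :: "real ^ 'n ^ 'n"
  assumes "A ** C = mat 1"
  shows "matrix_inv A = C" "invertible A"
proof -
  have C: "C ** A = mat 1" using assms by (simp add: matrix_left_right_inverse)
  show i: "invertible A" unfolding invertible_def using assms C by blast
  have "matrix_inv A = (matrix_inv A ** A) ** C"
    by (simp add: matrix_mul_assoc[symmetric] assms)
  then show "matrix_inv A = C" by (simp add: matrix_inv_mult[OF i])
qed

lemma norm_transpose: "norm (transpose A) = norm (A :: real ^ 'm ^ 'k)"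
proof -
  have "(norm (transpose A))\<^sup>2 = (norm A)\<^sup>2"
    unfolding power2_norm_eq_inner inner_vec_def[where 'a = "real ^ 'k"] inner_vec_def[where 'a = "real ^ 'm"]
      inner_vec_def[where 'a = real] by (subst sum.swap) (simp add: transpose_def)
  then show ?thesis by simp
qed

locale stable_pair =
  fixes Q B :: "real ^ 'n ^ 'n"
  assumes Q_symmetric: "symmetric_matrix Q"
    and Q_pos: "positive_definite Q"
    and B_stable: "complex_eigenvalue B z \<Longrightarrow> Re z < 0"
begin

definition F :: "real \<Rightarrow> real ^ 'n ^ 'n" where "F t = matrix_exp (t *\<^sub>R B)"

definition cov :: "real ^ 'n ^ 'n" where "cov = OU_cov Q B \<infinity>"

text \<open>The integrand of the covariance; it solves \<open>G' = B G + G B\<^sup>T\<close> with \<open>G 0 = Q\<close>.\<close>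

definition G :: "real \<Rightarrow> real ^ 'n ^ 'n" where "G s = F s ** Q ** transpose (F s)"

lemma F_0 [simp]: "F 0 = mat 1" by (simp add: F_def)

lemma F_add: "F (s + t) = F s ** F t" by (simp add: F_def matrix_exp_add)

lemma exp_transpose: "matrix_exp (t *\<^sub>R transpose B) = transpose (F t)"
  by (simp add: F_def matrix_exp_transpose flip: transpose_scalar)

lemma F_has_vector_derivative: "(F has_vector_derivative B ** F t) (at t within S)"
  unfolding F_def by (rule matrix_exp_has_vector_derivative)

lemma F_commute: "B ** F t = F t ** B"
  unfolding F_def by (rule matrix_exp_commute) (simp add: mm.scaleR_left mm.scaleR_right)

lemma FT_commute: "transpose (F t) ** transpose B = transpose B ** transpose (F t)"
  by (simp add: F_commute flip: matrix_transpose_mul)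

lemma FT_has_vector_derivative:
  "((\<lambda>t. transpose (F t)) has_vector_derivative transpose (F t) ** transpose B) (at t within S)"
  using bounded_linear.has_vector_derivative[OF bounded_linear_transpose F_has_vector_derivative]
  by (simp add: matrix_transpose_mul)

lemma F_conj_has_vector_derivative:
  "((\<lambda>t. F t ** X ** transpose (F t)) has_vector_derivative
      F t ** (B ** X + X ** transpose B) ** transpose (F t)) (at t within S)"
proof -
  have "((\<lambda>t. F t ** X) has_vector_derivative F t ** B ** X) (at t within S)"
    using bounded_linear.has_vector_derivative[OF mm.bounded_linear_left F_has_vector_derivative]
    by (simp add: F_commute)
  from mm.has_vector_derivative[OF this FT_has_vector_derivative]
  show ?thesis
    by (simp add: mm.add_left mm.add_right matrix_mul_assoc add.commute)
      (simp add: FT_commute flip: matrix_mul_assoc)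
qed

lemma QT: "transpose Q = Q" using Q_symmetric by (simp add: symmetric_matrix_def)

lemma F_decay: obtains C c where "C > 0" "c > 0" "\<And>t. t \<ge> 0 \<Longrightarrow> norm (F t) \<le> C * exp (- c * t)"
  using matrix_exp_decay[OF B_stable] unfolding F_def by blast

lemma conj_decay:
  obtains C c where "C > 0" "c > 0" "\<And>t. t \<ge> 0 \<Longrightarrow> norm (F t ** X ** transpose (F t)) \<le> C * exp (- c * t)"
proof -
  obtain C c where C: "C > 0" "c > 0" "\<And>t. t \<ge> 0 \<Longrightarrow> norm (F t) \<le> C * exp (- c * t)"
    using F_decay by blast
  obtain K where K: "K > 0" "\<And>(A :: real ^ 'n ^ 'n) (A' :: real ^ 'n ^ 'n). norm (A ** A') \<le> norm A * norm A' * K"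
    using mm.pos_bounded by blast
  have "norm (F t ** X ** transpose (F t)) \<le> (C * C * (norm X + 1) * K * K) * exp (- (2 * c) * t)" if t: "t \<ge> 0" for t
  proof -
    have "norm (F t ** X ** transpose (F t)) \<le> norm (F t ** X) * norm (F t) * K"
      using K(2)[of "F t ** X" "transpose (F t)"] by (simp add: norm_transpose)
    also have "\<dots> \<le> (norm (F t) * (norm X + 1) * K) * norm (F t) * K"
    proof -
      have "norm (F t ** X) \<le> norm (F t) * norm X * K" by (rule K)
      also have "\<dots> \<le> norm (F t) * (norm X + 1) * K"
        using K(1) by (intro mult_right_mono mult_left_mono) auto
      finally show ?thesis using K(1) by (intro mult_right_mono) auto
    qed
    also have "\<dots> \<le> ((C * exp (- c * t)) * (norm X + 1) * K) * (C * exp (- c * t)) * K"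
      using K(1) C(1) C(3)[OF t] by (intro mult_mono) auto
    also have "\<dots> = (C * C * (norm X + 1) * K * K) * exp (- (2 * c) * t)"
      by (simp add: exp_add[symmetric] algebra_simps)
    finally show ?thesis .
  qed
  moreover have "C * C * (norm X + 1) * K * K > 0"
    using C(1) K(1) norm_ge_zero[of X] by (intro mult_pos_pos add_nonneg_pos) auto
  ultimately show ?thesis using that C(2) by (metis mult_pos_pos zero_less_numeral)
qed

lemma conj_tendsto_0: "((\<lambda>t. F t ** X ** transpose (F t)) \<longlongrightarrow> 0) at_top"
proof -
  obtain C c where C: "C > 0" "c > 0" "\<And>t. t \<ge> 0 \<Longrightarrow> norm (F t ** X ** transpose (F t)) \<le> C * exp (- c * t)"
    using conj_decay[where X = X] by blast
  have "((\<lambda>t. C * exp (- (c * t))) \<longlongrightarrow> C * 0) at_top"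
    by (intro tendsto_mult tendsto_const filterlim_compose[OF exp_at_bot]
        filterlim_compose[OF filterlim_uminus_at_bot_at_top] filterlim_tendsto_pos_mult_at_top[OF tendsto_const C(2)]
        filterlim_ident)
  then have "((\<lambda>t. C * exp (- c * t)) \<longlongrightarrow> 0) at_top" by simp
  then show ?thesis
    by (rule Lim_null_comparison[rotated])
      (use C(3) in \<open>auto intro: eventually_at_top_linorderI[of 0]\<close>)
qed

lemma continuous_on_F [continuous_intros]: "continuous_on S F"
  using F_has_vector_derivative by (intro continuous_on_vector_derivative)

lemma continuous_on_FT [continuous_intros]: "continuous_on S (\<lambda>t. transpose (F t))"
  by (intro bounded_linear.continuous_on[OF bounded_linear_transpose] continuous_on_F)

lemma continuous_on_G: "continuous_on S G"
  unfolding G_def by (intro mm.continuous_on continuous_on_F continuous_on_FT continuous_on_const)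

lemma G_absolutely_integrable: "G absolutely_integrable_on {0..}"
proof -
  obtain C c where C: "C > 0" "c > 0" "\<And>t. t \<ge> 0 \<Longrightarrow> norm (G t) \<le> C * exp (- c * t)"
    unfolding G_def using conj_decay[where X = Q] by blast
  show ?thesis
  proof (rule measurable_bounded_by_integrable_imp_absolutely_integrable)
    show "G \<in> borel_measurable (lebesgue_on {0..})"
      by (rule continuous_imp_measurable_on_sets_lebesgue[OF continuous_on_G]) auto
    show "(\<lambda>t. C * exp (- c * t)) integrable_on {0..}"
      using integrable_on_exp_minus_to_infinity[OF C(2), of 0]
      by (simp add: integrable_on_mult_right)
  qed (use C in auto)
qed

lemma OU_cov_finite: "OU_cov Q B (ereal t) = integral {0..t} G"
  unfolding OU_cov_def by (rule arg_cong2[where f = integral]) (auto simp: G_def exp_transpose F_def)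

lemma cov_eq: "cov = integral {0..} G"
  unfolding cov_def OU_cov_def
  by (rule arg_cong2[where f = integral]) (auto simp: G_def exp_transpose F_def)

text \<open>Absolute integrability lets the integral over the half-line be computed as a limit.\<close>

lemma integral_G_tendsto: "((\<lambda>T. integral {0..T} G) \<longlongrightarrow> cov) at_top"
proof -
  have "((\<lambda>T. LINT x:{0..T}|lebesgue. G x) \<longlongrightarrow> (LINT x:{0..}|lebesgue. G x)) at_top"
    by (rule tendsto_set_lebesgue_integral_at_top[OF _ G_absolutely_integrable]) auto
  moreover have "(LINT x:{0..T}|lebesgue. G x) = integral {0..T} G" for T
    by (rule set_lebesgue_integral_eq_integral(2)[OF set_integrable_subset[OF G_absolutely_integrable]]) auto
  moreover have "(LINT x:{0..}|lebesgue. G x) = cov"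
    unfolding cov_eq by (rule set_lebesgue_integral_eq_integral(2)[OF G_absolutely_integrable])
  ultimately show ?thesis by simp
qed

text \<open>Integrating \<open>G' = B G + G B\<^sup>T\<close> over \<open>[0, T]\<close> and letting \<open>T\<close> tend to infinity gives the
  equation, because \<open>G\<close> decays from \<open>Q\<close> to zero.\<close>

lemma lyapunov: "B ** cov + cov ** transpose B = - Q"
proof -
  define L where "L = (\<lambda>X :: real ^ 'n ^ 'n. B ** X + X ** transpose B)"
  have bl: "bounded_linear L" unfolding L_def
    by (intro bounded_linear_add mm.bounded_linear_right mm.bounded_linear_left)
  have LG: "L (G t) = F t ** L Q ** transpose (F t)" for t
    by (simp add: L_def G_def mm.add_left mm.add_right matrix_mul_assoc F_commute)
      (metis (no_types, lifting) F_commute matrix_mul_assoc matrix_transpose_mul)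
  have dG: "(G has_vector_derivative L (G t)) (at t within S)" for t S
    unfolding LG using F_conj_has_vector_derivative[of Q t S] by (simp add: L_def G_def[abs_def])
  have int: "L (integral {0..T} G) = G T - Q" if "T \<ge> 0" for T
  proof -
    have "((\<lambda>t. L (G t)) has_integral (G T - G 0)) {0..T}"
      by (rule fundamental_theorem_of_calculus[OF that dG])
    moreover have "((L \<circ> G) has_integral L (integral {0..T} G)) {0..T}"
      by (rule has_integral_linear[OF _ bl])
        (simp add: integrable_integral integrable_continuous_real continuous_on_G)
    ultimately show ?thesis
      by (auto simp: o_def G_def dest: has_integral_unique)
  qed
  have "((\<lambda>T. L (integral {0..T} G)) \<longlongrightarrow> L cov) at_top"
    by (rule bounded_linear.tendsto[OF bl integral_G_tendsto])
  moreover have "((\<lambda>T. L (integral {0..T} G)) \<longlongrightarrow> 0 - Q) at_top"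
    by (rule Lim_transform_eventually[OF tendsto_diff[OF conj_tendsto_0[of Q] tendsto_const]])
      (auto intro!: eventually_at_top_linorderI[of 0] simp: int G_def)
  ultimately have "L cov = 0 - Q" by (intro tendsto_unique[OF _ _ _]) auto
  then show ?thesis by (simp add: L_def)
qed

text \<open>By the Lyapunov equation \<open>- F t cov (F t)\<^sup>T\<close> is a primitive of \<open>G\<close>.\<close>

lemma OU_cov_eq:
  assumes "t \<ge> 0"
  shows "OU_cov Q B (ereal t) = cov - F t ** cov ** transpose (F t)"
proof -
  have "(G has_integral (- (F t ** cov ** transpose (F t)) - - (F 0 ** cov ** transpose (F 0)))) {0..t}"
  proof (rule fundamental_theorem_of_calculus[OF assms])
    fix x
    show "((\<lambda>t. - (F t ** cov ** transpose (F t))) has_vector_derivative G x) (at x within {0..t})"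
      using has_vector_derivative_minus[OF F_conj_has_vector_derivative[of cov x "{0..t}"]]
      by (simp add: lyapunov G_def mm.minus_left mm.minus_right)
  qed
  then show ?thesis by (simp add: OU_cov_finite integral_unique)
qed

lemma cov_symmetric: "transpose cov = cov"
proof -
  have "transpose cov = integral {0..} (transpose \<circ> G)"
    unfolding cov_eq
    by (rule integral_linear[OF _ bounded_linear_transpose, symmetric])
      (use G_absolutely_integrable in \<open>auto intro: set_lebesgue_integral_eq_integral(1)\<close>)
  also have "transpose \<circ> G = G"
    by (auto simp: fun_eq_iff G_def matrix_transpose_mul QT matrix_mul_assoc)
  finally show ?thesis by (simp add: cov_eq)
qed

lemma FT_inverse: "transpose (F (- t)) ** transpose (F t) = mat 1"
  by (simp add: F_add[of t "- t", symmetric] flip: matrix_transpose_mul)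

text \<open>The quadratic form of the covariance strictly decreases to zero along trajectories of the
  adjoint flow, so it is positive.\<close>

lemma cov_pos: "positive_definite cov"
  unfolding positive_definite_def
proof (intro allI impI)
  fix x :: "real ^ 'n" assume x: "x \<noteq> 0"
  define f where "f = (\<lambda>t. ((F t ** cov ** transpose (F t)) *v x) \<bullet> x)"
  define f' where "f' = (\<lambda>t. - ((Q *v (transpose (F t) *v x)) \<bullet> (transpose (F t) *v x)))"
  have bl: "bounded_linear (\<lambda>X :: real ^ 'n ^ 'n. (X *v x) \<bullet> x)"
    by (intro bounded_linear_intros mv.bounded_linear_left)
  have d: "(f has_real_derivative f' t) (at t)" for t
    unfolding has_real_derivative_iff_has_vector_derivative f_def
    using bounded_linear.has_vector_derivative[OF bl F_conj_has_vector_derivative[of cov t UNIV]]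
    by (simp add: lyapunov f'_def mm.minus_left mm.minus_right mv.minus_left inner_matrix_transpose[of "F t"]
        flip: matrix_vector_mul_assoc)
  have neg: "f' t < 0" for t
  proof -
    have "transpose (F t) *v x \<noteq> 0"
      by (metis FT_inverse matrix_vector_mul_assoc matrix_vector_mul_lid mv.zero_right x)
    then show ?thesis using Q_pos by (simp add: f'_def positive_definite_def)
  qed
  have dec: "f b < f a" if "a < b" for a b
    using DERIV_neg_imp_decreasing[OF that, of f] d neg by blast
  have "(f \<longlongrightarrow> (0 *v x) \<bullet> x) at_top"
    unfolding f_def by (intro bounded_linear.tendsto[OF bl] conj_tendsto_0)
  then have "f 1 \<ge> 0"
    by (intro tendsto_upperbound[of f 0 at_top "f 1"])
      (auto simp: mv.zero_left intro!: eventually_at_top_linorderI[of 1] dest: dec simp: less_eq_real_def)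
  then have "f 0 > 0" using dec[of 0 1] by simp
  then show "0 < (cov *v x) \<bullet> x" by (simp add: f_def)
qed

definition P :: "real ^ 'n ^ 'n" where "P = matrix_inv cov"

lemma cov_P [simp]: "cov ** P = mat 1" "P ** cov = mat 1"
  unfolding P_def using matrix_inv_mult positive_definite_invertible[OF cov_pos] by auto

lemma cov_P_vec [simp]: "cov *v (P *v x) = x" "P *v (cov *v x) = x"
  by (simp_all add: matrix_vector_mul_assoc)

lemma P_symmetric: "transpose P = P"
proof -
  have "transpose (cov ** P) = mat 1" by simp
  then have "transpose P ** cov = mat 1" by (simp only: matrix_transpose_mul cov_symmetric)
  then have "(transpose P ** cov) ** P = P" by simp
  then show ?thesis by (simp add: matrix_mul_assoc[symmetric])
qed

lemma P_inner: "(P *v x) \<bullet> y = x \<bullet> (P *v y)"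
  by (rule inner_symmetric_matrix[OF P_symmetric])

lemma P_pos: "positive_definite P"
  unfolding positive_definite_def
proof (intro allI impI)
  fix x :: "real ^ 'n" assume "x \<noteq> 0"
  then have "P *v x \<noteq> 0" by (metis cov_P_vec(1) mv.zero_right)
  then have "0 < (cov *v (P *v x)) \<bullet> (P *v x)" using cov_pos unfolding positive_definite_def by blast
  then show "0 < (P *v x) \<bullet> x" by (simp add: inner_commute)
qed

end

section \<open>The Lyapunov norm and the contracting flow\<close>

text \<open>Gronwall's inequality: \<open>exp (a t) f t\<close> is nonincreasing.\<close>

lemma exponential_decay_bound:
  fixes f :: "real \<Rightarrow> real"
  assumes "\<And>t. (f has_real_derivative f' t) (at t)" "\<And>t. f' t \<le> - (a * f t)" "t \<ge> 0"
  shows "f t \<le> exp (- a * t) * f 0"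
proof -
  have "exp (a * t) * f t \<le> exp (a * 0) * f 0"
  proof (rule DERIV_nonpos_imp_nonincreasing[OF assms(3)])
    fix x
    have "((\<lambda>t. exp (a * t) * f t) has_real_derivative exp (a * x) * (a * f x + f' x)) (at x)"
      by (auto intro!: derivative_eq_intros assms(1) simp: algebra_simps)
    moreover have "exp (a * x) * (a * f x + f' x) \<le> 0"
      using assms(2)[of x] by (intro mult_nonneg_nonpos) auto
    ultimately show "\<exists>y. ((\<lambda>t. exp (a * t) * f t) has_real_derivative y) (at x) \<and> y \<le> 0" by blast
  qed
  then show ?thesis by (simp add: exp_minus field_simps)
qed

lemma exponential_decay_lower_bound:
  fixes f :: "real \<Rightarrow> real"
  assumes "\<And>t. (f has_real_derivative f' t) (at t)" "\<And>t. - (a * f t) \<le> f' t" "t \<ge> 0"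
  shows "exp (- a * t) * f 0 \<le> f t"
  using exponential_decay_bound[of "\<lambda>t. - f t" "\<lambda>t. - f' t" a t, OF DERIV_minus[OF assms(1)]] assms(3)
    minus_le_iff[THEN iffD1, OF assms(2)]
  by simp

context stable_pair
begin

text \<open>Twice the function \<open>R\<close> of the kernel, and the norm belonging to it. The matrix flows \<open>E\<close> and \<open>F\<close>
  both contract this norm with constant one; for the Euclidean norm this fails in general.\<close>

definition rho2 :: "real ^ 'n \<Rightarrow> real" where "rho2 x = (P *v x) \<bullet> x"

definition rho :: "real ^ 'n \<Rightarrow> real" where "rho x = sqrt (rho2 x)"

lemma rho2_nonneg [simp]: "0 \<le> rho2 x"
  using P_pos unfolding rho2_def positive_definite_def
  by (cases "x = 0") (auto simp: mv.zero_right less_imp_le)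

lemma rho2_eq_0_iff [simp]: "rho2 x = 0 \<longleftrightarrow> x = 0"
  using P_pos unfolding rho2_def positive_definite_def
  by (cases "x = 0") (force simp: mv.zero_right)+

lemma rho_nonneg [simp]: "0 \<le> rho x" by (simp add: rho_def)
lemma rho_power2 [simp]: "(rho x)\<^sup>2 = rho2 x" by (simp add: rho_def)
lemma rho_eq_0_iff [simp]: "rho x = 0 \<longleftrightarrow> x = 0" by (simp add: rho_def)
lemma rho2_0 [simp]: "rho2 0 = 0" by simp
lemma rho_0 [simp]: "rho 0 = 0" by simp

lemma rho2_scaleR: "rho2 (c *\<^sub>R x) = c\<^sup>2 * rho2 x"
  by (simp add: rho2_def mv.scaleR_right power2_eq_square)

lemma rho_scaleR: "rho (c *\<^sub>R x) = \<bar>c\<bar> * rho x"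
  by (simp add: rho_def rho2_scaleR real_sqrt_mult)

lemma rho_minus [simp]: "rho (- x) = rho x"
  using rho_scaleR[of "-1" x] by simp

lemma rho_diff_commute: "rho (x - y) = rho (y - x)"
  using rho_minus[of "x - y"] by simp

lemma rho2_add: "rho2 (x + y) = rho2 x + 2 * ((P *v x) \<bullet> y) + rho2 y"
proof -
  have "(P *v y) \<bullet> x = (P *v x) \<bullet> y" by (metis P_inner inner_commute)
  then show ?thesis by (simp add: rho2_def mv.add_right inner_add_left inner_add_right)
qed

text \<open>The form is nonnegative at \<open>rho y x - rho x y\<close>.\<close>

lemma P_cauchy_schwarz: "(P *v x) \<bullet> y \<le> rho x * rho y"
proof (cases "x = 0 \<or> y = 0")
  case True then show ?thesis by (auto simp: mv.zero_right)
next
  case False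
  then have pos: "rho x > 0" "rho y > 0" by (simp_all add: less_le)
  have "0 \<le> rho2 (rho y *\<^sub>R x + (- rho x) *\<^sub>R y)" by simp
  also have "\<dots> = 2 * (rho x * rho y) * (rho x * rho y - (P *v x) \<bullet> y)"
    unfolding rho2_add rho2_scaleR
    by (simp add: mv.scaleR_right flip: rho_power2) (simp add: power2_eq_square algebra_simps)
  finally show ?thesis
    using pos mult_le_cancel_left_pos[of "2 * (rho x * rho y)" 0 "rho x * rho y - (P *v x) \<bullet> y"] by simp
qed

lemma rho_triangle: "rho (x + y) \<le> rho x + rho y"
proof -
  have "(rho (x + y))\<^sup>2 \<le> (rho x + rho y)\<^sup>2"
    using P_cauchy_schwarz[of x y] by (simp add: rho2_add power2_sum mult.assoc)
  then show ?thesis by (rule power2_le_imp_le) simp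
qed

lemma rho_triangle_diff: "rho (x - z) \<le> rho (x - y) + rho (y - z)"
  using rho_triangle[of "x - y" "y - z"] by simp

lemma rho_abs_diff: "\<bar>rho x - rho y\<bar> \<le> rho (x - y)"
  using rho_triangle[of "x - y" y] rho_triangle[of "y - x" x] rho_diff_commute[of x y] by simp

lemma rho_norm_equivalent:
  "\<exists>m M. 0 < m \<and> 0 < M \<and> (\<forall>x. m * norm x \<le> rho x \<and> rho x \<le> M * norm x)"
proof -
  obtain a where a: "a > 0" "\<And>x. a * (norm x)\<^sup>2 \<le> (P *v x) \<bullet> x"
    using positive_definite_lower_bound[OF P_pos] by blast
  obtain b where b: "b > 0" "\<And>x. (P *v x) \<bullet> x \<le> b * (norm x)\<^sup>2"
    using quadratic_form_upper_bound[of P] by blast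
  have "sqrt a * norm x \<le> rho x \<and> rho x \<le> sqrt b * norm x" for x
    using real_sqrt_le_mono[OF a(2)[of x]] real_sqrt_le_mono[OF b(2)[of x]]
    by (simp add: rho_def rho2_def real_sqrt_mult)
  with a b show ?thesis by (intro exI[of _ "sqrt a"] exI[of _ "sqrt b"]) auto
qed

text \<open>Constants of the norm equivalence, fixed once and for all.\<close>

definition m_lo :: real where
  "m_lo = (SOME m. 0 < m \<and> (\<exists>M>0. \<forall>x. m * norm x \<le> rho x \<and> rho x \<le> M * norm x))"

definition m_hi :: real where
  "m_hi = (SOME M. 0 < M \<and> (\<forall>x. m_lo * norm x \<le> rho x \<and> rho x \<le> M * norm x))"

lemma m_lo_hi: "0 < m_lo" "0 < m_hi" "m_lo * norm x \<le> rho x" "rho x \<le> m_hi * norm x"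
proof -
  have 1: "0 < m_lo \<and> (\<exists>M>0. \<forall>x. m_lo * norm x \<le> rho x \<and> rho x \<le> M * norm x)"
    unfolding m_lo_def by (rule someI_ex) (use rho_norm_equivalent in blast)
  then have 2: "0 < m_hi \<and> (\<forall>x. m_lo * norm x \<le> rho x \<and> rho x \<le> m_hi * norm x)"
    unfolding m_hi_def by - (rule someI_ex, blast)
  from 1 2 show "0 < m_lo" "0 < m_hi" "m_lo * norm x \<le> rho x" "rho x \<le> m_hi * norm x" by auto
qed

lemma continuous_on_rho2 [continuous_intros]: "continuous_on S f \<Longrightarrow> continuous_on S (\<lambda>x. rho2 (f x))"
  unfolding rho2_def by (intro continuous_intros mv.continuous_on)

lemma continuous_on_rho [continuous_intros]: "continuous_on S f \<Longrightarrow> continuous_on S (\<lambda>x. rho (f x))"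
  unfolding rho_def by (intro continuous_intros)

text \<open>The group conjugate to the adjoint group; \<open>E t\<close> is the inverse of the matrix \<open>D\<^sub>t\<close> of the kernel, so it
  contracts where \<open>D\<^sub>t\<close> expands.\<close>

definition E :: "real \<Rightarrow> real ^ 'n ^ 'n" where "E t = cov ** transpose (F t) ** P"

definition gen :: "real ^ 'n ^ 'n" where "gen = cov ** transpose B ** P"

lemma OU_D_eq: "OU_D Q B t = E (- t)"
  unfolding OU_D_def E_def cov_def[symmetric] P_def[symmetric] exp_transpose ..

lemma OU_R_eq: "OU_R Q B x = rho2 x / 2"
  by (simp add: OU_R_def rho2_def P_def cov_def)

lemma E_0 [simp]: "E 0 = mat 1" by (simp add: E_def)

lemma E_add: "E (s + t) = E s ** E t"
proof -
  have "E s ** E t = cov ** transpose (F s) ** (P ** cov) ** transpose (F t) ** P"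
    by (simp only: E_def matrix_mul_assoc)
  also have "\<dots> = cov ** (transpose (F s) ** transpose (F t)) ** P"
    by (simp add: matrix_mul_assoc)
  also have "transpose (F s) ** transpose (F t) = transpose (F (s + t))"
    by (metis F_add add.commute matrix_transpose_mul)
  finally show ?thesis by (simp add: E_def)
qed

lemma E_add_vec: "E (s + t) *v x = E s *v (E t *v x)"
  by (simp add: E_add matrix_vector_mul_assoc)

lemma E_minus_mult [simp]: "E (- t) ** E t = mat 1" "E t ** E (- t) = mat 1"
  by (simp_all flip: E_add)

lemma E_minus_vec [simp]: "E (- t) *v (E t *v x) = x" "E t *v (E (- t) *v x) = x"
  by (simp_all add: matrix_vector_mul_assoc)

lemma E_has_vector_derivative: "(E has_vector_derivative gen ** E t) (at t within S)"
proof -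
  have bl: "bounded_linear (\<lambda>X :: real ^ 'n ^ 'n. cov ** X ** P)"
    using bounded_linear_compose[OF mm.bounded_linear_left mm.bounded_linear_right] .
  have "gen ** E t = cov ** transpose B ** (P ** cov) ** transpose (F t) ** P"
    by (simp only: E_def gen_def matrix_mul_assoc)
  also have "\<dots> = cov ** (transpose (F t) ** transpose B) ** P"
    by (simp add: FT_commute matrix_mul_assoc)
  finally show ?thesis
    using bounded_linear.has_vector_derivative[OF bl FT_has_vector_derivative]
    by (simp add: E_def[abs_def])
qed

lemma E_vec_has_vector_derivative:
  "((\<lambda>t. E t *v x) has_vector_derivative gen *v (E t *v x)) (at t within S)"
  using bounded_linear.has_vector_derivative[OF mv.bounded_linear_left E_has_vector_derivative]
  by (simp add: matrix_vector_mul_assoc)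

lemma continuous_on_E: "continuous_on S E"
  using E_has_vector_derivative by (intro continuous_on_vector_derivative)

lemma continuous_on_E_vec [continuous_intros]:
  "continuous_on S f \<Longrightarrow> continuous_on S g \<Longrightarrow> continuous_on S (\<lambda>s. E (f s) *v g s)"
  by (intro mv.continuous_on continuous_on_compose2[OF continuous_on_E]) auto

text \<open>The rate of decrease of \<open>rho2\<close> along the orbits of \<open>E\<close> as well as of \<open>F\<close>.\<close>

definition dissipation :: "real ^ 'n \<Rightarrow> real" where
  "dissipation x = (Q *v (P *v x)) \<bullet> (P *v x)"

lemma rho2_curve_derivative:
  assumes "(f has_vector_derivative f') (at t)"
  shows "((\<lambda>t. rho2 (f t)) has_real_derivative 2 * ((P *v f t) \<bullet> f')) (at t)"
proof -
  have "((\<lambda>t. (P *v f t) \<bullet> f t) has_vector_derivative (P *v f t) \<bullet> f' + (P *v f') \<bullet> f t) (at t)"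
    by (intro bounded_bilinear.has_vector_derivative[OF bounded_bilinear_inner] assms
        bounded_linear.has_vector_derivative[OF mv.bounded_linear_right])
  moreover have "(P *v f') \<bullet> f t = (P *v f t) \<bullet> f'" by (metis P_inner inner_commute)
  ultimately show ?thesis
    by (simp add: has_real_derivative_iff_has_vector_derivative rho2_def)
qed

text \<open>The scalar \<open>y \<bullet> B cov y\<close> sees only the symmetric part of \<open>B cov\<close>, which the Lyapunov equation
  gives.\<close>

lemma lyapunov_form: "2 * (y \<bullet> (B *v (cov *v y))) = - ((Q *v y) \<bullet> y)"
proof -
  have "y \<bullet> (B *v (cov *v y)) = (cov *v (transpose B *v y)) \<bullet> y"
    by (metis inner_matrix_transpose cov_symmetric inner_commute)
  moreover have "(B ** cov + cov ** transpose B) *v y = - (Q *v y)"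
    by (simp add: lyapunov mv.minus_left)
  then have "(B *v (cov *v y)) \<bullet> y + (cov *v (transpose B *v y)) \<bullet> y = - ((Q *v y) \<bullet> y)"
    by (simp add: mv.add_left matrix_vector_mul_assoc flip: inner_add_left)
  ultimately show ?thesis by (simp add: inner_commute)
qed

lemma rho2_E_derivative:
  "((\<lambda>t. rho2 (E t *v x)) has_real_derivative - dissipation (E t *v x)) (at t)"
proof -
  define y where "y = P *v (E t *v x)"
  have "gen *v (E t *v x) = cov *v (transpose B *v y)"
    by (simp only: gen_def y_def matrix_vector_mul_assoc matrix_mul_assoc)
  then have "y \<bullet> (gen *v (E t *v x)) = (cov *v y) \<bullet> (transpose B *v y)"
    by (simp only: inner_symmetric_matrix[OF cov_symmetric])
  also have "\<dots> = y \<bullet> (B *v (cov *v y))"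
    using inner_matrix_transpose[of B "cov *v y" y] by (simp only: inner_commute)
  finally have "2 * (y \<bullet> (gen *v (E t *v x))) = - ((Q *v y) \<bullet> y)"
    by (simp only: lyapunov_form)
  with rho2_curve_derivative[OF E_vec_has_vector_derivative[of x t UNIV]]
  show ?thesis by (simp only: y_def dissipation_def)
qed

lemma rho2_F_derivative:
  "((\<lambda>t. rho2 (F t *v x)) has_real_derivative - dissipation (F t *v x)) (at t)"
proof -
  define y where "y = P *v (F t *v x)"
  have d: "((\<lambda>t. F t *v x) has_vector_derivative B *v (F t *v x)) (at t)"
    using bounded_linear.has_vector_derivative[OF mv.bounded_linear_left F_has_vector_derivative]
    by (simp add: matrix_vector_mul_assoc)
  have "B *v (F t *v x) = B *v (cov *v y)" by (simp add: y_def)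
  then have "2 * (y \<bullet> (B *v (F t *v x))) = - ((Q *v y) \<bullet> y)" by (simp only: lyapunov_form)
  with rho2_curve_derivative[OF d] show ?thesis by (simp only: y_def dissipation_def)
qed

lemma dissipation_bounds:
  "\<exists>k K. 0 < k \<and> 0 < K \<and> (\<forall>x. 2 * k * rho2 x \<le> dissipation x \<and> dissipation x \<le> 2 * K * rho2 x)"
proof -
  obtain q where q: "q > 0" "\<And>x. q * (norm x)\<^sup>2 \<le> (Q *v x) \<bullet> x"
    using positive_definite_lower_bound[OF Q_pos] by blast
  obtain q' where q': "q' > 0" "\<And>x. (Q *v x) \<bullet> x \<le> q' * (norm x)\<^sup>2"
    using quadratic_form_upper_bound[of Q] by blast
  obtain a where a: "a > 0" "\<And>x. a * (norm x)\<^sup>2 \<le> (cov *v x) \<bullet> x"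
    using positive_definite_lower_bound[OF cov_pos] by blast
  obtain b where b: "b > 0" "\<And>x. (cov *v x) \<bullet> x \<le> b * (norm x)\<^sup>2"
    using quadratic_form_upper_bound[of cov] by blast
  have r: "rho2 x = (cov *v (P *v x)) \<bullet> (P *v x)" for x by (simp add: rho2_def inner_commute)
  have "2 * (q / (2 * b)) * rho2 x \<le> dissipation x" for x
  proof -
    have "2 * (q / (2 * b)) * rho2 x \<le> 2 * (q / (2 * b)) * (b * (norm (P *v x))\<^sup>2)"
      unfolding r by (intro mult_left_mono b) (use q b in auto)
    also have "\<dots> = q * (norm (P *v x))\<^sup>2" using b by simp
    also have "\<dots> \<le> dissipation x" unfolding dissipation_def by (rule q)
    finally show ?thesis .
  qed
  moreover have "dissipation x \<le> 2 * (q' / (2 * a)) * rho2 x" for x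
  proof -
    have "dissipation x \<le> q' * (norm (P *v x))\<^sup>2" unfolding dissipation_def by (rule q')
    also have "\<dots> = 2 * (q' / (2 * a)) * (a * (norm (P *v x))\<^sup>2)" using a by simp
    also have "\<dots> \<le> 2 * (q' / (2 * a)) * rho2 x"
      unfolding r by (intro mult_left_mono a) (use q' a in auto)
    finally show ?thesis .
  qed
  ultimately show ?thesis using q q' a b
    by (intro exI[of _ "q / (2 * b)"] exI[of _ "q' / (2 * a)"]) auto
qed

text \<open>Lower and upper bounds for the relative rate of decrease of \<open>rho\<close> along the flow.\<close>

definition k_lo :: real where
  "k_lo = (SOME k. 0 < k \<and> (\<forall>x. 2 * k * rho2 x \<le> dissipation x))"

definition k_hi :: real where
  "k_hi = (SOME K. 0 < K \<and> (\<forall>x. dissipation x \<le> 2 * K * rho2 x))"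

lemma k_lo: "0 < k_lo" "2 * k_lo * rho2 x \<le> dissipation x"
proof -
  have "0 < k_lo \<and> (\<forall>x. 2 * k_lo * rho2 x \<le> dissipation x)"
    unfolding k_lo_def by (rule someI_ex) (use dissipation_bounds in blast)
  then show "0 < k_lo" "2 * k_lo * rho2 x \<le> dissipation x" by auto
qed

lemma k_hi: "0 < k_hi" "dissipation x \<le> 2 * k_hi * rho2 x"
proof -
  have "0 < k_hi \<and> (\<forall>x. dissipation x \<le> 2 * k_hi * rho2 x)"
    unfolding k_hi_def by (rule someI_ex) (use dissipation_bounds in blast)
  then show "0 < k_hi" "dissipation x \<le> 2 * k_hi * rho2 x" by auto
qed

lemma rho2_E_le: "t \<ge> 0 \<Longrightarrow> rho2 (E t *v x) \<le> exp (- (2 * k_lo) * t) * rho2 x"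
  using exponential_decay_bound[OF rho2_E_derivative[of x], where a = "2 * k_lo"] k_lo by simp

lemma rho2_E_ge: "t \<ge> 0 \<Longrightarrow> exp (- (2 * k_hi) * t) * rho2 x \<le> rho2 (E t *v x)"
  using exponential_decay_lower_bound[OF rho2_E_derivative[of x], where a = "2 * k_hi"] k_hi by simp

lemma rho2_F_le: "t \<ge> 0 \<Longrightarrow> rho2 (F t *v x) \<le> exp (- (2 * k_lo) * t) * rho2 x"
  using exponential_decay_bound[OF rho2_F_derivative[of x], where a = "2 * k_lo"] k_lo by simp

lemma sqrt_exp_double: "sqrt (exp (- (2 * k) * t) * a) = exp (- k * t) * sqrt a"
proof -
  have sq: "exp (- (2 * k) * t) = (exp (- k * t))\<^sup>2"
    by (simp add: power2_eq_square flip: exp_add)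
  show ?thesis by (simp only: sq real_sqrt_mult real_sqrt_abs abs_exp_cancel)
qed

lemma rho_E_le: "t \<ge> 0 \<Longrightarrow> rho (E t *v x) \<le> exp (- k_lo * t) * rho x"
  unfolding rho_def using real_sqrt_le_mono[OF rho2_E_le[of t x]] by (simp only: sqrt_exp_double)

lemma rho_E_ge: "t \<ge> 0 \<Longrightarrow> exp (- k_hi * t) * rho x \<le> rho (E t *v x)"
  unfolding rho_def using real_sqrt_le_mono[OF rho2_E_ge[of t x]] by (simp only: sqrt_exp_double)

lemma rho_E_contract: "t \<ge> 0 \<Longrightarrow> rho (E t *v x) \<le> rho x"
proof (rule order_trans[OF rho_E_le])
  assume "t \<ge> 0"
  then have "exp (- k_lo * t) \<le> 1" using k_lo(1) by (simp add: mult_nonneg_nonneg less_imp_le)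
  then show "exp (- k_lo * t) * rho x \<le> rho x" by (rule mult_left_le_one_le[OF rho_nonneg exp_ge_zero])
qed

text \<open>Although \<open>rho\<close> is not differentiable at the origin, it is differentiable along every orbit,
  since the only orbit through the origin is constant.\<close>

lemma rho_E_derivative:
  "\<exists>d. ((\<lambda>t. rho (E t *v x)) has_real_derivative d) (at t) \<and> d \<le> - (k_lo * rho (E t *v x))"
proof (cases "x = 0")
  case True
  then show ?thesis by (intro exI[of _ 0]) (auto simp: mv.zero_right)
next
  case False
  define v where "v = E t *v x"
  have "v \<noteq> 0" unfolding v_def by (metis False E_minus_vec(1) mv.zero_right)
  then have r: "rho v > 0" "rho2 v > 0" by (simp_all add: less_le)
  define g where "g = (\<lambda>t. rho2 (E t *v x))"
  have g: "(g has_real_derivative - dissipation v) (at t)" "g t > 0"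
    using rho2_E_derivative[of x t] r(2) by (simp_all only: g_def v_def)
  have "((\<lambda>t. sqrt (g t)) has_real_derivative inverse (sqrt (g t)) / 2 * (- dissipation v)) (at t)"
    by (rule DERIV_chain2[where f = sqrt and g = g, OF DERIV_real_sqrt[OF g(2)] g(1)])
  then have "((\<lambda>t. rho (E t *v x)) has_real_derivative inverse (rho v) / 2 * (- dissipation v)) (at t)"
    by (simp only: g_def rho_def v_def)
  moreover have "inverse (rho v) / 2 * (- dissipation v) = (- dissipation v) / (2 * rho v)"
    by (simp add: inverse_eq_divide)
  ultimately have "((\<lambda>t. rho (E t *v x)) has_real_derivative (- dissipation v) / (2 * rho v)) (at t)"
    by (simp only:)
  moreover have "(- dissipation v) / (2 * rho v) \<le> - (k_lo * rho v)"
  proof -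
    have "k_lo * rho v = 2 * k_lo * (rho v)\<^sup>2 / (2 * rho v)"
      using r(1) by (simp only: power2_eq_square) simp
    also have "\<dots> \<le> dissipation v / (2 * rho v)"
      using k_lo(2)[of v] r(1) by (intro divide_right_mono) auto
    finally show ?thesis by simp
  qed
  ultimately show ?thesis unfolding v_def by blast
qed

lemma rho_gen_bound: "\<exists>K>0. \<forall>v. rho (gen *v v) \<le> K * rho v"
proof -
  obtain K where K: "K > 0" "\<And>v. norm (gen *v v) \<le> norm v * K"
    using bounded_linear.pos_bounded[OF matrix_vector_mul_bounded_linear[of gen]] by blast
  have "rho (gen *v v) \<le> (m_hi * K / m_lo) * rho v" for v
  proof -
    have "rho (gen *v v) \<le> m_hi * (norm v * K)"
      by (rule order_trans[OF m_lo_hi(4)])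
        (intro mult_left_mono K(2) less_imp_le[OF m_lo_hi(2)])
    also have "\<dots> \<le> m_hi * ((rho v / m_lo) * K)"
      using m_lo_hi(1,2) m_lo_hi(3)[of v] K(1) by (intro mult_left_mono mult_right_mono) (auto simp: field_simps)
    finally show ?thesis by (simp add: field_simps)
  qed
  moreover have "m_hi * K / m_lo > 0" using m_lo_hi(1,2) K by simp
  ultimately show ?thesis by blast
qed

text \<open>Speed along the flow is comparable to the rate of decrease of \<open>rho\<close>, so chords of an
  orbit are controlled by the difference of their levels.\<close>

lemma orbit_chord_bound:
  "\<exists>K>0. \<forall>u s t. rho (E s *v u - E t *v u) \<le> K * \<bar>rho (E s *v u) - rho (E t *v u)\<bar>"
proof -
  obtain K where K: "K > 0" "\<And>v. norm (gen *v v) \<le> norm v * K"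
    using bounded_linear.pos_bounded[OF matrix_vector_mul_bounded_linear[of gen]] by blast
  define C where "C = K / m_lo / k_lo"
  have C: "C > 0" using K m_lo_hi(1) k_lo(1) by (simp add: C_def)
  have main: "norm (E t *v u - E s *v u) \<le> C * (rho (E s *v u) - rho (E t *v u))" if st: "s < t" for s t u
  proof -
    define r where "r = (\<lambda>t. rho (E t *v u))"
    obtain r' where r': "\<And>t. (r has_real_derivative r' t) (at t)" "\<And>t. r' t \<le> - (k_lo * r t)"
      using rho_E_derivative[of u] unfolding r_def by metis
    have "norm (E t *v u - E s *v u) \<le> (- C * r t) - (- C * r s)"
    proof (rule differentiable_bound_general[OF st])
      show "continuous_on {s..t} (\<lambda>t. E t *v u)" by (intro continuous_intros)
      show "continuous_on {s..t} (\<lambda>t. - C * r t)" unfolding r_def by (intro continuous_intros)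
      fix x
      show "((\<lambda>t. E t *v u) has_vector_derivative gen *v (E x *v u)) (at x)"
        by (rule E_vec_has_vector_derivative)
      show "((\<lambda>t. - C * r t) has_vector_derivative - C * r' x) (at x)"
        unfolding has_real_derivative_iff_has_vector_derivative[symmetric]
        by (auto intro!: derivative_eq_intros r')
      have "norm (gen *v (E x *v u)) \<le> norm (E x *v u) * K" by (rule K)
      also have "\<dots> \<le> (r x / m_lo) * K"
        using K(1) m_lo_hi(1) m_lo_hi(3)[of "E x *v u"]
        by (intro mult_right_mono) (auto simp: field_simps r_def)
      also have "\<dots> = C * (k_lo * r x)" using k_lo(1) by (simp add: C_def)
      also have "\<dots> \<le> C * (- r' x)" using C r'(2)[of x] by (intro mult_left_mono) auto
      finally show "norm (gen *v (E x *v u)) \<le> - C * r' x" by simp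
    qed
    then show ?thesis by (simp add: r_def algebra_simps)
  qed
  have "rho (E s *v u - E t *v u) \<le> (m_hi * C) * \<bar>rho (E s *v u) - rho (E t *v u)\<bar>" for s t u
  proof -
    define r where "r = (\<lambda>t. rho (E t *v u))"
    have ab: "C * (r a - r b) \<le> C * \<bar>r s - r t\<bar>" if "r a - r b \<le> \<bar>r s - r t\<bar>" for a b
      using C that by (intro mult_left_mono) auto
    have n: "norm (E s *v u - E t *v u) \<le> C * \<bar>r s - r t\<bar>"
    proof (cases s t rule: linorder_cases)
      case less
      have "norm (E s *v u - E t *v u) \<le> C * (r s - r t)"
        using main[OF less, of u] by (simp only: r_def norm_minus_commute)
      also have "\<dots> \<le> C * \<bar>r s - r t\<bar>" by (rule ab) simp
      finally show ?thesis .
    next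
      case greater
      have "norm (E s *v u - E t *v u) \<le> C * (r t - r s)"
        using main[OF greater, of u] by (simp only: r_def)
      also have "\<dots> \<le> C * \<bar>r s - r t\<bar>" by (rule ab) simp
      finally show ?thesis .
    qed simp
    have "rho (E s *v u - E t *v u) \<le> m_hi * norm (E s *v u - E t *v u)" by (rule m_lo_hi(4))
    also have "\<dots> \<le> m_hi * (C * \<bar>r s - r t\<bar>)"
      by (intro mult_left_mono n less_imp_le[OF m_lo_hi(2)])
    finally show ?thesis by (simp only: r_def mult.assoc)
  qed
  moreover have "m_hi * C > 0" using m_lo_hi(2) C by simp
  ultimately show ?thesis by blast
qed

end

section \<open>Determinants and inverses along curves of matrices\<close>

text \<open>The form is nonnegative at \<open>x - (b / c) y\<close>, the minimiser along the line through \<open>x\<close> in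
  direction \<open>y\<close>.\<close>

lemma positive_definite_cauchy_schwarz:
  fixes A :: "real ^ 'n ^ 'n"
  assumes A: "positive_definite A" "transpose A = A"
  shows "((A *v x) \<bullet> y)\<^sup>2 \<le> ((A *v x) \<bullet> x) * ((A *v y) \<bullet> y)"
proof (cases "y = 0")
  case True then show ?thesis by (simp add: mv.zero_right)
next
  case False
  define a b c where "a = (A *v x) \<bullet> x" and "b = (A *v x) \<bullet> y" and "c = (A *v y) \<bullet> y"
  have c: "c > 0" using A(1) False by (simp add: c_def positive_definite_def)
  have sym: "(A *v y) \<bullet> x = b"
    unfolding b_def by (metis A(2) inner_symmetric_matrix inner_commute)
  define v where "v = x + (- (b / c)) *\<^sub>R y"
  have "0 \<le> (A *v v) \<bullet> v"
    using A(1) unfolding positive_definite_def by (cases "v = 0") (auto simp: mv.zero_right less_imp_le)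
  also have "(A *v v) \<bullet> v = a - (b / c) * b - (b / c) * b + (b / c) * (b / c) * c"
    unfolding v_def mv.add_right mv.scaleR_right inner_add_left inner_add_right inner_scaleR_left
      inner_scaleR_right sym a_def[symmetric] b_def[symmetric] c_def[symmetric]
    by (simp add: algebra_simps)
  also have "\<dots> = a - b\<^sup>2 / c" using c by (simp add: power2_eq_square)
  finally have "b\<^sup>2 \<le> a * c" using c by (simp add: field_simps)
  then show ?thesis by (simp only: a_def b_def c_def)
qed

text \<open>The determinant is a polynomial in the entries, hence Lipschitz on bounded sets; the common
  bound is scaled to one so that the telescoping estimate for products applies.\<close>

lemma det_lipschitz:
  "\<exists>C>0. \<forall>(X :: real ^ 'n ^ 'n) (Y :: real ^ 'n ^ 'n). norm X \<le> K \<longrightarrow> norm Y \<le> K \<longrightarrow>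
     \<bar>det X - det Y\<bar> \<le> C * norm (X - Y)"
proof (cases "K > 0")
  case True
  define n where "n = CARD('n)"
  define C where "C = (\<Sum>p\<in>{p. p permutes (UNIV :: 'n set)}. K ^ n * (\<Sum>i\<in>(UNIV :: 'n set). 1 / K)) + 1"
  have C: "C > 0" unfolding C_def using True by (intro add_nonneg_pos sum_nonneg mult_nonneg_nonneg) auto
  have ent: "\<bar>X $ i $ j\<bar> \<le> norm X" for X :: "real ^ 'n ^ 'n" and i j
    by (metis Finite_Cartesian_Product.norm_nth_le order_trans real_norm_def)
  have "\<bar>det X - det Y\<bar> \<le> C * norm (X - Y)" if X: "norm X \<le> K" and Y: "norm Y \<le> K" for X Y :: "real ^ 'n ^ 'n"
  proof -
    have prod_bd: "\<bar>(\<Prod>i\<in>UNIV. X $ i $ p i) - (\<Prod>i\<in>UNIV. Y $ i $ p i)\<bar>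
        \<le> K ^ n * (\<Sum>i\<in>(UNIV :: 'n set). 1 / K) * norm (X - Y)" for p :: "'n \<Rightarrow> 'n"
    proof -
      have sc: "(\<Prod>i\<in>UNIV. Z $ i $ p i) = K ^ n * (\<Prod>i\<in>UNIV. Z $ i $ p i / K)" for Z :: "real ^ 'n ^ 'n"
        using True by (simp add: prod_dividef n_def)
      have "norm ((\<Prod>i\<in>UNIV. X $ i $ p i / K) - (\<Prod>i\<in>UNIV. Y $ i $ p i / K))
          \<le> (\<Sum>i\<in>UNIV. norm (X $ i $ p i / K - Y $ i $ p i / K))"
      proof (rule norm_prod_diff)
        fix i show "norm (X $ i $ p i / K) \<le> 1" "norm (Y $ i $ p i / K) \<le> 1"
          using ent[of X i "p i"] ent[of Y i "p i"] X Y True by (auto simp: field_simps)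
      qed
      also have "\<dots> \<le> (\<Sum>i\<in>(UNIV :: 'n set). 1 / K * norm (X - Y))"
      proof (rule sum_mono)
        fix i
        have "norm (X $ i $ p i / K - Y $ i $ p i / K) = \<bar>(X - Y) $ i $ p i\<bar> / K"
          using True by (simp flip: diff_divide_distrib)
        also have "\<dots> \<le> norm (X - Y) / K" using True by (intro divide_right_mono ent) auto
        finally show "norm (X $ i $ p i / K - Y $ i $ p i / K) \<le> 1 / K * norm (X - Y)" by simp
      qed
      finally have "K ^ n * norm ((\<Prod>i\<in>UNIV. X $ i $ p i / K) - (\<Prod>i\<in>UNIV. Y $ i $ p i / K))
          \<le> K ^ n * ((\<Sum>i\<in>(UNIV :: 'n set). 1 / K) * norm (X - Y))"
        using True by (intro mult_left_mono) (auto simp: sum_distrib_right)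
      then show ?thesis
        unfolding sc[of X] sc[of Y] using True
        by (simp add: abs_mult mult.assoc flip: right_diff_distrib)
    qed
    have "\<bar>det X - det Y\<bar> = \<bar>\<Sum>p\<in>{p. p permutes (UNIV :: 'n set)}. of_int (sign p) * ((\<Prod>i\<in>UNIV. X $ i $ p i) - (\<Prod>i\<in>UNIV. Y $ i $ p i))\<bar>"
      by (simp add: det_def sum_subtractf right_diff_distrib)
    also have "\<dots> \<le> (\<Sum>p\<in>{p. p permutes (UNIV :: 'n set)}. \<bar>(\<Prod>i\<in>UNIV. X $ i $ p i) - (\<Prod>i\<in>UNIV. Y $ i $ p i)\<bar>)"
      by (rule order_trans[OF sum_abs]) (auto intro!: sum_mono simp: abs_mult sign_def)
    also have "\<dots> \<le> (\<Sum>p\<in>{p. p permutes (UNIV :: 'n set)}. K ^ n * (\<Sum>i\<in>(UNIV :: 'n set). 1 / K) * norm (X - Y))"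
      by (intro sum_mono prod_bd)
    also have "\<dots> = (\<Sum>p\<in>{p. p permutes (UNIV :: 'n set)}. K ^ n * (\<Sum>i\<in>(UNIV :: 'n set). 1 / K)) * norm (X - Y)"
      by (simp only: sum_distrib_right)
    also have "\<dots> \<le> C * norm (X - Y)" unfolding C_def by (intro mult_right_mono) auto
    finally show ?thesis .
  qed
  then show ?thesis using C by blast
next
  case False
  have "X = Y" if "norm X \<le> K" "norm Y \<le> K" for X Y :: "real ^ 'n ^ 'n"
    using that False norm_ge_zero[of X] norm_ge_zero[of Y]
    by (metis norm_eq_zero order_antisym order_trans not_less)
  then have "\<forall>(X :: real ^ 'n ^ 'n) (Y :: real ^ 'n ^ 'n). norm X \<le> K \<longrightarrow> norm Y \<le> K \<longrightarrow>
     \<bar>det X - det Y\<bar> \<le> 1 * norm (X - Y)" by fastforce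
  then show ?thesis by (intro exI[of _ 1]) auto
qed

lemma continuous_on_det:
  fixes f :: "'a :: topological_space \<Rightarrow> real ^ 'n ^ 'n"
  assumes "continuous_on S f"
  shows "continuous_on S (\<lambda>x. det (f x))"
  unfolding det_def by (intro continuous_intros assms)

text \<open>A positive definite matrix is joined to the identity by a segment of invertible matrices.\<close>

lemma det_positive_definite:
  fixes A :: "real ^ 'n ^ 'n"
  assumes "positive_definite A"
  shows "det A > 0"
proof (rule ccontr)
  assume "\<not> det A > 0"
  define f where "f = (\<lambda>s. s *\<^sub>R A + (1 - s) *\<^sub>R mat 1)"
  have "continuous_on {0..1} (\<lambda>s. det (f s))"
    unfolding f_def by (intro continuous_on_det continuous_intros)
  moreover have "det (f 1) \<le> 0" "0 \<le> det (f 0)" using \<open>\<not> det A > 0\<close> by (auto simp: f_def)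
  ultimately obtain s where s: "0 \<le> s" "s \<le> 1" "det (f s) = 0"
    using IVT2'[of "\<lambda>s. det (f s)" 1 0 0] by auto
  have "positive_definite (f s)"
    unfolding positive_definite_def
  proof (intro allI impI)
    fix x :: "real ^ 'n" assume x: "x \<noteq> 0"
    have "(f s *v x) \<bullet> x = s * ((A *v x) \<bullet> x) + (1 - s) * (x \<bullet> x)"
      by (simp add: f_def mv.add_left mv.scaleR_left inner_add_left)
    moreover have "(A *v x) \<bullet> x > 0" "x \<bullet> x > 0" using assms x by (auto simp: positive_definite_def)
    ultimately show "0 < (f s *v x) \<bullet> x"
      using s by (cases "s = 0") (auto intro!: add_pos_nonneg)
  qed
  then show False using positive_definite_invertible invertible_det_nz s(3) by blast
qed

lemma has_vector_derivative_at_iff_tendsto_quotient: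
  "(f has_vector_derivative D) (at x) \<longleftrightarrow> ((\<lambda>y. (1 / (y - x)) *\<^sub>R (f y - f x)) \<longlongrightarrow> D) (at x)"
proof -
  let ?g = "\<lambda>y. (1 / norm (y - x)) *\<^sub>R (f y - (f x + (y - x) *\<^sub>R D))"
  let ?h = "\<lambda>y. (1 / (y - x)) *\<^sub>R (f y - f x) - D"
  have "norm (?g y) = norm (?h y)" if "y \<noteq> x" for y
  proof -
    have "?h y = (1 / (y - x)) *\<^sub>R (f y - (f x + (y - x) *\<^sub>R D))"
      using that by (simp add: scaleR_diff_right scaleR_add_right)
    then show ?thesis by simp
  qed
  then have "eventually (\<lambda>y. norm (?g y) = norm (?h y)) (at x)"
    by (auto simp: eventually_at_filter)
  then have "((\<lambda>y. norm (?g y)) \<longlongrightarrow> 0) (at x) \<longleftrightarrow> ((\<lambda>y. norm (?h y)) \<longlongrightarrow> 0) (at x)"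
    by (rule tendsto_cong)
  then have "(?g \<longlongrightarrow> 0) (at x) \<longleftrightarrow> (?h \<longlongrightarrow> 0) (at x)"
    by (simp only: tendsto_norm_zero_iff)
  then show ?thesis
    unfolding has_vector_derivative_def has_derivative_at2
    by (simp only: LIM_zero_iff bounded_linear_scaleR_left simp_thms)
qed

text \<open>Differentiation of the inverse through \<open>M s - M t = - M s (N s - N t) M t\<close>.\<close>

lemma inverse_matrix_has_vector_derivative:
  fixes N M :: "real \<Rightarrow> real ^ 'n ^ 'n"
  assumes N: "(N has_vector_derivative N') (at t)"
    and inv: "\<And>s. s > a \<Longrightarrow> N s ** M s = mat 1"
    and bd: "\<And>s. s > a \<Longrightarrow> norm (M s) \<le> K" and t: "t > a"
  shows "(M has_vector_derivative - (M t ** N' ** M t)) (at t)"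
proof -
  have inv': "M s ** N s = mat 1" if "s > a" for s
    using inv[OF that] by (simp add: matrix_left_right_inverse)
  have diff: "M s - M t = - (M s ** (N s - N t) ** M t)" if "s > a" for s
  proof -
    have "M s ** (N s - N t) ** M t = (M s ** N s) ** M t - M s ** (N t ** M t)"
      by (simp add: mm.diff_right mm.diff_left matrix_mul_assoc)
    then show ?thesis by (simp add: inv'[OF that] inv[OF t])
  qed
  have ev: "eventually (\<lambda>s. s > a) (at t)"
    by (rule order_tendstoD(1)[OF tendsto_ident_at t])
  obtain L where L: "L > 0" "\<And>(A :: real ^ 'n ^ 'n) (A' :: real ^ 'n ^ 'n). norm (A ** A') \<le> norm A * norm A' * L"
    using mm.pos_bounded by blast
  have K0: "0 \<le> K" using bd[OF t] norm_ge_zero order_trans by blast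
  have contN: "(N \<longlongrightarrow> N t) (at t)"
    using has_vector_derivative_continuous[OF N] by (simp add: continuous_within)
  have "((\<lambda>s. K * norm (N s - N t) * L * norm (M t) * L) \<longlongrightarrow> K * norm (N t - N t) * L * norm (M t) * L) (at t)"
    by (intro tendsto_intros contN)
  then have lim0: "((\<lambda>s. K * norm (N s - N t) * L * norm (M t) * L) \<longlongrightarrow> 0) (at t)" by simp
  have "((\<lambda>s. M s - M t) \<longlongrightarrow> 0) (at t)"
  proof (rule Lim_null_comparison[OF _ lim0], rule eventually_mono[OF ev])
    fix s assume s: "s > a"
    have "norm (M s - M t) \<le> norm (M s ** (N s - N t)) * norm (M t) * L"
      unfolding diff[OF s] norm_minus_cancel by (rule L)
    also have "\<dots> \<le> (K * norm (N s - N t) * L) * norm (M t) * L"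
    proof -
      have "norm (M s ** (N s - N t)) \<le> norm (M s) * norm (N s - N t) * L" by (rule L)
      also have "\<dots> \<le> K * norm (N s - N t) * L"
        using bd[OF s] L(1) by (intro mult_right_mono) auto
      finally show ?thesis using L(1) by (intro mult_right_mono) auto
    qed
    finally show "norm (M s - M t) \<le> K * norm (N s - N t) * L * norm (M t) * L" .
  qed
  then have Mlim: "(M \<longlongrightarrow> M t) (at t)" by (simp add: LIM_zero_iff)
  have Nq: "((\<lambda>s. (1 / (s - t)) *\<^sub>R (N s - N t)) \<longlongrightarrow> N') (at t)"
    using N by (simp add: has_vector_derivative_at_iff_tendsto_quotient)
  have "((\<lambda>s. - (M s ** ((1 / (s - t)) *\<^sub>R (N s - N t)) ** M t)) \<longlongrightarrow> - (M t ** N' ** M t)) (at t)"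
    by (intro tendsto_minus mm.tendsto Mlim Nq tendsto_const)
  then have "((\<lambda>s. (1 / (s - t)) *\<^sub>R (M s - M t)) \<longlongrightarrow> - (M t ** N' ** M t)) (at t)"
    by (rule Lim_transform_eventually)
      (rule eventually_mono[OF ev], simp add: diff mm.scaleR_right mm.scaleR_left)
  then show ?thesis by (simp add: has_vector_derivative_at_iff_tendsto_quotient)
qed

section \<open>The kernel as a moving Gaussian bump\<close>

context stable_pair
begin

text \<open>The covariance at time \<open>t\<close> of the adjoint process: as a function of \<open>x\<close>, with respect to
  \<open>exp (- R(x)) dx\<close>, the kernel is a Gaussian with mean \<open>E t u\<close> and this covariance.\<close>

definition N :: "real \<Rightarrow> real ^ 'n ^ 'n" where "N t = cov - E t ** cov ** transpose (E t)"

definition M :: "real \<Rightarrow> real ^ 'n ^ 'n" where "M t = matrix_inv (N t)"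

definition cov_t :: "real \<Rightarrow> real ^ 'n ^ 'n" where "cov_t t = OU_cov Q B (ereal t)"

lemma transpose_E: "transpose (E t) = P ** F t ** cov"
  by (simp add: E_def matrix_transpose_mul cov_symmetric P_symmetric matrix_mul_assoc)

lemma N_eq: "N t = cov - cov ** transpose (F t) ** P ** F t ** cov"
proof -
  have "E t ** cov ** transpose (E t) = cov ** transpose (F t) ** (P ** cov) ** (P ** F t ** cov)"
    by (simp only: transpose_E) (simp only: E_def matrix_mul_assoc)
  then show ?thesis by (simp add: N_def matrix_mul_assoc)
qed

lemma N_symmetric: "transpose (N t) = N t"
proof -
  have "transpose (A - A') = transpose A - transpose A'" for A A' :: "real ^ 'n ^ 'n"
    by (simp add: transpose_def vec_eq_iff)
  then show ?thesis
    by (simp add: N_def matrix_transpose_mul cov_symmetric matrix_mul_assoc)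
qed

text \<open>The form of \<open>N t\<close> is the loss of \<open>rho2\<close> under the contraction \<open>F t\<close>, hence it is positive.\<close>

lemma N_form: "(N t *v w) \<bullet> w = rho2 (cov *v w) - rho2 (F t *v (cov *v w))"
proof -
  define z where "z = F t *v (cov *v w)"
  have "(cov ** transpose (F t) ** P ** F t ** cov) *v w = cov *v (transpose (F t) *v (P *v z))"
    by (simp only: z_def matrix_vector_mul_assoc matrix_mul_assoc)
  then have "((cov ** transpose (F t) ** P ** F t ** cov) *v w) \<bullet> w = (transpose (F t) *v (P *v z)) \<bullet> (cov *v w)"
    by (simp only: inner_symmetric_matrix[OF cov_symmetric])
  also have "\<dots> = (P *v z) \<bullet> z"
    by (simp only: inner_matrix_transpose transpose_transpose z_def)
  finally show ?thesis
    by (simp add: N_eq mv.diff_left inner_diff_left inner_diff_right rho2_def z_def inner_commute)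
qed

text \<open>The bounds of this section hold from time \<open>1/2\<close> on, so that each \<open>t \<ge> 1\<close> is an interior point of
  their range and two-sided derivatives can be taken there.\<close>

lemma N_lower_bound: "\<exists>c>0. \<forall>t\<ge>1/2. \<forall>w. c * (norm w)\<^sup>2 \<le> (N t *v w) \<bullet> w"
proof -
  obtain a where a: "a > 0" "\<And>x. a * (norm x)\<^sup>2 \<le> (cov *v x) \<bullet> x"
    using positive_definite_lower_bound[OF cov_pos] by blast
  define \<theta> where "\<theta> = exp (- k_lo)"
  have \<theta>: "\<theta> < 1" using k_lo(1) by (simp add: \<theta>_def)
  have "((1 - \<theta>) * a) * (norm w)\<^sup>2 \<le> (N t *v w) \<bullet> w" if t: "t \<ge> 1/2" for t w
  proof -
    have "k_lo * (1/2) \<le> k_lo * t" using k_lo(1) t by (intro mult_left_mono) auto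
    then have "exp (- (2 * k_lo) * t) \<le> \<theta>" by (simp add: \<theta>_def)
    then have "rho2 (F t *v (cov *v w)) \<le> \<theta> * rho2 (cov *v w)"
      using rho2_F_le[of t "cov *v w"] t mult_right_mono[OF _ rho2_nonneg, of _ \<theta> "cov *v w"] by fastforce
    then have "(1 - \<theta>) * rho2 (cov *v w) \<le> (N t *v w) \<bullet> w"
      by (simp add: N_form algebra_simps)
    moreover have "a * (norm w)\<^sup>2 \<le> rho2 (cov *v w)" using a(2)[of w] by (simp add: rho2_def inner_commute)
    then have "(1 - \<theta>) * (a * (norm w)\<^sup>2) \<le> (1 - \<theta>) * rho2 (cov *v w)"
      using \<theta> by (intro mult_left_mono) auto
    ultimately show ?thesis by (simp add: mult.assoc)
  qed
  moreover have "(1 - \<theta>) * a > 0" using a \<theta> by simp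
  ultimately show ?thesis by blast
qed

lemma N_pos: "t \<ge> 1/2 \<Longrightarrow> positive_definite (N t)"
  using N_lower_bound unfolding positive_definite_def
  by (metis less_le_trans mult_pos_pos zero_less_norm_iff zero_less_power)

lemma N_M: assumes "t \<ge> 1/2" shows "N t ** M t = mat 1" "M t ** N t = mat 1"
  unfolding M_def using matrix_inv_mult[OF positive_definite_invertible[OF N_pos[OF assms]]] by auto

lemma M_bounded: "\<exists>K>0. \<forall>t\<ge>1/2. norm (M t) \<le> K"
proof -
  obtain c where c: "c > 0" "\<And>t w. t \<ge> 1/2 \<Longrightarrow> c * (norm w)\<^sup>2 \<le> (N t *v w) \<bullet> w"
    using N_lower_bound by blast
  have v: "norm (M t *v z) \<le> norm z / c" if t: "t \<ge> 1/2" for t z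
  proof -
    define w where "w = M t *v z"
    have z: "z = N t *v w" by (simp add: w_def matrix_vector_mul_assoc N_M[OF t])
    have "c * (norm w)\<^sup>2 \<le> norm z * norm w"
      using c(2)[OF t, of w] norm_cauchy_schwarz[of z w] z by simp
    then have "c * norm w \<le> norm z"
      by (cases "norm w = 0") (auto simp: power2_eq_square)
    then show ?thesis using c(1) by (simp add: w_def field_simps)
  qed
  have "norm (M t) \<le> (\<Sum>i\<in>(UNIV :: 'n set). \<Sum>j\<in>(UNIV :: 'n set). 1 / c)" if t: "t \<ge> 1/2" for t
    by (rule order_trans[OF norm_matrix_le_columns])
      (intro sum_mono order_trans[OF v[OF t]], simp)
  moreover have "(\<Sum>i\<in>(UNIV :: 'n set). \<Sum>j\<in>(UNIV :: 'n set). 1 / c) > 0"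
    using c(1) by (simp add: card_gt_0_iff)
  ultimately show ?thesis by blast
qed

text \<open>The lower bound on the form of \<open>M t\<close> follows from an upper bound on \<open>N t\<close>, through the
  Cauchy--Schwarz inequality for the form of \<open>N t\<close>.\<close>

lemma M_lower_bound: "\<exists>c>0. \<forall>t\<ge>1/2. \<forall>z. c * rho2 z \<le> (M t *v z) \<bullet> z"
proof -
  obtain b where b: "b > 0" "\<And>x. (cov *v x) \<bullet> x \<le> b * (norm x)\<^sup>2"
    using quadratic_form_upper_bound[of cov] by blast
  have "(1 / (b * m_hi\<^sup>2)) * rho2 z \<le> (M t *v z) \<bullet> z" if t: "t \<ge> 1/2" for t z
  proof (cases "z = 0")
    case True then show ?thesis by (simp add: mv.zero_right)
  next
    case False
    define w where "w = M t *v z"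
    have z: "z = N t *v w" by (simp add: w_def matrix_vector_mul_assoc N_M[OF t])
    have "(z \<bullet> z)\<^sup>2 \<le> (z \<bullet> w) * ((N t *v z) \<bullet> z)"
      using positive_definite_cauchy_schwarz[OF N_pos[OF t] N_symmetric, of w z] z by simp
    also have "\<dots> \<le> (z \<bullet> w) * (b * (z \<bullet> z))"
    proof (rule mult_left_mono)
      have "(N t *v z) \<bullet> z \<le> rho2 (cov *v z)" by (simp add: N_form)
      also have "\<dots> = (cov *v z) \<bullet> z" by (simp add: rho2_def inner_commute)
      also have "\<dots> \<le> b * (z \<bullet> z)" using b(2)[of z] by (simp add: power2_norm_eq_inner)
      finally show "(N t *v z) \<bullet> z \<le> b * (z \<bullet> z)" .
      show "0 \<le> z \<bullet> w"
        using N_pos[OF t] unfolding z positive_definite_def by (cases "w = 0") (auto intro: less_imp_le)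
    qed
    finally have "(z \<bullet> z) * (z \<bullet> z) \<le> (b * (z \<bullet> w)) * (z \<bullet> z)" by (simp add: power2_eq_square mult_ac)
    then have 1: "z \<bullet> z \<le> b * (z \<bullet> w)" using False by (simp add: mult_le_cancel_right)
    have "rho2 z \<le> m_hi\<^sup>2 * (z \<bullet> z)"
      using power_mono[OF m_lo_hi(4)[of z], of 2] by (simp add: power_mult_distrib power2_norm_eq_inner)
    also have "\<dots> \<le> m_hi\<^sup>2 * (b * (z \<bullet> w))" using 1 by (intro mult_left_mono) auto
    finally have "rho2 z \<le> (b * m_hi\<^sup>2) * (z \<bullet> w)" by (simp add: mult_ac)
    then show ?thesis
      using b(1) m_lo_hi(2) by (simp add: w_def field_simps inner_commute)
  qed
  moreover have "1 / (b * m_hi\<^sup>2) > 0" using b(1) m_lo_hi(2) by simp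
  ultimately show ?thesis by blast
qed

lemma cov_t_eq: "t \<ge> 0 \<Longrightarrow> cov_t t = cov - F t ** cov ** transpose (F t)"
  by (simp add: cov_t_def OU_cov_eq)

text \<open>The Woodbury identity for the covariance \<open>cov_t t\<close>, viewed as a perturbation of \<open>cov\<close>.\<close>

lemma cov_t_inverse:
  assumes t: "t \<ge> 1/2"
  shows "cov_t t ** (P + transpose (E t) ** M t ** E t) = mat 1"
proof -
  have "cov_t t ** P = mat 1 - F t ** E t"
    using t by (simp add: cov_t_eq mm.diff_left E_def matrix_mul_assoc)
  moreover have "cov_t t ** transpose (E t) = F t ** N t"
  proof -
    have "cov_t t ** transpose (E t)
        = cov ** P ** F t ** cov - F t ** (cov ** transpose (F t) ** P ** F t ** cov)"
      using t by (simp only: cov_t_eq transpose_E mm.diff_left matrix_mul_assoc)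
    then show ?thesis by (simp add: N_eq mm.diff_right)
  qed
  then have "cov_t t ** (transpose (E t) ** M t ** E t) = F t ** (N t ** M t) ** E t"
    by (simp add: matrix_mul_assoc)
  ultimately show ?thesis by (simp add: mm.add_right N_M[OF t])
qed

lemma matrix_inv_cov_t:
  "t \<ge> 1/2 \<Longrightarrow> matrix_inv (cov_t t) = P + transpose (E t) ** M t ** E t"
  by (rule matrix_inv_eqI(1)[OF cov_t_inverse])

definition factor :: "real \<Rightarrow> real" where "factor t = sqrt (det cov / det (cov_t t))"

definition phase :: "real \<Rightarrow> real ^ 'n \<Rightarrow> real ^ 'n \<Rightarrow> real" where
  "phase t x u = (M t *v (E t *v u - x)) \<bullet> (E t *v u - x)"

text \<open>The kernel as a Gaussian bump in \<open>x\<close> centred at \<open>E t u\<close>, which moves towards the origin as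
  \<open>t\<close> grows.\<close>

lemma OU_kernel_eq:
  assumes t: "t \<ge> 1/2"
  shows "OU_kernel Q B t x u = factor t * exp (rho2 x / 2) * exp (- (1/2) * phase t x u)"
proof -
  define v where "v = u - OU_D Q B t *v x"
  have Ev: "E t *v v = E t *v u - x" by (simp add: v_def OU_D_eq mv.diff_right)
  have "((matrix_inv (cov_t t) - matrix_inv cov) *v v) \<bullet> v = (transpose (E t) *v (M t *v (E t *v v))) \<bullet> v"
    by (simp add: matrix_inv_cov_t[OF t] P_def matrix_vector_mul_assoc matrix_mul_assoc)
  also have "\<dots> = phase t x u"
    by (simp add: inner_matrix_transpose phase_def Ev)
  finally show ?thesis
    unfolding OU_kernel_def cov_t_def[symmetric] cov_def[symmetric] v_def[symmetric]
    by (simp add: OU_R_eq factor_def)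
qed

end

section \<open>The time derivative of the bump\<close>

lemma polynomial_absorbed_by_exp:
  fixes d y :: real
  assumes "d > 0" "y \<ge> 0"
  shows "(1 + y)\<^sup>2 * exp (- d * y) \<le> 1 / (min 1 (d / 2))\<^sup>2"
proof -
  define m where "m = min 1 (d / 2)"
  have m: "m > 0" using assms by (simp add: m_def)
  have "m * (1 + y) \<le> 1 + (d / 2) * y"
    unfolding distrib_left using assms by (intro add_mono mult_right_mono) (auto simp: m_def)
  also have "\<dots> \<le> exp ((d / 2) * y)" by (rule exp_ge_add_one_self)
  finally have "(m * (1 + y))\<^sup>2 \<le> (exp ((d / 2) * y))\<^sup>2"
    using m assms by (intro power_mono) auto
  also have "\<dots> = exp (d * y)" by (simp add: power2_eq_square flip: exp_add)
  finally have "m\<^sup>2 * (1 + y)\<^sup>2 \<le> exp (d * y)" by (simp add: power_mult_distrib)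
  then show ?thesis using m by (simp add: m_def[symmetric] exp_minus field_simps)
qed

text \<open>Part of the Gaussian decay is spent on a polynomial factor and on a fraction which is
  integrable in the level \<open>s\<close>.\<close>

lemma gaussian_absorbs:
  fixes c :: real
  assumes c: "c > 0"
  shows "\<exists>C>0. \<forall>r s a b. 0 \<le> r \<longrightarrow> \<bar>s\<bar> \<le> r \<longrightarrow> 0 \<le> a \<longrightarrow> 0 \<le> b \<longrightarrow>
    exp (- (c / 2) * r\<^sup>2) * (a * r\<^sup>2 + b * r) \<le> C * exp (- (c / 8) * r\<^sup>2) * (a + b / (1 + s\<^sup>2))"
proof -
  define d where "d = 3 * c / 8"
  have d: "d > 0" using c by (simp add: d_def)
  define C where "C = 1 / (min 1 (d / 2))\<^sup>2"
  have C: "C > 0" using d by (simp add: C_def)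
  have "exp (- (c / 2) * r\<^sup>2) * (a * r\<^sup>2 + b * r) \<le> C * exp (- (c / 8) * r\<^sup>2) * (a + b / (1 + s\<^sup>2))"
    if r: "0 \<le> r" and s: "\<bar>s\<bar> \<le> r" and a: "0 \<le> a" and b: "0 \<le> b" for r s a b :: real
  proof -
    have key: "(1 + r\<^sup>2)\<^sup>2 * exp (- d * r\<^sup>2) \<le> C"
      unfolding C_def by (rule polynomial_absorbed_by_exp[OF d]) simp
    have s2: "s\<^sup>2 \<le> r\<^sup>2" using s r by (simp add: abs_le_square_iff[symmetric])
    have s1: "0 < 1 + s\<^sup>2" by (simp add: add_pos_nonneg)
    have "0 \<le> (r - 1)\<^sup>2" by simp
    then have r1: "r \<le> 1 + r\<^sup>2" using r by (simp add: power2_eq_square algebra_simps)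
    have "r\<^sup>2 \<le> (1 + r\<^sup>2)\<^sup>2" by (simp add: power2_sum)
    then have 1: "a * r\<^sup>2 \<le> a * (1 + r\<^sup>2)\<^sup>2" using a by (intro mult_left_mono)
    have "r * (1 + s\<^sup>2) \<le> (1 + r\<^sup>2) * (1 + r\<^sup>2)"
      using r1 s2 r by (intro mult_mono) auto
    then have "b * r \<le> (b / (1 + s\<^sup>2)) * (1 + r\<^sup>2)\<^sup>2"
      using b s1 mult_left_mono[of "r * (1 + s\<^sup>2)" "(1 + r\<^sup>2) * (1 + r\<^sup>2)" b]
      by (simp add: power2_eq_square[of "1 + r\<^sup>2"] pos_le_divide_eq mult.assoc)
    with 1 have "a * r\<^sup>2 + b * r \<le> (a + b / (1 + s\<^sup>2)) * (1 + r\<^sup>2)\<^sup>2"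
      by (simp add: distrib_right)
    then have "exp (- (c / 2) * r\<^sup>2) * (a * r\<^sup>2 + b * r)
        \<le> exp (- (c / 2) * r\<^sup>2) * ((a + b / (1 + s\<^sup>2)) * (1 + r\<^sup>2)\<^sup>2)"
      by (intro mult_left_mono) auto
    also have "\<dots> = exp (- (c / 8) * r\<^sup>2) * (a + b / (1 + s\<^sup>2)) * ((1 + r\<^sup>2)\<^sup>2 * exp (- d * r\<^sup>2))"
    proof -
      have "exp (- (c / 2) * r\<^sup>2) = exp (- (c / 8) * r\<^sup>2) * exp (- d * r\<^sup>2)"
        by (simp add: d_def flip: exp_add)
      then show ?thesis by (simp only: mult_ac)
    qed
    also have "\<dots> \<le> exp (- (c / 8) * r\<^sup>2) * (a + b / (1 + s\<^sup>2)) * C"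
      using key a b s1 by (intro mult_left_mono mult_nonneg_nonneg add_nonneg_nonneg divide_nonneg_pos) auto
    finally show ?thesis by (simp only: mult_ac)
  qed
  with C show ?thesis by blast
qed

context stable_pair
begin

lemma E_norm_decay: "\<exists>K>0. \<forall>t\<ge>0. norm (E t) \<le> K * exp (- k_lo * t)"
proof -
  define K where "K = (\<Sum>i\<in>(UNIV :: 'n set). \<Sum>j\<in>UNIV. rho (axis j 1) / m_lo) + 1"
  have K: "K > 0" unfolding K_def
    using m_lo_hi(1) by (intro add_nonneg_pos sum_nonneg divide_nonneg_pos) auto
  have "norm (E t) \<le> K * exp (- k_lo * t)" if t: "t \<ge> 0" for t
  proof -
    have "norm (E t) \<le> (\<Sum>i\<in>(UNIV :: 'n set). \<Sum>j\<in>UNIV. norm (E t *v axis j 1))"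
      by (rule norm_matrix_le_columns)
    also have "\<dots> \<le> (\<Sum>i\<in>(UNIV :: 'n set). \<Sum>j\<in>UNIV. rho (axis j 1) / m_lo * exp (- k_lo * t))"
    proof (intro sum_mono)
      fix j :: 'n
      have "m_lo * norm (E t *v axis j 1) \<le> exp (- k_lo * t) * rho (axis j 1)"
        using m_lo_hi(3) rho_E_le[OF t] order_trans by blast
      then show "norm (E t *v axis j 1) \<le> rho (axis j 1) / m_lo * exp (- k_lo * t)"
        using m_lo_hi(1) by (simp add: pos_le_divide_eq mult_ac)
    qed
    also have "\<dots> = (\<Sum>i\<in>(UNIV :: 'n set). \<Sum>j\<in>UNIV. rho (axis j 1) / m_lo) * exp (- k_lo * t)"
      by (simp only: sum_distrib_right)
    also have "\<dots> \<le> K * exp (- k_lo * t)" by (intro mult_right_mono) (auto simp: K_def)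
    finally show ?thesis .
  qed
  with K show ?thesis by blast
qed

text \<open>The derivative of \<open>N t\<close> is quadratic in the decaying matrix \<open>E t\<close>, and passing to the inverse
  multiplies it by bounded matrices.\<close>

lemma M_has_small_derivative:
  "\<exists>K>0. \<forall>t\<ge>1. \<exists>M'. (M has_vector_derivative M') (at t) \<and> norm M' \<le> K * exp (- k_lo * t)"
proof -
  obtain L where L: "L > 0" "\<And>(A :: real ^ 'n ^ 'n) (A' :: real ^ 'n ^ 'n). norm (A ** A') \<le> norm A * norm A' * L"
    using mm.pos_bounded by blast
  obtain KE where KE: "KE > 0" "\<And>t. t \<ge> 0 \<Longrightarrow> norm (E t) \<le> KE * exp (- k_lo * t)"
    using E_norm_decay by blast
  obtain KM where KM: "KM > 0" "\<And>t. t \<ge> 1/2 \<Longrightarrow> norm (M t) \<le> KM"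
    using M_bounded by blast
  define N' where "N' = (\<lambda>t. - (E t ** cov ** transpose (gen ** E t) + gen ** E t ** cov ** transpose (E t)))"
  have dN: "(N has_vector_derivative N' t) (at t)" for t
  proof -
    have 1: "((\<lambda>t. E t ** cov) has_vector_derivative gen ** E t ** cov) (at t)"
      by (rule bounded_linear.has_vector_derivative[OF mm.bounded_linear_left E_has_vector_derivative])
    have 2: "((\<lambda>t. transpose (E t)) has_vector_derivative transpose (gen ** E t)) (at t)"
      by (rule bounded_linear.has_vector_derivative[OF bounded_linear_transpose E_has_vector_derivative])
    have "((\<lambda>t. cov - E t ** cov ** transpose (E t)) has_vector_derivative
        0 - (E t ** cov ** transpose (gen ** E t) + gen ** E t ** cov ** transpose (E t))) (at t)"
      by (intro has_vector_derivative_diff has_vector_derivative_const mm.has_vector_derivative 1 2)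
    then show ?thesis by (simp add: N'_def N_def[abs_def])
  qed
  define K1 where "K1 = KE * (norm cov + 1) * KE * (norm gen + 1) * L * L * L"
  have K1: "K1 > 0" unfolding K1_def using KE L by (intro mult_pos_pos add_nonneg_pos) auto
  have N'_bd: "norm (N' t) \<le> (2 * K1) * exp (- k_lo * t)" if t: "t \<ge> 0" for t
  proof -
    define e where "e = exp (- k_lo * t)"
    have e: "0 < e" "e \<le> 1" using k_lo(1) t by (auto simp: e_def)
    have nE: "norm (E t) \<le> KE * e" using KE(2)[OF t] by (simp add: e_def)
    have nEc: "norm (E t ** cov) \<le> (KE * e) * (norm cov + 1) * L"
      by (rule order_trans[OF L(2)]) (use nE KE(1) L(1) e in \<open>intro mult_mono; auto\<close>)
    have ngE: "norm (gen ** E t) \<le> (norm gen + 1) * (KE * e) * L"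
      by (rule order_trans[OF L(2)]) (use nE KE(1) L(1) e in \<open>intro mult_mono; auto\<close>)
    have "norm (E t ** cov ** transpose (gen ** E t)) \<le> ((KE * e) * (norm cov + 1) * L) * ((norm gen + 1) * (KE * e) * L) * L"
      by (rule order_trans[OF L(2)], unfold norm_transpose)
        (use nEc ngE KE(1) L(1) e in \<open>intro mult_mono; auto intro!: mult_nonneg_nonneg add_nonneg_nonneg\<close>)
    also have "\<dots> = K1 * e * e" by (simp add: K1_def mult_ac)
    finally have 1: "norm (E t ** cov ** transpose (gen ** E t)) \<le> K1 * e * e" .
    have "norm (gen ** E t ** cov) \<le> ((norm gen + 1) * (KE * e) * L) * (norm cov + 1) * L"
      by (rule order_trans[OF L(2)]) (use ngE KE(1) L(1) e in \<open>intro mult_mono; auto\<close>)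
    then have "norm (gen ** E t ** cov ** transpose (E t)) \<le> (((norm gen + 1) * (KE * e) * L) * (norm cov + 1) * L) * (KE * e) * L"
      using nE KE(1) L(1) e
      by (intro order_trans[OF L(2)], unfold norm_transpose) (intro mult_mono; auto intro!: mult_nonneg_nonneg add_nonneg_nonneg)
    also have "\<dots> = K1 * e * e" by (simp add: K1_def mult_ac)
    finally have 2: "norm (gen ** E t ** cov ** transpose (E t)) \<le> K1 * e * e" .
    have "norm (N' t) \<le> K1 * e * e + K1 * e * e"
      unfolding N'_def norm_minus_cancel using 1 2 norm_triangle_ineq order_trans add_mono by meson
    also have "\<dots> = (2 * K1 * e) * e" by simp
    also have "\<dots> \<le> (2 * K1 * e) * 1" using K1 e by (intro mult_left_mono) auto
    finally show ?thesis by (simp add: e_def)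
  qed
  have "\<exists>M'. (M has_vector_derivative M') (at t) \<and> norm M' \<le> (KM * (2 * K1) * KM * L * L) * exp (- k_lo * t)"
    if t: "t \<ge> 1" for t
  proof (intro exI conjI)
    show "(M has_vector_derivative - (M t ** N' t ** M t)) (at t)"
    proof (rule inverse_matrix_has_vector_derivative[where a = "1/2" and K = KM, OF dN])
      show "N s ** M s = mat 1" if "s > 1/2" for s using that by (intro N_M) simp
      show "norm (M s) \<le> KM" if "s > 1/2" for s using that by (intro KM) simp
    qed (use t in simp)
    have "norm (M t ** N' t) \<le> KM * ((2 * K1) * exp (- k_lo * t)) * L"
      by (rule order_trans[OF L(2)]) (use t KM N'_bd[of t] L(1) K1 in \<open>intro mult_mono; auto\<close>)
    then have "norm (M t ** N' t ** M t) \<le> (KM * ((2 * K1) * exp (- k_lo * t)) * L) * KM * L"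
      using t KM L(1) K1 by (intro order_trans[OF L(2)]) (intro mult_mono; auto)
    then show "norm (- (M t ** N' t ** M t)) \<le> (KM * (2 * K1) * KM * L * L) * exp (- k_lo * t)"
      by (simp add: mult_ac)
  qed
  moreover have "KM * (2 * K1) * KM * L * L > 0" using KM(1) K1 L(1) by simp
  ultimately show ?thesis by blast
qed

text \<open>A uniform lower bound for the form of \<open>M t\<close> relative to \<open>rho2\<close>.\<close>

definition M_form_const :: real where
  "M_form_const = (SOME c. c > 0 \<and> (\<forall>t\<ge>1/2. \<forall>z. c * rho2 z \<le> (M t *v z) \<bullet> z))"

lemma M_form_const: "M_form_const > 0" "t \<ge> 1/2 \<Longrightarrow> M_form_const * rho2 z \<le> (M t *v z) \<bullet> z"
proof -
  have "M_form_const > 0 \<and> (\<forall>t\<ge>1/2. \<forall>z. M_form_const * rho2 z \<le> (M t *v z) \<bullet> z)"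
    unfolding M_form_const_def by (rule someI_ex) (use M_lower_bound in blast)
  then show "M_form_const > 0" "t \<ge> 1/2 \<Longrightarrow> M_form_const * rho2 z \<le> (M t *v z) \<bullet> z" by auto
qed

text \<open>A quarter of the available exponent \<open>M_form_const / 2\<close> is kept for the spatial decay.\<close>

definition kappa :: real where "kappa = M_form_const / 8"

lemma kappa_pos: "kappa > 0" using M_form_const(1) by (simp add: kappa_def)

definition bump :: "real \<Rightarrow> real ^ 'n \<Rightarrow> real ^ 'n \<Rightarrow> real" where
  "bump t x u = exp (- kappa * rho2 (E t *v u - x))"

lemma exp_phase_le_bump: "t \<ge> 1/2 \<Longrightarrow> exp (- (1/2) * phase t x u) \<le> bump t x u"
proof -
  assume t: "t \<ge> 1/2"
  have "kappa * rho2 (E t *v u - x) \<le> (1/2) * (M_form_const * rho2 (E t *v u - x))"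
    using M_form_const(1) rho2_nonneg[of "E t *v u - x"] by (simp add: kappa_def mult_right_mono)
  also have "\<dots> \<le> (1/2) * phase t x u" using M_form_const(2)[OF t] by (simp add: phase_def)
  finally show ?thesis by (simp add: bump_def)
qed

text \<open>The derivative of the phase consists of a term from \<open>M'\<close>, which is exponentially small, and a
  term from the motion of the centre, which is at most of the order of \<open>rho (E t u)\<close> times the
  distance. The Gaussian absorbs the powers of the distance, and its decay in the difference of the
  levels produces the last denominator.\<close>

lemma exp_phase_derivative_bound:
  "\<exists>C>0. \<forall>t\<ge>1. \<forall>x u. \<exists>g'. ((\<lambda>t. exp (- (1/2) * phase t x u)) has_real_derivative g') (at t) \<and>
     \<bar>g'\<bar> \<le> C * bump t x u * (exp (- k_lo * t) + rho (E t *v u) / (1 + (rho (E t *v u) - rho x)\<^sup>2))"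
proof -
  obtain L where L: "L > 0" "\<And>(A :: real ^ 'n ^ 'n) x. norm (A *v x) \<le> norm A * norm x * L"
    using mv.pos_bounded by blast
  obtain KM where KM: "KM > 0" "\<And>t. t \<ge> 1/2 \<Longrightarrow> norm (M t) \<le> KM"
    using M_bounded by blast
  obtain KM' where KM': "KM' > 0"
    "\<And>t. t \<ge> 1 \<Longrightarrow> \<exists>M'. (M has_vector_derivative M') (at t) \<and> norm M' \<le> KM' * exp (- k_lo * t)"
    using M_has_small_derivative by blast
  obtain Kg where Kg: "Kg > 0" "\<And>v. rho (gen *v v) \<le> Kg * rho v"
    using rho_gen_bound by blast
  obtain C where C: "C > 0" "\<And>r s a b. 0 \<le> r \<Longrightarrow> \<bar>s\<bar> \<le> r \<Longrightarrow> 0 \<le> a \<Longrightarrow> 0 \<le> b \<Longrightarrow>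
    exp (- (M_form_const / 2) * r\<^sup>2) * (a * r\<^sup>2 + b * r) \<le> C * exp (- (M_form_const / 8) * r\<^sup>2) * (a + b / (1 + s\<^sup>2))"
    using gaussian_absorbs[OF M_form_const(1)] by blast
  define K2 where "K2 = KM' * L / m_lo\<^sup>2 + 2 * (KM * L * Kg / m_lo\<^sup>2)"
  have K2: "K2 > 0" unfolding K2_def using KM(1) KM'(1) L(1) Kg(1) m_lo_hi(1) by (intro add_pos_pos) auto
  have nrm: "norm v \<le> rho v / m_lo" for v using m_lo_hi(1) m_lo_hi(3)[of v] by (simp add: pos_le_divide_eq mult.commute)
  have "\<exists>g'. ((\<lambda>t. exp (- (1/2) * phase t x u)) has_real_derivative g') (at t) \<and>
     \<bar>g'\<bar> \<le> (K2 * C) * bump t x u * (exp (- k_lo * t) + rho (E t *v u) / (1 + (rho (E t *v u) - rho x)\<^sup>2))"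
    if t: "t \<ge> 1" for t x u
  proof -
    define z where "z = E t *v u - x"
    define z' where "z' = gen *v (E t *v u)"
    obtain M' where M': "(M has_vector_derivative M') (at t)" "norm M' \<le> KM' * exp (- k_lo * t)"
      using KM'(2)[OF t] by blast
    define p' where "p' = (M t *v z) \<bullet> z' + (M t *v z' + M' *v z) \<bullet> z"
    have dz: "((\<lambda>t. E t *v u - x) has_vector_derivative z') (at t)"
      unfolding z'_def using has_vector_derivative_diff[OF E_vec_has_vector_derivative has_vector_derivative_const]
      by simp
    have dp: "((\<lambda>t. phase t x u) has_real_derivative p') (at t)"
      unfolding phase_def has_real_derivative_iff_has_vector_derivative p'_def z_def
      by (intro bounded_bilinear.has_vector_derivative[OF bounded_bilinear_inner] mv.has_vector_derivative M' dz)
    define a where "a = exp (- k_lo * t)"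
    define b where "b = rho (E t *v u)"
    define r where "r = rho z"
    have ab: "0 \<le> a" "0 \<le> b" "0 \<le> r" by (auto simp: a_def b_def r_def)
    have nz: "norm z \<le> r / m_lo" unfolding r_def by (rule nrm)
    have nz': "norm z' \<le> Kg * b / m_lo"
    proof -
      have "norm z' \<le> rho z' / m_lo" by (rule nrm)
      also have "\<dots> \<le> Kg * b / m_lo"
        unfolding z'_def b_def using m_lo_hi(1) Kg(2) by (intro divide_right_mono) auto
      finally show ?thesis .
    qed
    have bi: "\<bar>(A *v v) \<bullet> w\<bar> \<le> (\<alpha> * L) * (\<beta> * \<gamma>)"
      if "norm A \<le> \<alpha>" "norm v \<le> \<beta>" "norm w \<le> \<gamma>" for A :: "real ^ 'n ^ 'n" and v w \<alpha> \<beta> \<gamma>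
    proof -
      have pos: "0 \<le> \<alpha>" "0 \<le> \<beta>" "0 \<le> \<gamma>" using that norm_ge_zero order_trans by blast+
      have "\<bar>(A *v v) \<bullet> w\<bar> \<le> norm (A *v v) * norm w" by (rule Cauchy_Schwarz_ineq2)
      also have "\<dots> \<le> (norm A * norm v * L) * norm w" by (intro mult_right_mono L) auto
      also have "\<dots> \<le> (\<alpha> * \<beta> * L) * \<gamma>" using that pos L(1) by (intro mult_mono) auto
      finally show ?thesis by (simp add: mult_ac)
    qed
    have Mt: "norm (M t) \<le> KM" using t by (intro KM) simp
    have "\<bar>p'\<bar> \<le> \<bar>(M t *v z) \<bullet> z'\<bar> + \<bar>(M t *v z') \<bullet> z\<bar> + \<bar>(M' *v z) \<bullet> z\<bar>"
      unfolding p'_def inner_add_left by linarith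
    also have "\<dots> \<le> (KM * L) * (r / m_lo * (Kg * b / m_lo)) + (KM * L) * (Kg * b / m_lo * (r / m_lo))
        + (KM' * exp (- k_lo * t) * L) * (r / m_lo * (r / m_lo))"
      by (intro add_mono bi Mt nz nz' M'(2))
    also have "\<dots> = (KM' * L / m_lo\<^sup>2) * (a * r\<^sup>2) + (2 * (KM * L * Kg / m_lo\<^sup>2)) * (b * r)"
      using m_lo_hi(1) by (simp add: a_def power2_eq_square field_simps)
    also have "\<dots> \<le> K2 * (a * r\<^sup>2) + K2 * (b * r)"
      unfolding K2_def using ab KM(1) KM'(1) L(1) Kg(1) m_lo_hi(1)
      by (intro add_mono mult_right_mono) auto
    finally have p'_bd: "\<bar>p'\<bar> \<le> K2 * (a * r\<^sup>2 + b * r)" by (simp add: distrib_left)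
    have dg: "((\<lambda>t. exp (- (1/2) * phase t x u)) has_real_derivative exp (- (1/2) * phase t x u) * (- (1/2) * p')) (at t)"
      by (auto intro!: derivative_eq_intros dp)
    have ph: "exp (- (1/2) * phase t x u) \<le> exp (- (M_form_const / 2) * r\<^sup>2)"
      using M_form_const(2)[of t z] t by (simp add: phase_def z_def r_def)
    have "\<bar>exp (- (1/2) * phase t x u) * (- (1/2) * p')\<bar> = exp (- (1/2) * phase t x u) * ((1/2) * \<bar>p'\<bar>)"
      by (simp add: abs_mult)
    also have "\<dots> \<le> exp (- (M_form_const / 2) * r\<^sup>2) * (K2 * (a * r\<^sup>2 + b * r))"
    proof (rule mult_mono[OF ph])
      show "(1/2) * \<bar>p'\<bar> \<le> K2 * (a * r\<^sup>2 + b * r)" using p'_bd abs_ge_zero[of p'] by linarith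
    qed auto
    also have "\<dots> = K2 * (exp (- (M_form_const / 2) * r\<^sup>2) * (a * r\<^sup>2 + b * r))" by (simp only: mult_ac)
    also have "\<dots> \<le> K2 * (C * exp (- (M_form_const / 8) * r\<^sup>2) * (a + b / (1 + (rho (E t *v u) - rho x)\<^sup>2)))"
      using K2 ab rho_abs_diff[of "E t *v u" x] by (intro mult_left_mono C(2)) (auto simp: r_def z_def)
    also have "\<dots> = (K2 * C) * bump t x u * (a + b / (1 + (rho (E t *v u) - rho x)\<^sup>2))"
      by (simp add: bump_def kappa_def r_def z_def)
    finally show ?thesis using dg unfolding a_def b_def by blast
  qed
  moreover have "K2 * C > 0" using K2 C(1) by simp
  ultimately show ?thesis by blast
qed

end

section \<open>Total variation of the kernel\<close>

text \<open>A majorant \<open>H\<close> of the increments bounds every variational sum.\<close>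

lemma sum_telescope_le:
  fixes \<phi> H :: "real \<Rightarrow> real" and \<tau> :: "nat \<Rightarrow> real"
  assumes "strict_mono_on {..n} \<tau>" "\<tau> ` {..n} \<subseteq> I"
    and "\<And>s t. s \<in> I \<Longrightarrow> t \<in> I \<Longrightarrow> s < t \<Longrightarrow> \<bar>\<phi> t - \<phi> s\<bar> \<le> H t - H s"
  shows "(\<Sum>i=1..n. \<bar>\<phi> (\<tau> i) - \<phi> (\<tau> (i - 1))\<bar>) \<le> H (\<tau> n) - H (\<tau> 0)"
  using assms
proof (induction n)
  case (Suc n)
  have "strict_mono_on {..n} \<tau>" using Suc(2) by (auto simp: strict_mono_on_def)
  moreover have "\<tau> ` {..n} \<subseteq> I" using Suc(3) by auto
  ultimately have "(\<Sum>i=1..n. \<bar>\<phi> (\<tau> i) - \<phi> (\<tau> (i - 1))\<bar>) \<le> H (\<tau> n) - H (\<tau> 0)"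
    using Suc by blast
  moreover have "\<bar>\<phi> (\<tau> (Suc n)) - \<phi> (\<tau> n)\<bar> \<le> H (\<tau> (Suc n)) - H (\<tau> n)"
    using Suc(2,3) by (intro Suc(4)) (auto simp: strict_mono_on_def)
  ultimately show ?case by simp
qed simp

context stable_pair
begin

text \<open>The largest bump that the orbit of \<open>u\<close> produces at \<open>x\<close> after time one. It is the spatial
  profile of the variation of the kernel.\<close>

definition Psi :: "real ^ 'n \<Rightarrow> real ^ 'n \<Rightarrow> real" where
  "Psi x u = (SUP t\<in>{1..}. bump t x u)"

lemma bump_bounds: "0 < bump t x u" "bump t x u \<le> 1"
  using kappa_pos by (simp_all add: bump_def)

lemma bdd_above_bump: "bdd_above ((\<lambda>t. bump t x u) ` T)"
  using bump_bounds(2) by (intro bdd_aboveI[of _ 1]) auto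

lemma bump_le_Psi: "t \<ge> 1 \<Longrightarrow> bump t x u \<le> Psi x u"
  unfolding Psi_def by (rule cSUP_upper[OF _ bdd_above_bump]) simp

lemma Psi_pos: "0 < Psi x u"
  using bump_bounds(1)[of 1 x u] bump_le_Psi[of 1 x u] by simp

lemma Psi_le_1: "Psi x u \<le> 1"
  unfolding Psi_def by (rule cSUP_least) (auto simp: bump_bounds)

text \<open>The flow contracts distances in the norm \<open>rho\<close> and maps the orbit of \<open>u\<close>, after time one, into
  itself.\<close>

lemma Psi_flow: assumes s: "s \<ge> 0" shows "Psi x u \<le> Psi (E s *v x) u"
  unfolding Psi_def[of x u]
proof (rule cSUP_least)
  fix t :: real assume t: "t \<in> {1..}"
  have "E (s + t) *v u - E s *v x = E s *v (E t *v u - x)"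
    by (simp add: E_add_vec mv.diff_right)
  moreover have "rho2 (E s *v (E t *v u - x)) \<le> rho2 (E t *v u - x)"
    using power_mono[OF rho_E_contract[OF s, of "E t *v u - x"], of 2] by simp
  ultimately have "bump t x u \<le> bump (s + t) (E s *v x) u"
    using kappa_pos by (simp add: bump_def)
  also have "\<dots> \<le> Psi (E s *v x) u" using s t by (intro bump_le_Psi) auto
  finally show "bump t x u \<le> Psi (E s *v x) u" .
qed simp

text \<open>A supremum of continuous functions is lower semicontinuous.\<close>

lemma borel_measurable_Psi: "(\<lambda>p. Psi (fst p) (snd p)) \<in> borel_measurable borel"
proof (rule borel_measurableI_greater)
  fix a :: real
  have "{p. a < Psi (fst p) (snd p)} = (\<Union>t\<in>{1..}. {p. a < bump t (fst p) (snd p)})"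
    unfolding Psi_def by (auto simp: less_cSUP_iff[OF _ bdd_above_bump])
  moreover have "open (\<Union>t\<in>{1..}. {p :: (real ^ 'n) \<times> (real ^ 'n). a < bump t (fst p) (snd p)})"
    unfolding bump_def by (intro open_UN ballI open_Collect_less continuous_intros)
  ultimately show "{p \<in> space borel. a < Psi (fst p) (snd p)} \<in> sets borel" by simp
qed

text \<open>The majorant \<open>H\<close> adds to a primitive of \<open>exp (- k_lo t)\<close> the arctangent of the level
  \<open>rho (E t u) - rho x\<close>, with a negative sign. Since the level decreases at least at the rate
  \<open>k_lo * rho (E t u)\<close>, the derivative of \<open>H\<close> dominates the bound for the derivative of the bump, and
  \<open>H\<close> is bounded independently of \<open>x\<close> and \<open>u\<close>.\<close>

lemma exp_phase_variation:
  "\<exists>C>0. \<exists>b>0. \<forall>x u. \<exists>H. (\<forall>s t. 1 \<le> s \<longrightarrow> s < t \<longrightarrow>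
     \<bar>exp (- (1/2) * phase t x u) - exp (- (1/2) * phase s x u)\<bar> \<le> C * Psi x u * (H t - H s)) \<and>
     (\<forall>s t. 1 \<le> s \<longrightarrow> s \<le> t \<longrightarrow> 0 \<le> H t - H s \<and> H t - H s \<le> b)"
proof -
  obtain C where C: "C > 0"
    "\<And>t x u. t \<ge> 1 \<Longrightarrow> \<exists>g'. ((\<lambda>t. exp (- (1/2) * phase t x u)) has_real_derivative g') (at t) \<and>
     \<bar>g'\<bar> \<le> C * bump t x u * (exp (- k_lo * t) + rho (E t *v u) / (1 + (rho (E t *v u) - rho x)\<^sup>2))"
    using exp_phase_derivative_bound by blast
  define b where "b = (1 + pi) / k_lo"
  have b: "b > 0" using k_lo(1) pi_gt_zero by (simp add: b_def add_pos_pos)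
  have "\<exists>H. (\<forall>s t. 1 \<le> s \<longrightarrow> s < t \<longrightarrow>
     \<bar>exp (- (1/2) * phase t x u) - exp (- (1/2) * phase s x u)\<bar> \<le> C * Psi x u * (H t - H s)) \<and>
     (\<forall>s t. 1 \<le> s \<longrightarrow> s \<le> t \<longrightarrow> 0 \<le> H t - H s \<and> H t - H s \<le> b)" for x u
  proof -
    define r where "r = (\<lambda>t. rho (E t *v u))"
    obtain r' where r': "\<And>t. (r has_real_derivative r' t) (at t)" "\<And>t. r' t \<le> - (k_lo * r t)"
      using rho_E_derivative[of u] unfolding r_def by metis
    obtain g' where g': "\<And>t. t \<ge> 1 \<Longrightarrow> ((\<lambda>t. exp (- (1/2) * phase t x u)) has_real_derivative g' t) (at t)"
      "\<And>t. t \<ge> 1 \<Longrightarrow> \<bar>g' t\<bar> \<le> C * bump t x u * (exp (- k_lo * t) + r t / (1 + (r t - rho x)\<^sup>2))"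
      using C(2)[of _ x u] unfolding r_def by metis
    define H where "H = (\<lambda>t. - (exp (- k_lo * t) + arctan (r t - rho x)) / k_lo)"
    define H' where "H' = (\<lambda>t. exp (- k_lo * t) + (- r' t / k_lo) / (1 + (r t - rho x)\<^sup>2))"
    have pos1: "0 < 1 + (r t - rho x)\<^sup>2" for t by (simp add: add_pos_nonneg)
    have dH: "(H has_real_derivative H' t) (at t)" for t
    proof -
      have alg: "- (- k * e + inverse w * d) / k = e + (- d / k) / w" if "k \<noteq> 0" "w \<noteq> 0" for k e w d :: real
        using that by (simp add: field_simps)
      have "(H has_real_derivative - (- k_lo * exp (- k_lo * t) + inverse (1 + (r t - rho x)\<^sup>2) * r' t) / k_lo) (at t)"
        unfolding H_def using k_lo(1) by (auto intro!: derivative_eq_intros r')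
      then show ?thesis
        unfolding H'_def using alg[of k_lo "1 + (r t - rho x)\<^sup>2"] k_lo(1) pos1[of t] by simp
    qed
    have H'_ge: "exp (- k_lo * t) + r t / (1 + (r t - rho x)\<^sup>2) \<le> H' t" for t
    proof -
      have "r t \<le> - r' t / k_lo" using r'(2)[of t] k_lo(1) by (simp add: field_simps)
      then show ?thesis unfolding H'_def using pos1[of t] by (intro add_left_mono divide_right_mono) auto
    qed
    have var: "\<bar>exp (- (1/2) * phase t x u) - exp (- (1/2) * phase s x u)\<bar> \<le> C * Psi x u * (H t - H s)"
      if s: "1 \<le> s" and st: "s < t" for s t
    proof -
      have "norm (exp (- (1/2) * phase t x u) - exp (- (1/2) * phase s x u))
          \<le> C * Psi x u * H t - C * Psi x u * H s"
      proof (rule differentiable_bound_general[OF st])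
        show "continuous_on {s..t} (\<lambda>t. exp (- (1/2) * phase t x u))"
          using DERIV_isCont[OF g'(1)] s by (intro continuous_at_imp_continuous_on ballI) auto
        show "continuous_on {s..t} (\<lambda>t. C * Psi x u * H t)"
          using DERIV_isCont[OF dH] by (intro continuous_on_mult_left continuous_at_imp_continuous_on ballI) auto
        fix y assume y: "s < y" "y < t"
        then have y1: "y \<ge> 1" using s by simp
        show "((\<lambda>t. exp (- (1/2) * phase t x u)) has_vector_derivative g' y) (at y)"
          using g'(1)[OF y1] by (simp add: has_real_derivative_iff_has_vector_derivative)
        show "((\<lambda>t. C * Psi x u * H t) has_vector_derivative C * Psi x u * H' y) (at y)"
          using DERIV_cmult[OF dH] by (simp add: has_real_derivative_iff_has_vector_derivative)
        have "\<bar>g' y\<bar> \<le> C * bump y x u * (exp (- k_lo * y) + r y / (1 + (r y - rho x)\<^sup>2))"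
          by (rule g'(2)[OF y1])
        also have "\<dots> \<le> C * Psi x u * H' y"
          using C(1) bump_le_Psi[OF y1, of x u] bump_bounds(1)[of y x u] H'_ge[of y] pos1[of y]
          by (intro mult_mono mult_left_mono add_nonneg_nonneg divide_nonneg_pos mult_nonneg_nonneg) (auto simp: r_def)
        finally show "norm (g' y) \<le> C * Psi x u * H' y" by simp
      qed
      then show ?thesis by (simp add: right_diff_distrib)
    qed
    have "0 \<le> H t - H s \<and> H t - H s \<le> b" if st: "1 \<le> s" "s \<le> t" for s t
    proof
      have "H s \<le> H t"
      proof (rule DERIV_nonneg_imp_nondecreasing[OF st(2)])
        fix y
        have "0 \<le> exp (- k_lo * y) + r y / (1 + (r y - rho x)\<^sup>2)"
          using pos1[of y] by (intro add_nonneg_nonneg divide_nonneg_pos) (auto simp: r_def)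
        then show "\<exists>z. (H has_real_derivative z) (at y) \<and> 0 \<le> z"
          using dH[of y] H'_ge[of y] by (meson order_trans)
      qed
      then show "0 \<le> H t - H s" by simp
      have e: "exp (- k_lo * s) \<le> 1" "0 < exp (- k_lo * t)" using k_lo(1) st by auto
      have "exp (- k_lo * s) + arctan (r s - rho x) - (exp (- k_lo * t) + arctan (r t - rho x)) \<le> 1 + pi"
        using e arctan_bounded[of "r s - rho x"] arctan_bounded[of "r t - rho x"] by linarith
      then have "(exp (- k_lo * s) + arctan (r s - rho x) - (exp (- k_lo * t) + arctan (r t - rho x))) / k_lo \<le> b"
        unfolding b_def using k_lo(1) by (intro divide_right_mono) auto
      then show "H t - H s \<le> b" by (simp add: H_def diff_divide_distrib add_divide_distrib)
    qed
    with var show ?thesis by blast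
  qed
  with C(1) b show ?thesis by blast
qed

lemma inv_cov_t_pos:
  assumes t: "t \<ge> 1/2" shows "positive_definite (P + transpose (E t) ** M t ** E t)"
  unfolding positive_definite_def
proof (intro allI impI)
  fix x :: "real ^ 'n" assume x: "x \<noteq> 0"
  have "((transpose (E t) ** M t ** E t) *v x) \<bullet> x = (M t *v (E t *v x)) \<bullet> (E t *v x)"
    by (simp add: inner_matrix_transpose flip: matrix_vector_mul_assoc)
  moreover have "0 \<le> M_form_const * rho2 (E t *v x)"
    using M_form_const(1) by simp
  then have "0 \<le> (M t *v (E t *v x)) \<bullet> (E t *v x)"
    using M_form_const(2)[OF t, of "E t *v x"] by linarith
  moreover have "0 < (P *v x) \<bullet> x" using P_pos x by (simp add: positive_definite_def)
  ultimately show "0 < ((P + transpose (E t) ** M t ** E t) *v x) \<bullet> x"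
    by (simp add: mv.add_left inner_add_left)
qed

lemma det_cov_t_inverse:
  "t \<ge> 1/2 \<Longrightarrow> det (cov_t t) * det (P + transpose (E t) ** M t ** E t) = 1"
  using arg_cong[OF cov_t_inverse, of t det] by (simp add: det_mul)

lemma det_cov_t_pos: assumes "t \<ge> 1/2" shows "det (cov_t t) > 0"
  using det_cov_t_inverse[OF assms] det_positive_definite[OF inv_cov_t_pos[OF assms]]
  by (metis zero_less_mult_pos2 zero_less_one)

lemma cov_t_bounds:
  "\<exists>K. \<forall>t\<ge>1/2. norm (cov_t t) \<le> K \<and> norm (P + transpose (E t) ** M t ** E t) \<le> K"
proof -
  obtain L where L: "L > 0" "\<And>(A :: real ^ 'n ^ 'n) (A' :: real ^ 'n ^ 'n). norm (A ** A') \<le> norm A * norm A' * L"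
    using mm.pos_bounded by blast
  obtain KE where KE: "KE > 0" "\<And>t. t \<ge> 0 \<Longrightarrow> norm (E t) \<le> KE * exp (- k_lo * t)"
    using E_norm_decay by blast
  obtain KM where KM: "KM > 0" "\<And>t. t \<ge> 1/2 \<Longrightarrow> norm (M t) \<le> KM"
    using M_bounded by blast
  obtain C c where C: "C > 0" "c > 0" "\<And>t. t \<ge> 0 \<Longrightarrow> norm (F t ** cov ** transpose (F t)) \<le> C * exp (- c * t)"
    using conj_decay[where X = cov] by blast
  define K where "K = (norm cov + C) + (norm P + KE * KM * L * KE * L)"
  have "norm (cov_t t) \<le> K \<and> norm (P + transpose (E t) ** M t ** E t) \<le> K" if t: "t \<ge> 1/2" for t
  proof
    have "C * exp (- c * t) \<le> C * 1" using C t by (intro mult_left_mono) auto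
    then have 1: "norm (F t ** cov ** transpose (F t)) \<le> C" using C(3)[of t] t by simp
    have "norm (cov_t t) \<le> norm cov + C"
      using t 1 norm_triangle_ineq4[of cov "F t ** cov ** transpose (F t)"] by (simp add: cov_t_eq)
    moreover have "0 \<le> norm P + KE * KM * L * KE * L" using KE KM L by simp
    ultimately show "norm (cov_t t) \<le> K" by (simp add: K_def)
    have "KE * exp (- k_lo * t) \<le> KE * 1" using KE k_lo(1) t by (intro mult_left_mono) auto
    then have E1: "norm (E t) \<le> KE" using KE(2)[of t] t by simp
    have "norm (transpose (E t) ** M t) \<le> KE * KM * L"
      by (rule order_trans[OF L(2)]) (use E1 KM t KE L in \<open>intro mult_mono; auto simp: norm_transpose\<close>)
    then have "norm (transpose (E t) ** M t ** E t) \<le> KE * KM * L * KE * L"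
      using E1 KE L KM by (intro order_trans[OF L(2)]) (intro mult_mono; auto)
    moreover have "0 \<le> norm cov + C" using C by simp
    ultimately show "norm (P + transpose (E t) ** M t ** E t) \<le> K"
      using norm_triangle_ineq[of P "transpose (E t) ** M t ** E t"] by (simp add: K_def)
  qed
  then show ?thesis by blast
qed

text \<open>The determinants of \<open>cov_t t\<close> and of its inverse are both bounded, and their product is one.\<close>

lemma det_cov_t_bounds:
  "\<exists>p q. 0 < p \<and> (\<forall>t\<ge>1/2. p \<le> det (cov_t t) \<and> det (cov_t t) \<le> q)"
proof -
  obtain K where K: "\<And>t. t \<ge> 1/2 \<Longrightarrow> norm (cov_t t) \<le> K"
    "\<And>t. t \<ge> 1/2 \<Longrightarrow> norm (P + transpose (E t) ** M t ** E t) \<le> K"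
    using cov_t_bounds by blast
  have K0: "0 \<le> K" using order_trans[OF norm_ge_zero K(1)[of 1]] by simp
  obtain C where C: "C > 0" "\<And>(X :: real ^ 'n ^ 'n) (Y :: real ^ 'n ^ 'n). norm X \<le> K \<Longrightarrow> norm Y \<le> K \<Longrightarrow>
     \<bar>det X - det Y\<bar> \<le> C * norm (X - Y)"
    using det_lipschitz[of K] by blast
  define q where "q = C * K + \<bar>det (0 :: real ^ 'n ^ 'n)\<bar> + 1"
  have q: "q > 0" using C(1) K0 by (simp add: q_def add_nonneg_pos)
  have le: "det X \<le> q" if "norm X \<le> K" for X :: "real ^ 'n ^ 'n"
  proof -
    have "\<bar>det X - det (0 :: real ^ 'n ^ 'n)\<bar> \<le> C * norm (X - 0)" by (rule C(2)) (use that K0 in auto)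
    also have "\<dots> \<le> C * K" using that C(1) by (intro mult_left_mono) auto
    finally show ?thesis by (simp add: q_def)
  qed
  have "1 / q \<le> det (cov_t t) \<and> det (cov_t t) \<le> q" if t: "t \<ge> 1/2" for t
  proof
    show "det (cov_t t) \<le> q" by (intro le K t)
    have "1 \<le> det (cov_t t) * q"
      using mult_left_mono[OF le[OF K(2)[OF t]] less_imp_le[OF det_cov_t_pos[OF t]]] det_cov_t_inverse[OF t] by simp
    then show "1 / q \<le> det (cov_t t)" using q by (simp add: field_simps)
  qed
  then show ?thesis using q by (intro exI[of _ "1 / q"] exI[of _ q]) auto
qed

text \<open>The derivative of \<open>cov_t\<close> is the exponentially small matrix \<open>G\<close>.\<close>

lemma det_cov_t_variation:
  "\<exists>C>0. \<exists>c>0. \<forall>s t. 1 \<le> s \<longrightarrow> s < t \<longrightarrow> \<bar>det (cov_t t) - det (cov_t s)\<bar> \<le> C * (exp (- c * s) - exp (- c * t))"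
proof -
  obtain K where K: "\<And>t. t \<ge> 1/2 \<Longrightarrow> norm (cov_t t) \<le> K" using cov_t_bounds by blast
  obtain L where L: "L > 0" "\<And>(X :: real ^ 'n ^ 'n) (Y :: real ^ 'n ^ 'n). norm X \<le> K \<Longrightarrow> norm Y \<le> K \<Longrightarrow>
     \<bar>det X - det Y\<bar> \<le> L * norm (X - Y)"
    using det_lipschitz[of K] by blast
  obtain C c where C: "C > 0" "c > 0" "\<And>t. t \<ge> 0 \<Longrightarrow> norm (G t) \<le> C * exp (- c * t)"
    unfolding G_def using conj_decay[where X = Q] by blast
  \<comment> \<open>A formula for \<open>cov_t\<close> that is smooth on the whole line.\<close>
  define f where "f = (\<lambda>t. cov - F t ** cov ** transpose (F t))"
  have df: "(f has_vector_derivative G t) (at t)" for t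
    using has_vector_derivative_diff[OF has_vector_derivative_const F_conj_has_vector_derivative[of cov t UNIV], of cov]
    by (simp add: f_def lyapunov G_def mm.minus_left mm.minus_right)
  have "\<bar>det (cov_t t) - det (cov_t s)\<bar> \<le> (L * (C / c)) * (exp (- c * s) - exp (- c * t))"
    if s: "1 \<le> s" and st: "s < t" for s t
  proof -
    have "norm (f t - f s) \<le> - (C / c) * exp (- c * t) - (- (C / c) * exp (- c * s))"
    proof (rule differentiable_bound_general[OF st])
      show "continuous_on {s..t} f"
        using df by (intro continuous_at_imp_continuous_on ballI has_vector_derivative_continuous) auto
      show "continuous_on {s..t} (\<lambda>t. - (C / c) * exp (- c * t))" by (intro continuous_intros)
      fix x assume x: "s < x" "x < t"
      show "(f has_vector_derivative G x) (at x)" by (rule df)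
      show "((\<lambda>t. - (C / c) * exp (- c * t)) has_vector_derivative C * exp (- c * x)) (at x)"
        unfolding has_real_derivative_iff_has_vector_derivative[symmetric]
        using C(2) by (auto intro!: derivative_eq_intros)
      show "norm (G x) \<le> C * exp (- c * x)" using x s by (intro C(3)) simp
    qed
    then have "norm (cov_t t - cov_t s) \<le> (C / c) * (exp (- c * s) - exp (- c * t))"
      using s st by (simp add: cov_t_eq f_def right_diff_distrib)
    then have "L * norm (cov_t t - cov_t s) \<le> L * ((C / c) * (exp (- c * s) - exp (- c * t)))"
      using L(1) by (intro mult_left_mono) auto
    moreover have "\<bar>det (cov_t t) - det (cov_t s)\<bar> \<le> L * norm (cov_t t - cov_t s)"
      using s st by (intro L(2) K) auto
    ultimately show ?thesis by (simp add: mult.assoc)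
  qed
  moreover have "L * (C / c) > 0" using L(1) C by simp
  ultimately show ?thesis using C(2) by blast
qed

lemma sqrt_diff_bound:
  fixes a b m :: real
  assumes "0 < m" "m \<le> a" "m \<le> b"
  shows "\<bar>sqrt a - sqrt b\<bar> \<le> \<bar>a - b\<bar> / sqrt m"
proof -
  have s: "sqrt m \<le> sqrt a" "0 < sqrt m" "0 \<le> sqrt b" using assms by auto
  have "\<bar>sqrt a - sqrt b\<bar> * sqrt m \<le> \<bar>sqrt a - sqrt b\<bar> * (sqrt a + sqrt b)"
  proof (rule mult_left_mono)
    show "sqrt m \<le> sqrt a + sqrt b" using s by linarith
  qed simp
  also have "\<dots> = \<bar>(sqrt a - sqrt b) * (sqrt a + sqrt b)\<bar>"
    using s by (simp add: abs_mult)
  also have "(sqrt a - sqrt b) * (sqrt a + sqrt b) = a - b"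
    using assms by (simp add: algebra_simps)
  finally show ?thesis using s by (simp add: pos_le_divide_eq)
qed

lemma factor_bounds:
  "\<exists>D>0. \<exists>C>0. \<exists>c>0. (\<forall>t\<ge>1. 0 \<le> factor t \<and> factor t \<le> D) \<and>
    (\<forall>s t. 1 \<le> s \<longrightarrow> s < t \<longrightarrow> \<bar>factor t - factor s\<bar> \<le> C * (exp (- c * s) - exp (- c * t)))"
proof -
  obtain p q where pq: "0 < p" "\<And>t. t \<ge> 1/2 \<Longrightarrow> p \<le> det (cov_t t)" "\<And>t. t \<ge> 1/2 \<Longrightarrow> det (cov_t t) \<le> q"
    using det_cov_t_bounds by blast
  obtain C c where C: "C > 0" "c > 0"
    "\<And>s t. 1 \<le> s \<Longrightarrow> s < t \<Longrightarrow> \<bar>det (cov_t t) - det (cov_t s)\<bar> \<le> C * (exp (- c * s) - exp (- c * t))"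
    using det_cov_t_variation by blast
  have d0: "det cov > 0" by (rule det_positive_definite[OF cov_pos])
  have q: "q > 0" using pq(1) pq(2)[of 1] pq(3)[of 1] by simp
  define D where "D = sqrt (det cov / p) + 1"
  have D: "D > 0" unfolding D_def using d0 pq(1) by (intro add_nonneg_pos) auto
  define m where "m = det cov / q"
  have m: "m > 0" using d0 q by (simp add: m_def)
  define C' where "C' = det cov * C / (p * p) / sqrt m"
  have C': "C' > 0" using d0 C(1) pq(1) m by (simp add: C'_def)
  have "0 \<le> factor t \<and> factor t \<le> D" if t: "t \<ge> 1" for t
  proof
    show "0 \<le> factor t" using d0 det_cov_t_pos[of t] t by (simp add: factor_def)
    have "det cov / det (cov_t t) \<le> det cov / p"
      using d0 pq(1) pq(2)[of t] t by (intro divide_left_mono mult_pos_pos) auto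
    then have "factor t \<le> sqrt (det cov / p)" unfolding factor_def by (rule real_sqrt_le_mono)
    then show "factor t \<le> D" by (simp add: D_def)
  qed
  moreover have "\<bar>factor t - factor s\<bar> \<le> C' * (exp (- c * s) - exp (- c * t))" if s: "1 \<le> s" and st: "s < t" for s t
  proof -
    define a b where "a = det (cov_t t)" and "b = det (cov_t s)"
    have ab: "p \<le> a" "p \<le> b" "a \<le> q" "b \<le> q" using s st pq by (auto simp: a_def b_def)
    then have pos: "0 < a" "0 < b" using pq(1) by auto
    have "\<bar>factor t - factor s\<bar> \<le> \<bar>det cov / a - det cov / b\<bar> / sqrt m"
      unfolding factor_def a_def[symmetric] b_def[symmetric]
      using m d0 pos ab q by (intro sqrt_diff_bound) (auto simp: m_def intro!: divide_left_mono)
    also have "\<bar>det cov / a - det cov / b\<bar> = det cov * \<bar>a - b\<bar> / (a * b)"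
      using pos d0 by (simp add: diff_frac_eq abs_mult abs_minus_commute flip: right_diff_distrib)
    also have "det cov * \<bar>a - b\<bar> / (a * b) \<le> det cov * (C * (exp (- c * s) - exp (- c * t))) / (p * p)"
      using C(3)[OF s st] d0 ab pq(1) by (intro frac_le mult_left_mono mult_mono) (auto simp: a_def b_def)
    finally show ?thesis using m by (simp add: C'_def divide_right_mono mult_ac)
  qed
  ultimately show ?thesis using D C' C(2) by blast
qed

text \<open>Increments of the product are split into those of \<open>factor\<close>, weighted by the bump, and those of
  the exponential, weighted by \<open>factor\<close>.\<close>

lemma OU_kernel_variation:
  "\<exists>C>0. \<forall>x u n (\<tau> :: nat \<Rightarrow> real). strict_mono_on {..n} \<tau> \<longrightarrow> \<tau> ` {..n} \<subseteq> {1..} \<longrightarrow>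
     (\<Sum>i=1..n. \<bar>OU_kernel Q B (\<tau> i) x u - OU_kernel Q B (\<tau> (i - 1)) x u\<bar>) \<le> C * exp (rho2 x / 2) * Psi x u"
proof -
  obtain D Cd c where D: "D > 0" "Cd > 0" "c > 0" "\<And>t. t \<ge> 1 \<Longrightarrow> 0 \<le> factor t" "\<And>t. t \<ge> 1 \<Longrightarrow> factor t \<le> D"
    "\<And>s t. 1 \<le> s \<Longrightarrow> s < t \<Longrightarrow> \<bar>factor t - factor s\<bar> \<le> Cd * (exp (- c * s) - exp (- c * t))"
    using factor_bounds by blast
  obtain C b where C: "C > 0" "b > 0" "\<And>x u. \<exists>H. (\<forall>s t. 1 \<le> s \<longrightarrow> s < t \<longrightarrow>
     \<bar>exp (- (1/2) * phase t x u) - exp (- (1/2) * phase s x u)\<bar> \<le> C * Psi x u * (H t - H s)) \<and>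
     (\<forall>s t. 1 \<le> s \<longrightarrow> s \<le> t \<longrightarrow> 0 \<le> H t - H s \<and> H t - H s \<le> b)"
    using exp_phase_variation by blast
  define C' where "C' = Cd + D * C * b"
  have C': "C' > 0" unfolding C'_def using D C by (intro add_pos_pos) auto
  have main: "(\<Sum>i=1..n. \<bar>OU_kernel Q B (\<tau> i) x u - OU_kernel Q B (\<tau> (i - 1)) x u\<bar>) \<le> C' * exp (rho2 x / 2) * Psi x u"
    if sm: "strict_mono_on {..n} \<tau>" and im: "\<tau> ` {..n} \<subseteq> {1..}" for x u n and \<tau> :: "nat \<Rightarrow> real"
  proof -
    obtain H where H: "\<And>s t. 1 \<le> s \<Longrightarrow> s < t \<Longrightarrow>
     \<bar>exp (- (1/2) * phase t x u) - exp (- (1/2) * phase s x u)\<bar> \<le> C * Psi x u * (H t - H s)"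
     "\<And>s t. 1 \<le> s \<Longrightarrow> s \<le> t \<Longrightarrow> 0 \<le> H t - H s" "\<And>s t. 1 \<le> s \<Longrightarrow> s \<le> t \<Longrightarrow> H t - H s \<le> b"
      using C(3)[of x u] by blast
    define A where "A = exp (rho2 x / 2) * Psi x u"
    have A: "A > 0" using Psi_pos by (simp add: A_def)
    define J where "J = (\<lambda>t. A * (- Cd * exp (- c * t) + D * C * H t))"
    have "(\<Sum>i=1..n. \<bar>OU_kernel Q B (\<tau> i) x u - OU_kernel Q B (\<tau> (i - 1)) x u\<bar>) \<le> J (\<tau> n) - J (\<tau> 0)"
    proof (rule sum_telescope_le[OF sm im])
      fix s t :: real assume "s \<in> {1..}" "t \<in> {1..}" and st: "s < t"
      then have s: "1 \<le> s" and t: "1 \<le> t" by auto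
      define g where "g = (\<lambda>t. exp (- (1/2) * phase t x u))"
      have "g t \<le> Psi x u"
        using exp_phase_le_bump[of t x u] bump_le_Psi[OF t, of x u] t by (simp add: g_def)
      moreover have "g t > 0" by (simp add: g_def)
      ultimately have gt: "\<bar>g t\<bar> \<le> Psi x u" by simp
      have "OU_kernel Q B t x u - OU_kernel Q B s x u
          = exp (rho2 x / 2) * ((factor t - factor s) * g t + factor s * (g t - g s))"
        using s t by (simp add: OU_kernel_eq g_def algebra_simps)
      then have "\<bar>OU_kernel Q B t x u - OU_kernel Q B s x u\<bar>
          \<le> exp (rho2 x / 2) * (\<bar>factor t - factor s\<bar> * \<bar>g t\<bar> + \<bar>factor s\<bar> * \<bar>g t - g s\<bar>)"
        by (simp add: abs_mult) (metis abs_mult abs_triangle_ineq)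
      also have "\<dots> \<le> exp (rho2 x / 2) * ((Cd * (exp (- c * s) - exp (- c * t))) * Psi x u + D * (C * Psi x u * (H t - H s)))"
        using D(4)[OF s] D(5)[OF s] D(6)[OF s st] gt H(1)[OF s st] D(1)
        by (intro mult_left_mono add_mono mult_mono) (auto simp: g_def)
      also have "\<dots> = J t - J s" by (simp add: J_def A_def algebra_simps)
      finally show "\<bar>OU_kernel Q B t x u - OU_kernel Q B s x u\<bar> \<le> J t - J s" .
    qed
    also have "J (\<tau> n) - J (\<tau> 0) \<le> A * C'"
    proof -
      have t: "1 \<le> \<tau> 0" "\<tau> 0 \<le> \<tau> n"
        using im sm by (auto simp: strict_mono_on_def) (metis atMost_iff le0 le_neq_implies_less less_imp_le order_refl)
      have "exp (- c * \<tau> 0) \<le> 1" "0 < exp (- c * \<tau> n)" using D(3) t by auto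
      then have "exp (- c * \<tau> 0) - exp (- c * \<tau> n) \<le> 1" by linarith
      then have "Cd * (exp (- c * \<tau> 0) - exp (- c * \<tau> n)) \<le> Cd * 1" by (intro mult_left_mono less_imp_le[OF D(2)])
      moreover have "D * C * (H (\<tau> n) - H (\<tau> 0)) \<le> D * C * b"
        using H(3)[OF t] D(1) C(1) by (intro mult_left_mono) auto
      ultimately have "Cd * (exp (- c * \<tau> 0) - exp (- c * \<tau> n)) + D * C * (H (\<tau> n) - H (\<tau> 0)) \<le> C'"
        by (simp add: C'_def)
      then have "A * (Cd * (exp (- c * \<tau> 0) - exp (- c * \<tau> n)) + D * C * (H (\<tau> n) - H (\<tau> 0))) \<le> A * C'"
        using A by (intro mult_left_mono) auto
      then show ?thesis by (simp add: J_def algebra_simps)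
    qed
    finally show ?thesis by (simp add: A_def mult_ac)
  qed
  show ?thesis by (intro exI[of _ C'] conjI allI impI C' main)
qed

end

section \<open>Integration lemmas on Euclidean space\<close>

text \<open>Comparison with \<open>1 / (1 + x\<^sup>2)\<close>, whose primitive is the arctangent.\<close>

lemma nn_integral_gaussian_1D_finite:
  assumes a: "a > 0"
  shows "(\<integral>\<^sup>+x. ennreal (exp (- a * x\<^sup>2)) \<partial>(lborel :: real measure)) < \<infinity>"
proof -
  define m where "m = min 1 a"
  have m: "m > 0" using a by (simp add: m_def)
  define f where "f = (\<lambda>x::real. inverse (1 + x\<^sup>2) / m)"
  have fb: "f \<in> borel_measurable borel" unfolding f_def by measurable
  have bd: "exp (- a * x\<^sup>2) \<le> f x" for x
  proof -
    have p: "0 < 1 + x\<^sup>2" by (simp add: add_pos_nonneg)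
    have "m * (1 + x\<^sup>2) \<le> 1 + a * x\<^sup>2"
      unfolding distrib_left by (intro add_mono mult_right_mono) (auto simp: m_def)
    also have "\<dots> \<le> exp (a * x\<^sup>2)" by (rule exp_ge_add_one_self)
    finally have "inverse (exp (a * x\<^sup>2)) \<le> inverse (m * (1 + x\<^sup>2))"
      using p m by (intro le_imp_inverse_le mult_pos_pos)
    then show ?thesis by (simp add: f_def exp_minus divide_inverse mult.commute)
  qed
  have half: "(\<integral>\<^sup>+x. ennreal (f x) * indicator {0..} x \<partial>lborel) = ennreal ((pi / 2) / m - arctan 0 / m)"
  proof (rule nn_integral_FTC_atLeast[OF fb])
    show "((\<lambda>x. arctan x / m) has_real_derivative f x) (at x)" for x
      unfolding f_def by (rule DERIV_cdivide[OF DERIV_arctan])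
    show "0 \<le> f x" for x using m by (simp add: f_def)
    show "((\<lambda>x. arctan x / m) \<longlongrightarrow> (pi / 2) / m) at_top"
      using m by (intro tendsto_divide tendsto_arctan_at_top tendsto_const) auto
  qed
  have even: "f (- x) = f x" for x by (simp add: f_def)
  have "(\<integral>\<^sup>+x. ennreal (exp (- a * x\<^sup>2)) \<partial>lborel)
      \<le> (\<integral>\<^sup>+x. (ennreal (f x) * indicator {0..} x + ennreal (f (- x)) * indicator {0..} (- x)) \<partial>lborel)"
  proof (rule nn_integral_mono)
    fix x
    have "ennreal (exp (- a * x\<^sup>2)) \<le> ennreal (f x)" by (rule ennreal_leI[OF bd])
    then show "ennreal (exp (- a * x\<^sup>2)) \<le> ennreal (f x) * indicator {0..} x + ennreal (f (- x)) * indicator {0..} (- x)"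
      unfolding even by (cases "0 \<le> x") (auto intro: add_increasing2)
  qed
  also have "\<dots> = (\<integral>\<^sup>+x. ennreal (f x) * indicator {0..} x \<partial>lborel) + (\<integral>\<^sup>+x. ennreal (f (- x)) * indicator {0..} (- x) \<partial>lborel)"
    using fb by (intro nn_integral_add) auto
  also have "(\<integral>\<^sup>+x. ennreal (f (- x)) * indicator {0..} (- x) \<partial>lborel) = (\<integral>\<^sup>+x. ennreal (f x) * indicator {0..} x \<partial>lborel)"
    using nn_integral_real_affine[of "\<lambda>x. ennreal (f x) * indicator {0..} x" "-1" 0] fb by simp
  also have "(\<integral>\<^sup>+x. ennreal (f x) * indicator {0..} x \<partial>lborel) + (\<integral>\<^sup>+x. ennreal (f x) * indicator {0..} x \<partial>lborel) < \<infinity>"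
    unfolding half by simp
  finally show ?thesis .
qed

lemma nn_integral_gaussian_finite:
  assumes a: "a > 0"
  shows "(\<integral>\<^sup>+x. ennreal (exp (- a * (norm x)\<^sup>2)) \<partial>(lborel :: 'a :: euclidean_space measure)) < \<infinity>"
proof -
  have "exp (- a * (norm x)\<^sup>2) = (\<Prod>b\<in>Basis. exp (- a * (x \<bullet> b)\<^sup>2))" for x :: 'a
  proof -
    have "(norm x)\<^sup>2 = (\<Sum>b\<in>Basis. (x \<bullet> b)\<^sup>2)"
      unfolding power2_norm_eq_inner euclidean_inner[of x x] by (simp add: power2_eq_square)
    then show ?thesis by (simp add: exp_sum sum_distrib_left flip: sum_negf)
  qed
  then have "(\<integral>\<^sup>+x. ennreal (exp (- a * (norm x)\<^sup>2)) \<partial>(lborel :: 'a measure))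
      = (\<integral>\<^sup>+x. (\<Prod>b\<in>Basis. ennreal (exp (- a * (x \<bullet> b)\<^sup>2))) \<partial>(lborel :: 'a measure))"
    by (simp add: prod_ennreal)
  also have "\<dots> = (\<Prod>b\<in>(Basis :: 'a set). (\<integral>\<^sup>+x. ennreal (exp (- a * x\<^sup>2)) \<partial>lborel))"
    by (rule nn_integral_lborel_prod) auto
  also have "\<dots> < \<infinity>"
    using nn_integral_gaussian_1D_finite[OF a] by (simp add: power_less_top_ennreal)
  finally show ?thesis .
qed

lemma nn_integral_lborel_reflect_translate:
  fixes k :: "'a :: euclidean_space \<Rightarrow> ennreal"
  assumes k: "k \<in> borel_measurable borel"
  shows "(\<integral>\<^sup>+x. k x \<partial>lborel) = (\<integral>\<^sup>+w. k (t - w) \<partial>lborel)" "(\<integral>\<^sup>+x. k x \<partial>lborel) = (\<integral>\<^sup>+w. k (t + w) \<partial>lborel)"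
proof -
  have aff: "(\<integral>\<^sup>+x. k x \<partial>lborel) = (\<integral>\<^sup>+w. k (t + c *\<^sub>R w) \<partial>lborel)" if "c = 1 \<or> c = -1" for c
  proof -
    have "lborel = density (distr lborel borel (\<lambda>x. t + c *\<^sub>R x)) (\<lambda>_. ennreal (\<bar>c\<bar> ^ DIM('a)))"
      using that by (intro lborel_affine) auto
    also have "\<dots> = distr lborel borel (\<lambda>x. t + c *\<^sub>R x)"
      using that by (auto simp: density_1)
    finally have "(\<integral>\<^sup>+x. k x \<partial>lborel) = (\<integral>\<^sup>+x. k x \<partial>distr lborel borel (\<lambda>x. t + c *\<^sub>R x))" by simp
    then show ?thesis using k by (simp add: nn_integral_distr)
  qed
  from aff[of "-1"] aff[of 1]
  show "(\<integral>\<^sup>+x. k x \<partial>lborel) = (\<integral>\<^sup>+w. k (t - w) \<partial>lborel)" "(\<integral>\<^sup>+x. k x \<partial>lborel) = (\<integral>\<^sup>+w. k (t + w) \<partial>lborel)"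
    by simp_all
qed

text \<open>The integral \<open>\<integral> h (A y) dy\<close> is translation invariant in \<open>h\<close>, hence proportional to the
  integral of \<open>h\<close>; the constant is read off by convolving with the unit ball.\<close>

lemma nn_integral_linear_change:
  fixes A A' :: "real ^ 'n ^ 'n" and h :: "real ^ 'n \<Rightarrow> ennreal"
  assumes inv: "A ** A' = mat 1" and h: "h \<in> borel_measurable borel"
  shows "emeasure lborel {y. A *v y \<in> cball 0 1} * (\<integral>\<^sup>+x. h x \<partial>lborel)
    = emeasure lborel (cball (0 :: real ^ 'n) 1) * (\<integral>\<^sup>+y. h (A *v y) \<partial>lborel)"
proof -
  define W where "W = cball (0 :: real ^ 'n) 1"
  have W: "W \<in> sets borel" by (simp add: W_def)
  define k :: "real ^ 'n \<Rightarrow> ennreal" where "k = indicator W"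
  have k[measurable]: "k \<in> borel_measurable borel" using W by (simp add: k_def)
  note h[measurable]
  have A[measurable]: "(\<lambda>y. A *v y) \<in> borel_measurable borel"
    by (intro borel_measurable_continuous_onI mv.continuous_on continuous_on_const continuous_on_id)
  have shift: "A *v (A' *v x + y) = x + A *v y" for x y
    by (simp add: mv.add_right matrix_vector_mul_assoc inv)
  have "emeasure lborel {y. A *v y \<in> W} = (\<integral>\<^sup>+y. indicator {y. A *v y \<in> W} y \<partial>lborel)"
    using W by (subst nn_integral_indicator) (auto intro: measurable_sets_borel[OF A, unfolded vimage_def])
  then have c: "emeasure lborel {y. A *v y \<in> W} = (\<integral>\<^sup>+y. k (A *v y) \<partial>lborel)"
    by (simp add: k_def indicator_def)
  have c_shift: "(\<integral>\<^sup>+y. k (A *v y - x) \<partial>lborel) = (\<integral>\<^sup>+y. k (A *v y) \<partial>lborel)" for x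
    by (subst nn_integral_lborel_reflect_translate(2)[of _ "A' *v x"]) (simp_all add: shift)
  have h_shift: "(\<integral>\<^sup>+y. h (A *v y - w) \<partial>lborel) = (\<integral>\<^sup>+y. h (A *v y) \<partial>lborel)" for w
    by (subst nn_integral_lborel_reflect_translate(2)[of _ "A' *v w"]) (simp_all add: shift)
  have "(\<integral>\<^sup>+y. k (A *v y) \<partial>lborel) * (\<integral>\<^sup>+x. h x \<partial>lborel) = (\<integral>\<^sup>+x. (\<integral>\<^sup>+y. h x * k (A *v y - x) \<partial>lborel) \<partial>lborel)"
    by (simp add: nn_integral_cmult nn_integral_multc c_shift mult.commute)
  also have "\<dots> = (\<integral>\<^sup>+y. (\<integral>\<^sup>+x. h x * k (A *v y - x) \<partial>lborel) \<partial>lborel)"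
    by (rule lborel_pair.Fubini'[symmetric]) simp
  also have "\<dots> = (\<integral>\<^sup>+y. (\<integral>\<^sup>+w. h (A *v y - w) * k w \<partial>lborel) \<partial>lborel)"
  proof (rule nn_integral_cong)
    fix y
    show "(\<integral>\<^sup>+x. h x * k (A *v y - x) \<partial>lborel) = (\<integral>\<^sup>+w. h (A *v y - w) * k w \<partial>lborel)"
      using nn_integral_lborel_reflect_translate(1)[of "\<lambda>x. h x * k (A *v y - x)" "A *v y"] by simp
  qed
  also have "\<dots> = (\<integral>\<^sup>+w. (\<integral>\<^sup>+y. h (A *v y - w) * k w \<partial>lborel) \<partial>lborel)"
    by (rule lborel_pair.Fubini') simp
  also have "\<dots> = (\<integral>\<^sup>+w. k w \<partial>lborel) * (\<integral>\<^sup>+y. h (A *v y) \<partial>lborel)"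
    by (simp add: nn_integral_multc nn_integral_cmult h_shift) (simp add: mult.commute)
  also have "(\<integral>\<^sup>+w. k w \<partial>lborel) = emeasure lborel W" using W by (simp add: k_def)
  finally show ?thesis by (simp add: c[symmetric] W_def)
qed

text \<open>A matrix that expands by at most \<open>a\<close> maps the ball of radius \<open>1 / a\<close> into the unit ball, which
  bounds the constant of proportionality.\<close>

lemma nn_integral_linear_bound:
  fixes a :: real
  assumes a: "a > 0"
  shows "\<exists>J :: real. 0 < J \<and> (\<forall>(A :: real ^ 'n ^ 'n) A' h. A ** A' = mat 1 \<longrightarrow> (\<forall>y. norm (A *v y) \<le> a * norm y) \<longrightarrow>
    h \<in> borel_measurable borel \<longrightarrow> (\<integral>\<^sup>+x. h x \<partial>lborel) \<le> ennreal J * (\<integral>\<^sup>+y. h (A *v y) \<partial>lborel))"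
proof -
  define b where "b = measure lborel (cball (0 :: real ^ 'n) (1 / a))"
  define v where "v = measure lborel (cball (0 :: real ^ 'n) 1)"
  have fin: "emeasure lborel (cball (0 :: real ^ 'n) r) = ennreal (measure lborel (cball (0 :: real ^ 'n) r))" for r
    using emeasure_bounded_finite[OF bounded_cball, of "0 :: real ^ 'n" r] by (intro emeasure_eq_ennreal_measure) auto
  have pos: "0 < measure lborel (cball (0 :: real ^ 'n) r)" if "r > 0" for r
    using content_cball_pos[OF that] by simp
  have bv: "b > 0" "v > 0" using a pos by (auto simp: b_def v_def)
  have "(\<integral>\<^sup>+x. h x \<partial>lborel) \<le> ennreal (v / b) * (\<integral>\<^sup>+y. h (A *v y) \<partial>lborel)"
    if inv: "A ** A' = mat 1" and bd: "\<And>y. norm (A *v y) \<le> a * norm y" and h: "h \<in> borel_measurable borel"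
    for A A' :: "real ^ 'n ^ 'n" and h
  proof -
    have sub: "cball 0 (1 / a) \<subseteq> {y. A *v y \<in> cball 0 1}"
    proof
      fix y :: "real ^ 'n" assume "y \<in> cball 0 (1 / a)"
      then have "a * norm y \<le> 1" using a by (simp add: field_simps)
      then show "y \<in> {y. A *v y \<in> cball 0 1}" using bd[of y] by simp
    qed
    have A: "(\<lambda>y. A *v y) \<in> borel_measurable borel"
      by (intro borel_measurable_continuous_onI mv.continuous_on continuous_on_const continuous_on_id)
    have "{y. A *v y \<in> cball 0 1} \<in> sets lborel"
      using measurable_sets_borel[OF A, of "cball 0 1"] by (simp add: vimage_def)
    then have "ennreal b \<le> emeasure lborel {y. A *v y \<in> cball 0 1}"
      unfolding b_def fin[symmetric] by (rule emeasure_mono[OF sub])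
    then have "ennreal b * (\<integral>\<^sup>+x. h x \<partial>lborel) \<le> emeasure lborel {y. A *v y \<in> cball 0 1} * (\<integral>\<^sup>+x. h x \<partial>lborel)"
      by (rule mult_right_mono) simp
    also have "\<dots> = ennreal v * (\<integral>\<^sup>+y. h (A *v y) \<partial>lborel)"
      unfolding nn_integral_linear_change[OF inv h] v_def fin ..
    finally have "ennreal (1 / b) * (ennreal b * (\<integral>\<^sup>+x. h x \<partial>lborel)) \<le> ennreal (1 / b) * (ennreal v * (\<integral>\<^sup>+y. h (A *v y) \<partial>lborel))"
      by (rule mult_left_mono) simp
    moreover have "ennreal (1 / b) * ennreal b = 1" "ennreal (1 / b) * ennreal v = ennreal (v / b)"
      using bv by (simp_all flip: ennreal_mult ennreal_1)
    ultimately show ?thesis by (simp flip: mult.assoc)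
  qed
  moreover have "0 < v / b" using bv by simp
  ultimately show ?thesis by blast
qed

text \<open>When the exponent grows at least at the rate \<open>l\<close>, the integral over a superlevel set is
  dominated by the value at the first entrance time.\<close>

lemma nn_integral_exp_growth:
  fixes g :: "real \<Rightarrow> real"
  assumes g: "continuous_on {0..} g" "\<And>s t. 0 \<le> s \<Longrightarrow> s \<le> t \<Longrightarrow> l * (t - s) \<le> g t - g s"
    and l: "l > 0" and \<beta>: "\<beta> \<ge> 0"
  shows "(\<integral>\<^sup>+t. ennreal (exp (- g t)) * indicator {t. 0 \<le> t \<and> exp (- g t) < \<beta>} t \<partial>lborel) \<le> ennreal (\<beta> / l)"
proof (cases "{t. 0 \<le> t \<and> exp (- g t) < \<beta>} = {}")
  case True
  then show ?thesis by simp
next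
  case False
  define T where "T = {t. 0 \<le> t \<and> exp (- g t) < \<beta>}"
  define t0 where "t0 = Inf T"
  have bdd: "bdd_below T" unfolding T_def by (intro bdd_belowI[of _ 0]) auto
  have ne: "T \<noteq> {}" using False by (simp add: T_def)
  have t0: "0 \<le> t0" unfolding t0_def using ne by (intro cInf_greatest) (auto simp: T_def)
  have t0_le: "t0 \<le> t" if "t \<in> T" for t unfolding t0_def using that bdd by (rule cInf_lower)
  have "t0 \<in> closure T" unfolding t0_def by (rule closure_contains_Inf[OF ne bdd])
  also have "closure T \<subseteq> {t \<in> {0..}. exp (- g t) \<le> \<beta>}"
  proof (rule closure_minimal)
    show "closed {t \<in> {0..}. exp (- g t) \<le> \<beta>}"
      using g(1) by (intro continuous_on_closed_Collect_le continuous_intros) auto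
  qed (auto simp: T_def)
  finally have e0: "exp (- g t0) \<le> \<beta>" by simp
  have bd: "exp (- g t) \<le> \<beta> * exp (- l * (t - t0))" if "t \<in> T" for t
  proof -
    have "exp (- g t) \<le> exp (- g t0 + - l * (t - t0))"
      using g(2)[OF t0 t0_le[OF that]] by simp
    also have "\<dots> = exp (- g t0) * exp (- l * (t - t0))" by (rule exp_add)
    also have "\<dots> \<le> \<beta> * exp (- l * (t - t0))" using e0 by (intro mult_right_mono) auto
    finally show ?thesis .
  qed
  define f where "f = (\<lambda>t. \<beta> * exp (- l * (t - t0)))"
  have "(\<integral>\<^sup>+t. ennreal (exp (- g t)) * indicator T t \<partial>lborel) \<le> (\<integral>\<^sup>+t. ennreal (f t) * indicator {t0..} t \<partial>lborel)"
    using bd t0_le by (intro nn_integral_mono) (auto simp: indicator_def f_def intro!: ennreal_leI)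
  also have "\<dots> = ennreal (0 - (- (\<beta> / l) * exp (- l * (t0 - t0))))"
  proof (rule nn_integral_FTC_atLeast[where F = "\<lambda>t. - (\<beta> / l) * exp (- l * (t - t0))"])
    show "f \<in> borel_measurable borel" unfolding f_def by measurable
    show "((\<lambda>t. - (\<beta> / l) * exp (- l * (t - t0))) has_real_derivative f t) (at t)" for t
      using l unfolding f_def by (auto intro!: derivative_eq_intros)
    show "0 \<le> f t" for t using \<beta> by (simp add: f_def)
    have "((\<lambda>t. - (\<beta> / l) * (exp (l * t0) * exp (- (l * t)))) \<longlongrightarrow> - (\<beta> / l) * (exp (l * t0) * 0)) at_top"
      by (intro tendsto_mult tendsto_const filterlim_compose[OF exp_at_bot]
        filterlim_compose[OF filterlim_uminus_at_bot_at_top] filterlim_tendsto_pos_mult_at_top[OF tendsto_const l]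
        filterlim_ident)
    moreover have "exp (l * t0) * exp (- (l * t)) = exp (- l * (t - t0))" for t
      by (simp add: algebra_simps flip: exp_add)
    ultimately show "((\<lambda>t. - (\<beta> / l) * exp (- l * (t - t0))) \<longlongrightarrow> 0) at_top" by simp
  qed
  finally show ?thesis by (simp add: T_def)
qed

section \<open>Level sets along the flow\<close>

context stable_pair
begin

lemma measurable_E [measurable]:
  assumes [measurable]: "f \<in> borel_measurable N'" "g \<in> borel_measurable N'"
  shows "(\<lambda>x. E (f x) *v g x) \<in> borel_measurable N'"
proof -
  have "(\<lambda>p. E (fst p) *v snd p) \<in> borel_measurable (borel :: (real \<times> (real ^ 'n)) measure)"
    by (intro borel_measurable_continuous_onI continuous_intros)
  then have "(\<lambda>p. E (fst p) *v snd p) \<in> borel_measurable (borel \<Otimes>\<^sub>M borel)"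
    by (simp only: borel_prod)
  from measurable_compose[OF _ this, of "\<lambda>x. (f x, g x)" N']
  show ?thesis by simp
qed

lemma measurable_rho2 [measurable]: "rho2 \<in> borel_measurable borel"
  by (intro borel_measurable_continuous_onI continuous_on_rho2 continuous_on_id)

lemma measurable_rho [measurable]: "rho \<in> borel_measurable borel"
  by (intro borel_measurable_continuous_onI continuous_on_rho continuous_on_id)

lemma measurable_Psi [measurable]:
  assumes [measurable]: "f \<in> borel_measurable N'" "g \<in> borel_measurable N'"
  shows "(\<lambda>x. Psi (f x) (g x)) \<in> borel_measurable N'"
proof -
  have "(\<lambda>p. Psi (fst p) (snd p)) \<in> borel_measurable (borel \<Otimes>\<^sub>M borel)"
    using borel_measurable_Psi by (simp only: borel_prod)
  from measurable_compose[OF _ this, of "\<lambda>x. (f x, g x)" N'] show ?thesis by simp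
qed

lemma gaussian_rho2_finite:
  assumes a: "a > 0"
  shows "(\<integral>\<^sup>+x. ennreal (exp (- a * rho2 x)) \<partial>lborel) < \<infinity>"
proof -
  have "(\<integral>\<^sup>+x. ennreal (exp (- a * rho2 x)) \<partial>lborel)
      \<le> (\<integral>\<^sup>+x. ennreal (exp (- (a * m_lo\<^sup>2) * (norm x)\<^sup>2)) \<partial>(lborel :: (real ^ 'n) measure))"
  proof (intro nn_integral_mono ennreal_leI)
    fix x
    have "(m_lo * norm x)\<^sup>2 \<le> (rho x)\<^sup>2"
      using m_lo_hi(1,3) by (intro power_mono) auto
    then have "a * (m_lo\<^sup>2 * (norm x)\<^sup>2) \<le> a * rho2 x"
      using a by (intro mult_left_mono) (auto simp: power_mult_distrib)
    then show "exp (- a * rho2 x) \<le> exp (- (a * m_lo\<^sup>2) * (norm x)\<^sup>2)" by (simp add: mult.assoc)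
  qed
  also have "\<dots> < \<infinity>" using a m_lo_hi(1) by (intro nn_integral_gaussian_finite) simp
  finally show ?thesis .
qed

definition shell :: "real \<Rightarrow> (real ^ 'n) set" where
  "shell r = {y. r - 1 \<le> rho y \<and> rho y \<le> r}"

lemma shell_sets [measurable]: "shell r \<in> sets borel"
  unfolding shell_def by measurable

text \<open>All points of the shell that are close to the orbit of \<open>u\<close> are close to one another: orbits
  are transversal to the level sets of \<open>rho\<close>. Hence \<open>Psi y u\<close>, as a function of \<open>y\<close> in a shell of
  bounded width, is dominated by a single Gaussian. Its centre is an almost closest point.\<close>

lemma Psi_shell_integral:
  "\<exists>C :: real. \<forall>r u. (\<integral>\<^sup>+y. ennreal (Psi y u) * indicator (shell r) y \<partial>lborel) \<le> ennreal C"
proof -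
  obtain K where K: "K > 0" "\<And>u s t. rho (E s *v u - E t *v u) \<le> K * \<bar>rho (E s *v u) - rho (E t *v u)\<bar>"
    using orbit_chord_bound by blast
  define a where "a = 2 + 2 * K"
  have a: "a > 0" using K by (simp add: a_def)
  define k where "k = kappa / (2 * a\<^sup>2)"
  have k: "k > 0" using kappa_pos a by (simp add: k_def)
  define I where "I = (\<integral>\<^sup>+x. ennreal (exp (- k * rho2 x)) \<partial>lborel)"
  have I: "I < \<infinity>" unfolding I_def by (rule gaussian_rho2_finite[OF k])
  have "(\<integral>\<^sup>+y. ennreal (Psi y u) * indicator (shell r) y \<partial>lborel) \<le> ennreal (exp kappa) * I" for r u
  proof (cases "shell r = {}")
    case False
    define X where "X = (\<lambda>(y, t). rho (y - E t *v u)) ` (shell r \<times> {1..})"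
    have X: "X \<noteq> {}" "bdd_below X" using False unfolding X_def by (auto intro!: bdd_belowI[of _ 0])
    obtain \<delta>0 where "\<delta>0 \<in> X" "\<delta>0 < Inf X + 1"
      using cInf_lessD[OF X(1), of "Inf X + 1"] by auto
    then obtain y0 t0 where y0: "y0 \<in> shell r" "t0 \<ge> 1" "rho (y0 - E t0 *v u) < Inf X + 1"
      by (auto simp: X_def)
    \<comment> \<open>The infimum need not be attained, which costs the summand one.\<close>
    have near: "rho (y0 - E t0 *v u) \<le> rho (y - E t *v u) + 1" if "y \<in> shell r" "t \<ge> 1" for y t
    proof -
      have "rho (y - E t *v u) \<in> X" unfolding X_def using that by force
      then have "Inf X \<le> rho (y - E t *v u)" using X(2) by (rule cInf_lower)
      then show ?thesis using y0(3) by simp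
    qed
    have bd: "Psi y u \<le> exp kappa * exp (- k * rho2 (y - y0))" if y: "y \<in> shell r" for y
      unfolding Psi_def
    proof (rule cSUP_least)
      fix t :: real assume "t \<in> {1..}"
      then have t: "t \<ge> 1" by simp
      define \<delta> where "\<delta> = rho (y - E t *v u)"
      have \<delta>: "\<delta> \<ge> 0" by (simp add: \<delta>_def)
      have n: "rho (y0 - E t0 *v u) \<le> \<delta> + 1" unfolding \<delta>_def by (rule near[OF y t])
      have "\<bar>rho y - rho y0\<bar> \<le> 1" using y y0(1) by (auto simp: shell_def)
      moreover have "\<bar>rho y - rho (E t *v u)\<bar> \<le> \<delta>" unfolding \<delta>_def by (rule rho_abs_diff)
      moreover have "\<bar>rho y0 - rho (E t0 *v u)\<bar> \<le> \<delta> + 1" using rho_abs_diff[of y0 "E t0 *v u"] n by linarith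
      ultimately have "\<bar>rho (E t *v u) - rho (E t0 *v u)\<bar> \<le> 2 * \<delta> + 2" by linarith
      then have "K * \<bar>rho (E t *v u) - rho (E t0 *v u)\<bar> \<le> K * (2 * \<delta> + 2)"
        using K(1) by (intro mult_left_mono) auto
      then have c: "rho (E t *v u - E t0 *v u) \<le> K * (2 * \<delta> + 2)" using K(2)[of t u t0] by linarith
      have "rho (y - y0) \<le> rho (y - E t *v u) + rho (E t *v u - y0)" by (rule rho_triangle_diff)
      also have "rho (E t *v u - y0) \<le> rho (E t *v u - E t0 *v u) + rho (E t0 *v u - y0)" by (rule rho_triangle_diff)
      also have "rho (E t0 *v u - y0) = rho (y0 - E t0 *v u)" by (rule rho_diff_commute)
      finally have "rho (y - y0) \<le> a * (\<delta> + 1)" using c n \<delta> by (simp add: \<delta>_def[symmetric] a_def algebra_simps)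
      then have "(rho (y - y0))\<^sup>2 \<le> (a * (\<delta> + 1))\<^sup>2" by (intro power_mono) auto
      also have "\<dots> \<le> a\<^sup>2 * (2 * \<delta>\<^sup>2 + 2)"
      proof -
        have "0 \<le> (\<delta> - 1)\<^sup>2" by simp
        then have "(\<delta> + 1)\<^sup>2 \<le> 2 * \<delta>\<^sup>2 + 2" by (simp add: power2_eq_square algebra_simps)
        then show ?thesis unfolding power_mult_distrib by (intro mult_left_mono) auto
      qed
      finally have "rho2 (y - y0) / (2 * a\<^sup>2) \<le> \<delta>\<^sup>2 + 1" using a by (simp add: field_simps)
      then have "kappa * (rho2 (y - y0) / (2 * a\<^sup>2)) \<le> kappa * (\<delta>\<^sup>2 + 1)"
        using kappa_pos by (intro mult_left_mono) auto
      then have "k * rho2 (y - y0) \<le> kappa * \<delta>\<^sup>2 + kappa" by (simp add: k_def algebra_simps)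
      moreover have "rho2 (E t *v u - y) = \<delta>\<^sup>2" unfolding \<delta>_def by (simp only: rho_diff_commute[of y] rho_power2)
      ultimately have "- kappa * rho2 (E t *v u - y) \<le> kappa + (- k * rho2 (y - y0))" by simp
      then show "bump t y u \<le> exp kappa * exp (- k * rho2 (y - y0))"
        unfolding bump_def exp_add[symmetric] by simp
    qed simp
    have "(\<integral>\<^sup>+y. ennreal (Psi y u) * indicator (shell r) y \<partial>lborel)
        \<le> (\<integral>\<^sup>+y. ennreal (exp kappa) * ennreal (exp (- k * rho2 (y - y0))) \<partial>lborel)"
    proof (rule nn_integral_mono)
      fix y
      show "ennreal (Psi y u) * indicator (shell r) y \<le> ennreal (exp kappa) * ennreal (exp (- k * rho2 (y - y0)))"
        using bd[of y] by (cases "y \<in> shell r") (auto simp flip: ennreal_mult intro: ennreal_leI)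
    qed
    also have "\<dots> = ennreal (exp kappa) * (\<integral>\<^sup>+y. ennreal (exp (- k * rho2 (y - y0))) \<partial>lborel)"
      by (rule nn_integral_cmult) simp
    also have "(\<integral>\<^sup>+y. ennreal (exp (- k * rho2 (y - y0))) \<partial>lborel) = I"
      unfolding I_def by (subst nn_integral_lborel_reflect_translate(2)[of _ y0]) simp_all
    finally show ?thesis .
  qed simp
  moreover have "ennreal (exp kappa) * I = ennreal (exp kappa * enn2real I)"
    using I by (simp add: ennreal_mult)
  ultimately show ?thesis by (intro exI[of _ "exp kappa * enn2real I"]) auto
qed

text \<open>The level falls from at most \<open>2 r\<close> to \<open>r\<close> within time \<open>ln 2 / k_lo\<close>, and afterwards it takes at least
  the time \<open>1 / (k_hi r)\<close> to fall by one.\<close>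

lemma flow_time_in_shell:
  fixes r :: real
  defines "\<Sigma> \<equiv> ln 2 / k_lo + 1 / k_hi"
  assumes r: "r \<ge> 1" and x: "r < rho x" "rho x \<le> 2 * r"
  shows "1 \<le> ennreal (k_hi * r) * (\<integral>\<^sup>+\<sigma>. indicator {0..\<Sigma>} \<sigma> * indicator (shell r) (E \<sigma> *v x) \<partial>lborel)"
proof -
  define \<tau> where "\<tau> = ln 2 / k_lo"
  have \<tau>: "\<tau> \<ge> 0" using k_lo(1) by (simp add: \<tau>_def)
  have "rho (E \<tau> *v x) \<le> exp (- k_lo * \<tau>) * rho x" by (rule rho_E_le[OF \<tau>])
  also have "exp (- k_lo * \<tau>) = 1 / 2" using k_lo(1) by (simp add: \<tau>_def exp_minus)
  finally have "rho (E \<tau> *v x) \<le> r" using x(2) by simp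
  moreover have "r \<le> rho (E 0 *v x)" using x(1) by simp
  moreover have "continuous_on {0..\<tau>} (\<lambda>t. rho (E t *v x))" by (intro continuous_intros)
  ultimately obtain s where s: "0 \<le> s" "s \<le> \<tau>" "rho (E s *v x) = r"
    using IVT2'[of "\<lambda>t. rho (E t *v x)" \<tau> r 0] \<tau> by auto
  define h where "h = 1 / (k_hi * r)"
  have h: "0 < h" "h \<le> 1 / k_hi" using k_hi(1) r by (auto simp: h_def field_simps)
  have mem: "E \<sigma> *v x \<in> shell r" if \<sigma>: "\<sigma> \<in> {s..s + h}" for \<sigma>
  proof -
    have \<sigma>': "\<sigma> - s \<ge> 0" "\<sigma> - s \<le> h" using \<sigma> by auto
    have eq: "E \<sigma> *v x = E (\<sigma> - s) *v (E s *v x)" by (simp flip: E_add_vec)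
    have up: "rho (E \<sigma> *v x) \<le> r" unfolding eq using rho_E_contract[OF \<sigma>'(1)] s(3) by metis
    have "k_hi * (\<sigma> - s) * r \<le> 1"
    proof -
      have "k_hi * (\<sigma> - s) * r \<le> k_hi * h * r"
        using \<sigma>' k_hi(1) r by (intro mult_right_mono mult_left_mono) auto
      also have "\<dots> = 1" using k_hi(1) r by (simp add: h_def)
      finally show ?thesis .
    qed
    then have "r - 1 \<le> (1 + - k_hi * (\<sigma> - s)) * r" by (simp add: algebra_simps)
    also have "\<dots> \<le> exp (- k_hi * (\<sigma> - s)) * r" using r by (intro mult_right_mono exp_ge_add_one_self) auto
    also have "\<dots> \<le> rho (E \<sigma> *v x)" unfolding eq using rho_E_ge[OF \<sigma>'(1), of "E s *v x"] s(3) by simp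
    finally show ?thesis using up by (simp add: shell_def)
  qed
  have "ennreal h = (\<integral>\<^sup>+\<sigma>. indicator {s..s + h} \<sigma> \<partial>lborel)" using h by simp
  also have "\<dots> \<le> (\<integral>\<^sup>+\<sigma>. indicator {0..\<Sigma>} \<sigma> * indicator (shell r) (E \<sigma> *v x) \<partial>lborel)"
  proof (rule nn_integral_mono)
    fix \<sigma>
    show "indicator {s..s + h} \<sigma> \<le> (indicator {0..\<Sigma>} \<sigma> * indicator (shell r) (E \<sigma> *v x) :: ennreal)"
    proof (cases "\<sigma> \<in> {s..s + h}")
      case True
      then have "\<sigma> \<in> {0..\<Sigma>}" using s h by (auto simp: \<Sigma>_def \<tau>_def)
      then show ?thesis using mem[OF True] by (simp add: indicator_def)
    qed simp
  qed
  finally have "ennreal (k_hi * r) * ennreal h \<le> ennreal (k_hi * r) * (\<integral>\<^sup>+\<sigma>. indicator {0..\<Sigma>} \<sigma> * indicator (shell r) (E \<sigma> *v x) \<partial>lborel)"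
    by (rule mult_left_mono) simp
  moreover have "ennreal (k_hi * r) * ennreal h = 1"
    using k_hi(1) r by (simp add: h_def flip: ennreal_mult ennreal_1)
  ultimately show ?thesis by simp
qed

text \<open>Outside the ball of radius \<open>r / 2\<close> the dissipation is at least of order \<open>r\<^sup>2\<close>, and going backwards along
  an orbit leads away from the origin.\<close>

lemma rho2_backward_growth:
  assumes y: "r / 2 \<le> rho y" and r: "r > 0" and st: "0 \<le> s" "s \<le> t"
  shows "(k_lo * r\<^sup>2 / 4) * (t - s) \<le> rho2 (E (- t) *v y) / 2 - rho2 (E (- s) *v y) / 2"
proof -
  define l where "l = k_lo * r\<^sup>2 / 4"
  define f where "f = (\<lambda>t. rho2 (E (- t) *v y) / 2 - l * t)"
  have "f s \<le> f t"
  proof (rule DERIV_nonneg_imp_nondecreasing[OF st(2)])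
    fix x assume x: "s \<le> x" "x \<le> t"
    have "((\<lambda>t. rho2 (E (- t) *v y)) has_real_derivative - (- dissipation (E (- x) *v y))) (at x)"
      using DERIV_mirror[of "\<lambda>t. rho2 (E t *v y)" "- dissipation (E (- x) *v y)" x] rho2_E_derivative[of y "- x"] by simp
    then have "(f has_real_derivative dissipation (E (- x) *v y) / 2 - l) (at x)"
      unfolding f_def by (auto intro!: derivative_eq_intros)
    moreover have "0 \<le> dissipation (E (- x) *v y) / 2 - l"
    proof -
      have "rho y = rho (E x *v (E (- x) *v y))" by simp
      also have "\<dots> \<le> rho (E (- x) *v y)" using st x by (intro rho_E_contract) simp
      finally have "r / 2 \<le> rho (E (- x) *v y)" using y by simp
      then have "(r / 2)\<^sup>2 \<le> (rho (E (- x) *v y))\<^sup>2" using r by (intro power_mono) auto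
      then have "k_lo * (r\<^sup>2 / 4) \<le> k_lo * rho2 (E (- x) *v y)"
        using k_lo(1) by (intro mult_left_mono) (auto simp: power_divide)
      also have "\<dots> \<le> dissipation (E (- x) *v y) / 2" using k_lo(2)[of "E (- x) *v y"] by simp
      finally show ?thesis by (simp add: l_def)
    qed
    ultimately show "\<exists>z. (f has_real_derivative z) (at x) \<and> 0 \<le> z" by blast
  qed
  then have "rho2 (E (- s) *v y) / 2 - l * s \<le> rho2 (E (- t) *v y) / 2 - l * t" by (simp only: f_def)
  then show ?thesis unfolding l_def[symmetric] by (simp add: right_diff_distrib)
qed

text \<open>Points of the level set are transported along the flow into the shell. Averaging over the
  time spent there costs a factor \<open>r\<close>; along each orbit the Gaussian weight decays at rate
  \<open>r\<^sup>2\<close>, which gains \<open>1 / r\<^sup>2\<close>.\<close>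

lemma level_set_bound:
  "\<exists>C>0. \<forall>r\<ge>2. \<forall>\<alpha>>0. \<forall>\<Phi> \<in> borel_measurable borel. (\<forall>x. 0 \<le> \<Phi> x) \<longrightarrow> (\<forall>x s. 0 \<le> s \<longrightarrow> \<Phi> x \<le> \<Phi> (E s *v x)) \<longrightarrow>
    (\<integral>\<^sup>+x. ennreal (exp (- (rho2 x / 2))) * indicator {x. r < rho x \<and> rho x \<le> 2 * r \<and> \<alpha> < exp (rho2 x / 2) * \<Phi> x} x \<partial>lborel)
      \<le> ennreal (C / (\<alpha> * r)) * (\<integral>\<^sup>+y. ennreal (\<Phi> y) * indicator (shell r) y \<partial>lborel)"
proof -
  define \<Sigma> where "\<Sigma> = ln 2 / k_lo + 1 / k_hi"
  have \<Sigma>: "\<Sigma> > 0" using k_lo(1) k_hi(1) by (simp add: \<Sigma>_def add_pos_pos)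
  define a where "a = exp (k_hi * \<Sigma>) * m_hi / m_lo"
  have a: "a > 0" using m_lo_hi(1,2) by (simp add: a_def)
  obtain J where J: "J > 0" "\<And>(A :: real ^ 'n ^ 'n) A' h. A ** A' = mat 1 \<Longrightarrow> (\<And>y. norm (A *v y) \<le> a * norm y) \<Longrightarrow>
    h \<in> borel_measurable borel \<Longrightarrow> (\<integral>\<^sup>+x. h x \<partial>lborel) \<le> ennreal J * (\<integral>\<^sup>+y. h (A *v y) \<partial>lborel)"
    using nn_integral_linear_bound[OF a] by blast
  have E_bd: "norm (E (- \<sigma>) *v y) \<le> a * norm y" if \<sigma>: "0 \<le> \<sigma>" "\<sigma> \<le> \<Sigma>" for \<sigma> y
  proof -
    have "exp (- k_hi * \<sigma>) * rho (E (- \<sigma>) *v y) \<le> rho y" using rho_E_ge[OF \<sigma>(1), of "E (- \<sigma>) *v y"] by simp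
    then have "rho (E (- \<sigma>) *v y) \<le> exp (k_hi * \<sigma>) * rho y" by (simp add: exp_minus field_simps)
    also have "\<dots> \<le> exp (k_hi * \<Sigma>) * (m_hi * norm y)"
      using \<sigma>(2) k_hi(1) m_lo_hi(4) by (intro mult_mono) auto
    finally have "m_lo * norm (E (- \<sigma>) *v y) \<le> exp (k_hi * \<Sigma>) * (m_hi * norm y)"
      using m_lo_hi(3) order_trans by blast
    then show ?thesis using m_lo_hi(1) by (simp add: a_def field_simps)
  qed
  define C where "C = k_hi * J * 4 / k_lo"
  have C: "C > 0" using k_hi(1) k_lo(1) J(1) by (simp add: C_def)
  have main: "(\<integral>\<^sup>+x. ennreal (exp (- (rho2 x / 2))) * indicator {x. r < rho x \<and> rho x \<le> 2 * r \<and> \<alpha> < exp (rho2 x / 2) * \<Phi> x} x \<partial>lborel)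
      \<le> ennreal (C / (\<alpha> * r)) * (\<integral>\<^sup>+y. ennreal (\<Phi> y) * indicator (shell r) y \<partial>lborel)"
    if r: "r \<ge> 2" and \<alpha>: "\<alpha> > 0" and \<Phi>[measurable]: "\<Phi> \<in> borel_measurable borel" and \<Phi>0: "\<And>x. 0 \<le> \<Phi> x"
      and mono: "\<And>x s. 0 \<le> s \<Longrightarrow> \<Phi> x \<le> \<Phi> (E s *v x)" for r \<alpha> and \<Phi> :: "real ^ 'n \<Rightarrow> real"
  proof -
    define A where "A = {x. r < rho x \<and> rho x \<le> 2 * r \<and> \<alpha> < exp (rho2 x / 2) * \<Phi> x}"
    have A[measurable]: "A \<in> sets borel" unfolding A_def by measurable
    define w where "w = (\<lambda>x. ennreal (exp (- (rho2 x / 2))) * indicator A x)"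
    have w[measurable]: "w \<in> borel_measurable borel" unfolding w_def by measurable
    define i where "i = (\<lambda>\<sigma> :: real. indicator {0..\<Sigma>} \<sigma> :: ennreal)"
    have i[measurable]: "i \<in> borel_measurable borel" unfolding i_def by measurable
    define S where "S = (\<lambda>y. indicator (shell r) y :: ennreal)"
    have S[measurable]: "S \<in> borel_measurable borel" unfolding S_def by measurable
    define l where "l = k_lo * r\<^sup>2 / 4"
    have l: "l > 0" using k_lo(1) r by (simp add: l_def)
    have "(\<integral>\<^sup>+x. w x \<partial>lborel) \<le> (\<integral>\<^sup>+x. w x * (ennreal (k_hi * r) * (\<integral>\<^sup>+\<sigma>. i \<sigma> * S (E \<sigma> *v x) \<partial>lborel)) \<partial>lborel)"
    proof (rule nn_integral_mono)
      fix x
      show "w x \<le> w x * (ennreal (k_hi * r) * (\<integral>\<^sup>+\<sigma>. i \<sigma> * S (E \<sigma> *v x) \<partial>lborel))"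
      proof (cases "x \<in> A")
        case True
        then have "1 \<le> ennreal (k_hi * r) * (\<integral>\<^sup>+\<sigma>. i \<sigma> * S (E \<sigma> *v x) \<partial>lborel)"
          unfolding i_def S_def \<Sigma>_def using r by (intro flow_time_in_shell) (auto simp: A_def)
        then have "w x * 1 \<le> w x * (ennreal (k_hi * r) * (\<integral>\<^sup>+\<sigma>. i \<sigma> * S (E \<sigma> *v x) \<partial>lborel))"
          by (rule mult_left_mono) simp
        then show ?thesis by simp
      qed (simp add: w_def)
    qed
    also have "\<dots> = ennreal (k_hi * r) * (\<integral>\<^sup>+x. (\<integral>\<^sup>+\<sigma>. i \<sigma> * (w x * S (E \<sigma> *v x)) \<partial>lborel) \<partial>lborel)"
    proof -
      have "w x * (ennreal (k_hi * r) * (\<integral>\<^sup>+\<sigma>. i \<sigma> * S (E \<sigma> *v x) \<partial>lborel))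
          = ennreal (k_hi * r) * (\<integral>\<^sup>+\<sigma>. i \<sigma> * (w x * S (E \<sigma> *v x)) \<partial>lborel)" for x
      proof -
        have "w x * (\<integral>\<^sup>+\<sigma>. i \<sigma> * S (E \<sigma> *v x) \<partial>lborel) = (\<integral>\<^sup>+\<sigma>. w x * (i \<sigma> * S (E \<sigma> *v x)) \<partial>lborel)"
          by (rule nn_integral_cmult[symmetric]) simp
        also have "\<dots> = (\<integral>\<^sup>+\<sigma>. i \<sigma> * (w x * S (E \<sigma> *v x)) \<partial>lborel)" by (simp only: mult_ac)
        finally show ?thesis by (simp only: mult.left_commute[of "w x"])
      qed
      then show ?thesis by (simp add: nn_integral_cmult)
    qed
    also have "(\<integral>\<^sup>+x. (\<integral>\<^sup>+\<sigma>. i \<sigma> * (w x * S (E \<sigma> *v x)) \<partial>lborel) \<partial>lborel)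
        = (\<integral>\<^sup>+\<sigma>. (\<integral>\<^sup>+x. i \<sigma> * (w x * S (E \<sigma> *v x)) \<partial>lborel) \<partial>lborel)"
      by (rule lborel_pair.Fubini') simp
    also have "\<dots> \<le> (\<integral>\<^sup>+\<sigma>. ennreal J * (\<integral>\<^sup>+y. i \<sigma> * (w (E (- \<sigma>) *v y) * S y) \<partial>lborel) \<partial>lborel)"
    proof (rule nn_integral_mono)
      fix \<sigma>
      show "(\<integral>\<^sup>+x. i \<sigma> * (w x * S (E \<sigma> *v x)) \<partial>lborel) \<le> ennreal J * (\<integral>\<^sup>+y. i \<sigma> * (w (E (- \<sigma>) *v y) * S y) \<partial>lborel)"
      proof (cases "\<sigma> \<in> {0..\<Sigma>}")
        case True
        have "(\<integral>\<^sup>+x. i \<sigma> * (w x * S (E \<sigma> *v x)) \<partial>lborel)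
            \<le> ennreal J * (\<integral>\<^sup>+y. i \<sigma> * (w (E (- \<sigma>) *v y) * S (E \<sigma> *v (E (- \<sigma>) *v y))) \<partial>lborel)"
          by (rule J(2)[of "E (- \<sigma>)" "E \<sigma>"]) (use True E_bd in auto)
        then show ?thesis by simp
      qed (simp add: i_def)
    qed
    also have "\<dots> = ennreal J * (\<integral>\<^sup>+\<sigma>. (\<integral>\<^sup>+y. i \<sigma> * (w (E (- \<sigma>) *v y) * S y) \<partial>lborel) \<partial>lborel)"
      by (rule nn_integral_cmult) simp
    also have "(\<integral>\<^sup>+\<sigma>. (\<integral>\<^sup>+y. i \<sigma> * (w (E (- \<sigma>) *v y) * S y) \<partial>lborel) \<partial>lborel)
        = (\<integral>\<^sup>+y. (\<integral>\<^sup>+\<sigma>. i \<sigma> * (w (E (- \<sigma>) *v y) * S y) \<partial>lborel) \<partial>lborel)"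
      by (rule lborel_pair.Fubini') simp
    also have "\<dots> \<le> (\<integral>\<^sup>+y. ennreal (1 / (\<alpha> * l)) * (ennreal (\<Phi> y) * S y) \<partial>lborel)"
    proof (rule nn_integral_mono)
      fix y
      show "(\<integral>\<^sup>+\<sigma>. i \<sigma> * (w (E (- \<sigma>) *v y) * S y) \<partial>lborel) \<le> ennreal (1 / (\<alpha> * l)) * (ennreal (\<Phi> y) * S y)"
      proof (cases "y \<in> shell r")
        case True
        then have y: "r / 2 \<le> rho y" using r by (simp add: shell_def)
        define g where "g = (\<lambda>\<sigma>. rho2 (E (- \<sigma>) *v y) / 2)"
        have "(\<integral>\<^sup>+\<sigma>. i \<sigma> * (w (E (- \<sigma>) *v y) * S y) \<partial>lborel)
            \<le> (\<integral>\<^sup>+\<sigma>. ennreal (exp (- g \<sigma>)) * indicator {t. 0 \<le> t \<and> exp (- g t) < \<Phi> y / \<alpha>} \<sigma> \<partial>lborel)"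
        proof (rule nn_integral_mono)
          fix \<sigma>
          show "i \<sigma> * (w (E (- \<sigma>) *v y) * S y) \<le> ennreal (exp (- g \<sigma>)) * indicator {t. 0 \<le> t \<and> exp (- g t) < \<Phi> y / \<alpha>} \<sigma>"
          proof (cases "\<sigma> \<in> {0..\<Sigma>} \<and> E (- \<sigma>) *v y \<in> A")
            case T: True
            have "\<alpha> < exp (g \<sigma>) * \<Phi> (E (- \<sigma>) *v y)" using T by (simp add: A_def g_def)
            also have "\<dots> \<le> exp (g \<sigma>) * \<Phi> y"
              using mono[of \<sigma> "E (- \<sigma>) *v y"] T by (intro mult_left_mono) auto
            finally have "exp (- g \<sigma>) < \<Phi> y / \<alpha>" using \<alpha> by (simp add: exp_minus field_simps)
            then show ?thesis using T True by (simp add: i_def w_def S_def g_def)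
          qed (auto simp: i_def w_def)
        qed
        also have "\<dots> \<le> ennreal (\<Phi> y / \<alpha> / l)"
        proof (rule nn_integral_exp_growth)
          show "continuous_on {0..} g" unfolding g_def by (intro continuous_intros) auto
          show "l * (t - s) \<le> g t - g s" if "0 \<le> s" "s \<le> t" for s t
            unfolding g_def l_def using rho2_backward_growth[OF y _ that] r by simp
        qed (use l \<alpha> \<Phi>0 in auto)
        also have "\<dots> = ennreal (1 / (\<alpha> * l)) * (ennreal (\<Phi> y) * S y)"
          using True \<alpha> l \<Phi>0 by (simp add: S_def field_simps flip: ennreal_mult)
        finally show ?thesis .
      qed (simp add: S_def)
    qed
    also have "\<dots> = ennreal (1 / (\<alpha> * l)) * (\<integral>\<^sup>+y. ennreal (\<Phi> y) * S y \<partial>lborel)"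
      by (rule nn_integral_cmult) simp
    finally have fin: "(\<integral>\<^sup>+x. w x \<partial>lborel) \<le> ennreal (k_hi * r) * (ennreal J * (ennreal (1 / (\<alpha> * l)) * (\<integral>\<^sup>+y. ennreal (\<Phi> y) * S y \<partial>lborel)))"
      by (simp add: mult_left_mono)
    have "ennreal (k_hi * r) * (ennreal J * ennreal (1 / (\<alpha> * l))) = ennreal (k_hi * r * (J * (1 / (\<alpha> * l))))"
    proof -
      have nn: "0 \<le> k_hi * r" "0 \<le> J" "0 \<le> 1 / (\<alpha> * l)" using k_hi(1) r J(1) \<alpha> l by auto
      then show ?thesis
        by (simp only: ennreal_mult[OF nn(2,3), symmetric] ennreal_mult[OF nn(1) mult_nonneg_nonneg[OF nn(2,3)], symmetric])
    qed
    also have "k_hi * r * (J * (1 / (\<alpha> * l))) = C / (\<alpha> * r)"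
      using r k_lo(1) \<alpha> by (simp add: C_def l_def power2_eq_square field_simps)
    finally show ?thesis using fin by (simp add: w_def A_def S_def flip: mult.assoc)
  qed
  show ?thesis
    by (rule exI[of _ C], intro conjI allI ballI impI C main) auto
qed

end

section \<open>The variation operator\<close>

text \<open>Each term is at most \<open>a i * s powr (\<rho> - 1)\<close>, where \<open>s\<close> is the sum of the \<open>a i\<close>.\<close>

lemma powr_sum_le_sum:
  fixes a :: "'b \<Rightarrow> real"
  assumes "finite I" and a: "\<And>i. i \<in> I \<Longrightarrow> 0 \<le> a i" and \<rho>: "\<rho> \<ge> 1"
  shows "(\<Sum>i\<in>I. a i powr \<rho>) powr (1 / \<rho>) \<le> (\<Sum>i\<in>I. a i)"
proof (cases "(\<Sum>i\<in>I. a i) = 0")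
  case True
  then have "\<And>i. i \<in> I \<Longrightarrow> a i = 0" using assms by (simp add: sum_nonneg_eq_0_iff)
  then show ?thesis using \<rho> by (simp add: True)
next
  case False
  define s where "s = (\<Sum>i\<in>I. a i)"
  have s: "s > 0" using False a by (simp add: s_def less_le sum_nonneg)
  have "(\<Sum>i\<in>I. a i powr \<rho>) \<le> (\<Sum>i\<in>I. a i * s powr (\<rho> - 1))"
  proof (rule sum_mono)
    fix i assume i: "i \<in> I"
    have "a i \<le> s" unfolding s_def using assms(1) a i by (intro member_le_sum) auto
    then have "a i powr (\<rho> - 1) \<le> s powr (\<rho> - 1)" using a[OF i] \<rho> by (intro powr_mono2) auto
    then have "a i * a i powr (\<rho> - 1) \<le> a i * s powr (\<rho> - 1)" using a[OF i] by (rule mult_left_mono)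
    moreover have "a i powr \<rho> = a i * a i powr (\<rho> - 1)"
      using a[OF i] by (cases "a i = 0") (auto simp: powr_diff)
    ultimately show "a i powr \<rho> \<le> a i * s powr (\<rho> - 1)" by simp
  qed
  also have "\<dots> = s * s powr (\<rho> - 1)" by (simp only: s_def sum_distrib_right)
  also have "\<dots> = s powr \<rho>" using s by (simp add: powr_diff)
  finally have "(\<Sum>i\<in>I. a i powr \<rho>) powr (1 / \<rho>) \<le> (s powr \<rho>) powr (1 / \<rho>)"
    using \<rho> by (intro powr_mono2) (auto intro: sum_nonneg)
  also have "\<dots> = s" using s \<rho> by (simp add: powr_powr)
  finally show ?thesis by (simp add: s_def)
qed

text \<open>For a continuous function the supremum over all partitions equals the supremum over the
  countably many rational ones. The partition points are approximated from the right, so that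
  the left end point of the half-line causes no trouble.\<close>

lemma borel_measurable_rho_variation:
  fixes \<phi> :: "'a \<Rightarrow> real \<Rightarrow> real"
  assumes meas: "\<And>t. t \<ge> a \<Longrightarrow> (\<lambda>x. \<phi> x t) \<in> borel_measurable M'"
    and cont: "\<And>x. continuous_on {a..} (\<phi> x)" and \<rho>: "\<rho> \<ge> 1"
  shows "(\<lambda>x. rho_variation \<rho> {a..} (\<phi> x)) \<in> borel_measurable M'"
proof (rule borel_measurableI_greater)
  fix b :: ennreal
  define val where "val = (\<lambda>N (\<tau> :: nat \<Rightarrow> real) x. (\<Sum>i=1..N. \<bar>\<phi> x (\<tau> i) - \<phi> x (\<tau> (i - 1))\<bar> powr \<rho>) powr (1 / \<rho>))"
  define part where "part = (\<lambda>N (\<tau> :: nat \<Rightarrow> real). strict_mono_on {..N} \<tau> \<and> \<tau> ` {..N} \<subseteq> {a..})"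
  define q where "q = (\<lambda>(l :: rat list) i. real_of_rat (l ! i))"
  have V: "rho_variation \<rho> {a..} (\<phi> x) = (SUP (N, \<tau>) \<in> {(N, \<tau>). part N \<tau>}. ennreal (val N \<tau> x))" for x
    unfolding rho_variation_def val_def part_def ..
  have rational: "\<exists>l. part N (q l) \<and> b < ennreal (val N (q l) x)"
    if part: "part N \<tau>" and less: "b < ennreal (val N \<tau> x)" for N \<tau> x
  proof -
    \<comment> \<open>An upper limit for the rational points that keeps them in increasing order.\<close>
    define up where "up = (\<lambda>k i. min (\<tau> i + 1 / real (Suc k)) (if i < N then \<tau> (Suc i) else \<tau> i + 1))"
    have \<tau>: "\<tau> i < up k i" if "i \<le> N" for k i
      using part that by (auto simp: up_def part_def strict_mono_on_def)
    have "\<exists>r. \<tau> i < real_of_rat r \<and> real_of_rat r < up k i" if "i \<le> N" for k i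
      by (rule of_rat_dense[OF \<tau>[OF that]])
    note ex = this
    define r where "r = (\<lambda>k i. SOME r. \<tau> i < real_of_rat r \<and> real_of_rat r < up k i)"
    have r: "\<tau> i < real_of_rat (r k i)" "real_of_rat (r k i) < up k i" if "i \<le> N" for k i
      using someI_ex[OF ex[OF that, of k]] unfolding r_def by auto
    define l where "l = (\<lambda>k. map (r k) [0..<Suc N])"
    have ql: "q (l k) i = real_of_rat (r k i)" if "i \<le> N" for k i
      using that by (simp add: q_def l_def nth_append del: upt_Suc)
    have ge: "q (l k) i \<ge> a" if "i \<le> N" for k i
      using part that r(1)[OF that, of k] by (force simp: ql[OF that] part_def)
    have "part N (q (l k))" for k
      unfolding part_def
    proof
      have step: "q (l k) i < q (l k) j" if "i < j" "j \<le> N" for i j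
      proof -
        have "q (l k) i < \<tau> (Suc i)" using r(2)[of i k] that by (simp add: ql up_def split: if_splits)
        also have "\<tau> (Suc i) \<le> \<tau> j" using part that by (cases "Suc i = j") (auto simp: part_def strict_mono_on_def intro!: less_imp_le)
        also have "\<tau> j < q (l k) j" using r(1)[of j k] that by (simp add: ql)
        finally show ?thesis .
      qed
      then show "strict_mono_on {..N} (q (l k))" by (auto simp: strict_mono_on_def)
      show "q (l k) ` {..N} \<subseteq> {a..}" using ge by auto
    qed
    moreover have lim: "(\<lambda>k. q (l k) i) \<longlonglongrightarrow> \<tau> i" if i: "i \<le> N" for i
    proof (rule tendsto_sandwich[of "\<lambda>_. \<tau> i" _ _ "\<lambda>k. \<tau> i + 1 / real (Suc k)"])
      show "(\<lambda>k. \<tau> i + 1 / real (Suc k)) \<longlonglongrightarrow> \<tau> i"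
        using tendsto_add[OF tendsto_const[of "\<tau> i"] LIMSEQ_Suc[OF lim_1_over_n]] by simp
      show "\<forall>\<^sub>F k in sequentially. \<tau> i \<le> q (l k) i"
        using r(1)[OF i] by (auto simp: ql[OF i] intro!: always_eventually less_imp_le)
      show "\<forall>\<^sub>F k in sequentially. q (l k) i \<le> \<tau> i + 1 / real (Suc k)"
      proof (rule always_eventually, rule allI)
        fix k show "q (l k) i \<le> \<tau> i + 1 / real (Suc k)"
          using r(2)[OF i, of k] by (simp add: ql[OF i] up_def)
      qed
    qed simp
    have lim\<phi>: "(\<lambda>k. \<phi> x (q (l k) i)) \<longlonglongrightarrow> \<phi> x (\<tau> i)" if i: "i \<le> N" for i
      using part i ge[OF i] by (intro continuous_on_tendsto_compose[OF cont lim[OF i]]) (auto simp: part_def)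
    have "(\<lambda>k. val N (q (l k)) x) \<longlonglongrightarrow> val N \<tau> x"
      unfolding val_def using \<rho>
      by (intro tendsto_powr' tendsto_sum tendsto_rabs tendsto_diff lim\<phi> tendsto_const)
        (auto intro!: always_eventually sum_nonneg)
    then have "(\<lambda>k. ennreal (val N (q (l k)) x)) \<longlonglongrightarrow> ennreal (val N \<tau> x)" by (rule tendsto_ennrealI)
    then have "\<forall>\<^sub>F k in sequentially. b < ennreal (val N (q (l k)) x)" using less by (rule order_tendstoD)
    then obtain k where "b < ennreal (val N (q (l k)) x)" by (auto simp: eventually_sequentially)
    ultimately show ?thesis by blast
  qed
  have "{x \<in> space M'. b < rho_variation \<rho> {a..} (\<phi> x)}
      = (\<Union>(N, l) \<in> {(N, l). part N (q l)}. {x \<in> space M'. b < ennreal (val N (q l) x)})"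
    unfolding V less_SUP_iff using rational by (fastforce simp: case_prod_beta)
  also have "\<dots> \<in> sets M'"
  proof (rule sets.countable_UN')
    show "countable {(N :: nat, l :: rat list). part N (q l)}" by (rule countableI_type)
    have "{x \<in> space M'. b < ennreal (val N (q l) x)} \<in> sets M'" if "part N (q l)" for N l
    proof -
      have [measurable]: "(\<lambda>x. \<phi> x (q l i)) \<in> borel_measurable M'" if "i \<le> N" for i
        using \<open>part N (q l)\<close> that by (intro meas) (auto simp: part_def)
      have "(\<lambda>x. \<Sum>i=1..N. \<bar>\<phi> x (q l i) - \<phi> x (q l (i - 1))\<bar> powr \<rho>) \<in> borel_measurable M'"
        by (intro borel_measurable_sum) (measurable; auto)
      then have [measurable]: "val N (q l) \<in> borel_measurable M'" unfolding val_def by measurable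
      show ?thesis by measurable
    qed
    then show "(\<lambda>(N, l). {x \<in> space M'. b < ennreal (val N (q l) x)}) ` {(N, l). part N (q l)} \<subseteq> sets M'"
      by auto
  qed
  finally show "{x \<in> space M'. b < rho_variation \<rho> {a..} (\<phi> x)} \<in> sets M'" .
qed

context stable_pair
begin

abbreviation \<gamma> :: "(real ^ 'n) measure" where "\<gamma> \<equiv> OU_measure Q B"

definition dens_const :: real where
  "dens_const = (2 * pi) powr (- (real CARD('n) / 2)) * det cov powr (- (1 / 2))"

lemma dens_const_nonneg: "0 \<le> dens_const" by (simp add: dens_const_def)

lemma OU_measure_eq: "\<gamma> = density lborel (\<lambda>x. ennreal dens_const * ennreal (exp (- (rho2 x / 2))))"
  unfolding OU_measure_def dens_const_def cov_def rho2_def P_def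
  by (simp add: ennreal_mult)

lemma sets_OU_measure [measurable_cong, simp]: "sets \<gamma> = sets borel"
  by (simp add: OU_measure_def)

lemma space_OU_measure [simp]: "space \<gamma> = UNIV"
  by (simp add: OU_measure_def)

lemma emeasure_OU_measure:
  assumes [measurable]: "A \<in> sets borel"
  shows "emeasure \<gamma> A = ennreal dens_const * (\<integral>\<^sup>+x. ennreal (exp (- (rho2 x / 2))) * indicator A x \<partial>lborel)"
  unfolding OU_measure_eq by (simp add: emeasure_density mult.assoc nn_integral_cmult)

lemma finite_OU_measure: "finite_measure \<gamma>"
proof
  have "emeasure \<gamma> UNIV = ennreal dens_const * (\<integral>\<^sup>+x. ennreal (exp (- (1/2) * rho2 x)) \<partial>lborel)"
    by (subst emeasure_OU_measure) simp_all
  also have "\<dots> < \<infinity>" using gaussian_rho2_finite[of "1/2"] by (simp add: ennreal_mult_less_top)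
  finally show "emeasure \<gamma> (space \<gamma>) \<noteq> \<infinity>" by simp
qed

interpretation G: finite_measure \<gamma> by (rule finite_OU_measure)

lemma OU_kernel_bound: "\<exists>D>0. \<forall>t\<ge>1. \<forall>x u. \<bar>OU_kernel Q B t x u\<bar> \<le> D * exp (rho2 x / 2)"
proof -
  obtain D where D: "D > 0" "\<And>t. t \<ge> 1 \<Longrightarrow> 0 \<le> factor t" "\<And>t. t \<ge> 1 \<Longrightarrow> factor t \<le> D"
    using factor_bounds by blast
  have "\<bar>OU_kernel Q B t x u\<bar> \<le> D * exp (rho2 x / 2)" if t: "t \<ge> 1" for t x u
  proof -
    have "exp (- (1/2) * phase t x u) \<le> 1"
      using exp_phase_le_bump[of t x u] bump_bounds(2)[of t x u] t by linarith
    moreover have "factor t * exp (rho2 x / 2) \<le> D * exp (rho2 x / 2)"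
      using D(3)[OF t] by (intro mult_right_mono) auto
    ultimately have "factor t * exp (rho2 x / 2) * exp (- (1/2) * phase t x u) \<le> D * exp (rho2 x / 2) * 1"
      using D(1) D(2)[OF t] by (intro mult_mono) auto
    moreover have "0 \<le> factor t * exp (rho2 x / 2) * exp (- (1/2) * phase t x u)"
      using D(2)[OF t] by simp
    ultimately show ?thesis using t by (simp add: OU_kernel_eq)
  qed
  with D(1) show ?thesis by blast
qed

lemma measurable_OU_kernel:
  assumes t: "t \<ge> 1" and [measurable]: "f \<in> borel_measurable M'" "g \<in> borel_measurable M'"
  shows "(\<lambda>x. OU_kernel Q B t (f x) (g x)) \<in> borel_measurable M'"
proof -
  have "(\<lambda>p. phase t (fst p) (snd p)) \<in> borel_measurable borel"
    unfolding phase_def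
    by (intro borel_measurable_continuous_onI continuous_intros mv.continuous_on continuous_on_const)
  then have "(\<lambda>p. phase t (fst p) (snd p)) \<in> borel_measurable (borel \<Otimes>\<^sub>M borel)"
    by (simp only: borel_prod)
  from measurable_compose[OF _ this, of "\<lambda>x. (f x, g x)" M']
  have [measurable]: "(\<lambda>x. phase t (f x) (g x)) \<in> borel_measurable M'" by simp
  have "OU_kernel Q B t x u = factor t * exp (rho2 x / 2) * exp (- (1/2) * phase t x u)" for x u
    using t by (intro OU_kernel_eq) simp
  then show ?thesis by simp
qed

lemma continuous_on_OU_kernel: "continuous_on {1..} (\<lambda>t. OU_kernel Q B t x u)"
proof -
  have "continuous_on {1..} (\<lambda>t. det (cov - F t ** cov ** transpose (F t)))"
    by (intro continuous_on_det continuous_intros mm.continuous_on continuous_on_F continuous_on_FT)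
  then have "continuous_on {1..} (\<lambda>t. det (cov_t t))"
    by (rule continuous_on_cong[THEN iffD1, rotated 2]) (auto simp: cov_t_eq)
  moreover have "det (cov_t t) \<noteq> 0" if "t \<in> {1..}" for t
    using det_cov_t_pos[of t] that by simp
  ultimately have 1: "continuous_on {1..} factor"
    unfolding factor_def by (intro continuous_intros) auto
  have 2: "continuous_on {1..} (\<lambda>t. exp (- (1/2) * phase t x u))"
  proof (intro continuous_at_imp_continuous_on ballI)
    fix t :: real assume "t \<in> {1..}"
    then show "isCont (\<lambda>t. exp (- (1/2) * phase t x u)) t"
      using exp_phase_derivative_bound DERIV_isCont by (metis atLeast_iff)
  qed
  have "continuous_on {1..} (\<lambda>t. factor t * exp (rho2 x / 2) * exp (- (1/2) * phase t x u))"
    by (intro continuous_on_mult 1 2 continuous_on_const)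
  then show ?thesis
    by (rule continuous_on_cong[THEN iffD1, rotated 2]) (auto simp: OU_kernel_eq)
qed

lemma OU_kernel_integrable:
  assumes t: "t \<ge> 1" and f: "integrable \<gamma> f"
  shows "integrable \<gamma> (\<lambda>u. OU_kernel Q B t x u * f u)"
proof -
  obtain D where D: "D > 0" "\<And>t x u. t \<ge> 1 \<Longrightarrow> \<bar>OU_kernel Q B t x u\<bar> \<le> D * exp (rho2 x / 2)"
    using OU_kernel_bound by blast
  have [measurable]: "f \<in> borel_measurable borel" using borel_measurable_integrable[OF f] by simp
  have "(\<lambda>u. OU_kernel Q B t x u) \<in> borel_measurable borel"
    using t by (intro measurable_OU_kernel) auto
  then have "(\<lambda>u. OU_kernel Q B t x u * f u) \<in> borel_measurable \<gamma>" by measurable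
  moreover have "integrable \<gamma> (\<lambda>u. D * exp (rho2 x / 2) * f u)" using f by simp
  moreover have "norm (OU_kernel Q B t x u * f u) \<le> norm (D * exp (rho2 x / 2) * f u)" for u
    using D(2)[OF t, of x u] D(1) by (simp add: abs_mult mult_right_mono)
  ultimately show ?thesis using Bochner_Integration.integrable_bound by blast
qed

text \<open>Dominated convergence: for fixed \<open>x\<close> the kernel is bounded in \<open>u\<close> and \<open>t \<ge> 1\<close>.\<close>

lemma continuous_on_OU_semigroup:
  assumes f: "integrable \<gamma> f"
  shows "continuous_on {1..} (\<lambda>t. OU_semigroup Q B t f x)"
proof -
  obtain D where D: "D > 0" "\<And>t x u. t \<ge> 1 \<Longrightarrow> \<bar>OU_kernel Q B t x u\<bar> \<le> D * exp (rho2 x / 2)"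
    using OU_kernel_bound by blast
  show ?thesis
    unfolding continuous_on_sequentially
  proof (intro allI ballI impI, elim conjE)
    fix s and t :: real assume t: "t \<in> {1..}" and s: "\<forall>n. s n \<in> {1..}" and lim: "s \<longlonglongrightarrow> t"
    have "(\<lambda>n. \<integral>u. OU_kernel Q B (s n) x u * f u \<partial>\<gamma>) \<longlonglongrightarrow> (\<integral>u. OU_kernel Q B t x u * f u \<partial>\<gamma>)"
    proof (rule integral_dominated_convergence)
      show "integrable \<gamma> (\<lambda>u. D * exp (rho2 x / 2) * \<bar>f u\<bar>)" using f by simp
      show "(\<lambda>u. OU_kernel Q B t x u * f u) \<in> borel_measurable \<gamma>"
        using OU_kernel_integrable[OF _ f] t by (intro borel_measurable_integrable) simp
      show "(\<lambda>u. OU_kernel Q B (s n) x u * f u) \<in> borel_measurable \<gamma>" for n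
        using OU_kernel_integrable[OF _ f] s by (intro borel_measurable_integrable) simp
      show "AE u in \<gamma>. (\<lambda>n. OU_kernel Q B (s n) x u * f u) \<longlonglongrightarrow> OU_kernel Q B t x u * f u"
        using t s lim
        by (intro AE_I2 tendsto_mult tendsto_const continuous_on_tendsto_compose[OF continuous_on_OU_kernel lim]) auto
      show "AE u in \<gamma>. norm (OU_kernel Q B (s n) x u * f u) \<le> D * exp (rho2 x / 2) * \<bar>f u\<bar>" for n
        using D(2)[of "s n" x] s by (intro AE_I2) (simp add: abs_mult mult_right_mono)
    qed
    then show "((\<lambda>t. OU_semigroup Q B t f x) \<circ> s) \<longlonglongrightarrow> OU_semigroup Q B t f x"
      by (simp add: o_def OU_semigroup_def)
  qed
qed

lemma measurable_OU_semigroup: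
  assumes t: "t \<ge> 1" and f: "integrable \<gamma> f"
  shows "(\<lambda>x. OU_semigroup Q B t f x) \<in> borel_measurable borel"
proof -
  have [measurable]: "f \<in> borel_measurable borel" using borel_measurable_integrable[OF f] by simp
  have [measurable]: "(\<lambda>p. OU_kernel Q B t (fst p) (snd p)) \<in> borel_measurable (borel \<Otimes>\<^sub>M borel)"
    by (rule measurable_OU_kernel[OF t]) measurable
  have "(\<lambda>(x, u). OU_kernel Q B t x u * f u) \<in> borel_measurable (borel \<Otimes>\<^sub>M borel)"
    unfolding case_prod_beta by measurable
  then have "(\<lambda>(x, u). OU_kernel Q B t x u * f u) \<in> borel_measurable (borel \<Otimes>\<^sub>M \<gamma>)"
    by (simp cong: measurable_cong_sets sets_pair_measure_cong)
  then show ?thesis unfolding OU_semigroup_def by (rule G.borel_measurable_lebesgue_integral)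
qed

text \<open>The function whose product with \<open>exp (R(x))\<close> dominates the variation of the semigroup.\<close>

definition Phi :: "(real ^ 'n \<Rightarrow> real) \<Rightarrow> real ^ 'n \<Rightarrow> real" where
  "Phi f x = (\<integral>u. Psi x u * \<bar>f u\<bar> \<partial>\<gamma>)"

lemma Psi_integrable:
  assumes f: "integrable \<gamma> f"
  shows "integrable \<gamma> (\<lambda>u. Psi x u * \<bar>f u\<bar>)"
proof (rule Bochner_Integration.integrable_bound[OF f])
  have [measurable]: "f \<in> borel_measurable borel" using borel_measurable_integrable[OF f] by simp
  show "(\<lambda>u. Psi x u * \<bar>f u\<bar>) \<in> borel_measurable \<gamma>" by measurable
  show "AE u in \<gamma>. norm (Psi x u * \<bar>f u\<bar>) \<le> norm (f u)"
    using Psi_pos Psi_le_1 by (intro AE_I2) (simp add: abs_mult mult_left_le_one_le less_imp_le)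
qed

lemma Phi_nonneg: "0 \<le> Phi f x"
  unfolding Phi_def using Psi_pos by (intro integral_nonneg_AE AE_I2) (simp add: less_imp_le)

lemma Phi_le:
  assumes f: "integrable \<gamma> f" shows "Phi f x \<le> (\<integral>u. \<bar>f u\<bar> \<partial>\<gamma>)"
  unfolding Phi_def using f Psi_integrable[OF f] Psi_le_1
  by (intro integral_mono) (auto intro!: mult_left_le_one_le less_imp_le[OF Psi_pos])

lemma Phi_flow:
  assumes f: "integrable \<gamma> f" and "0 \<le> s" shows "Phi f x \<le> Phi f (E s *v x)"
  unfolding Phi_def using Psi_integrable[OF f] Psi_flow[OF assms(2)]
  by (intro integral_mono) (auto intro!: mult_right_mono)

lemma measurable_Phi:
  assumes f: "integrable \<gamma> f" shows "Phi f \<in> borel_measurable borel"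
proof -
  have [measurable]: "f \<in> borel_measurable borel" using borel_measurable_integrable[OF f] by simp
  have "(\<lambda>(x, u). Psi x u * \<bar>f u\<bar>) \<in> borel_measurable (borel \<Otimes>\<^sub>M borel)"
    unfolding case_prod_beta by measurable
  then have "(\<lambda>(x, u). Psi x u * \<bar>f u\<bar>) \<in> borel_measurable (borel \<Otimes>\<^sub>M \<gamma>)"
    by (simp cong: measurable_cong_sets sets_pair_measure_cong)
  then show ?thesis unfolding Phi_def[abs_def] by (rule G.borel_measurable_lebesgue_integral)
qed

text \<open>Tonelli reduces this to the bound for a single \<open>u\<close>.\<close>

lemma Phi_shell_integral:
  "\<exists>C>0. \<forall>r f. integrable \<gamma> f \<longrightarrow>
     (\<integral>\<^sup>+y. ennreal (Phi f y) * indicator (shell r) y \<partial>lborel) \<le> ennreal (C * (\<integral>u. \<bar>f u\<bar> \<partial>\<gamma>))"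
proof -
  obtain C0 :: real where C0: "\<And>r u. (\<integral>\<^sup>+y. ennreal (Psi y u) * indicator (shell r) y \<partial>lborel) \<le> ennreal C0"
    using Psi_shell_integral by blast
  define C where "C = \<bar>C0\<bar> + 1"
  have C: "C > 0" by (simp add: C_def add_nonneg_pos)
  have C_le: "ennreal C0 \<le> ennreal C" unfolding C_def by (intro ennreal_leI) linarith
  have "(\<integral>\<^sup>+y. ennreal (Phi f y) * indicator (shell r) y \<partial>lborel) \<le> ennreal (C * (\<integral>u. \<bar>f u\<bar> \<partial>\<gamma>))"
    if f: "integrable \<gamma> f" for r f
  proof -
    have [measurable]: "f \<in> borel_measurable borel" using borel_measurable_integrable[OF f] by simp
    interpret pair_sigma_finite lborel \<gamma> ..
    have "ennreal (Phi f y) * indicator (shell r) y = (\<integral>\<^sup>+u. ennreal (Psi y u) * indicator (shell r) y * ennreal \<bar>f u\<bar> \<partial>\<gamma>)" for y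
    proof -
      have "ennreal (Phi f y) = (\<integral>\<^sup>+u. ennreal (Psi y u * \<bar>f u\<bar>) \<partial>\<gamma>)"
        unfolding Phi_def using Psi_pos
        by (intro nn_integral_eq_integral[symmetric] Psi_integrable f AE_I2) (simp add: less_imp_le)
      also have "\<dots> = (\<integral>\<^sup>+u. ennreal (Psi y u) * ennreal \<bar>f u\<bar> \<partial>\<gamma>)"
        using Psi_pos by (simp add: ennreal_mult less_imp_le)
      finally show ?thesis by (cases "y \<in> shell r") auto
    qed
    then have "(\<integral>\<^sup>+y. ennreal (Phi f y) * indicator (shell r) y \<partial>lborel)
        = (\<integral>\<^sup>+y. (\<integral>\<^sup>+u. ennreal (Psi y u) * indicator (shell r) y * ennreal \<bar>f u\<bar> \<partial>\<gamma>) \<partial>lborel)" by simp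
    also have "\<dots> = (\<integral>\<^sup>+u. (\<integral>\<^sup>+y. ennreal (Psi y u) * indicator (shell r) y * ennreal \<bar>f u\<bar> \<partial>lborel) \<partial>\<gamma>)"
      by (rule Fubini'[symmetric]) measurable
    also have "\<dots> \<le> (\<integral>\<^sup>+u. ennreal C * ennreal \<bar>f u\<bar> \<partial>\<gamma>)"
    proof (rule nn_integral_mono)
      fix u
      have "(\<integral>\<^sup>+y. ennreal (Psi y u) * indicator (shell r) y * ennreal \<bar>f u\<bar> \<partial>lborel)
          = (\<integral>\<^sup>+y. ennreal (Psi y u) * indicator (shell r) y \<partial>lborel) * ennreal \<bar>f u\<bar>"
        by (rule nn_integral_multc) measurable
      also have "\<dots> \<le> ennreal C * ennreal \<bar>f u\<bar>"
        using order_trans[OF C0 C_le] by (intro mult_right_mono) auto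
      finally show "(\<integral>\<^sup>+y. ennreal (Psi y u) * indicator (shell r) y * ennreal \<bar>f u\<bar> \<partial>lborel) \<le> ennreal C * ennreal \<bar>f u\<bar>" .
    qed
    also have "\<dots> = ennreal C * (\<integral>\<^sup>+u. ennreal \<bar>f u\<bar> \<partial>\<gamma>)" by (rule nn_integral_cmult) measurable
    also have "(\<integral>\<^sup>+u. ennreal \<bar>f u\<bar> \<partial>\<gamma>) = ennreal (\<integral>u. \<bar>f u\<bar> \<partial>\<gamma>)"
      using f by (intro nn_integral_eq_integral) auto
    finally show ?thesis using C by (simp add: ennreal_mult')
  qed
  with C show ?thesis by blast
qed

lemma rho_variation_le_Phi:
  "\<exists>C\<ge>1. \<forall>\<rho>\<ge>1. \<forall>f x. integrable \<gamma> f \<longrightarrow>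
     rho_variation \<rho> {1..} (\<lambda>t. OU_semigroup Q B t f x) \<le> ennreal (C * exp (rho2 x / 2) * Phi f x)"
proof -
  obtain C0 where C0: "C0 > 0" "\<And>x u n (\<tau> :: nat \<Rightarrow> real). strict_mono_on {..n} \<tau> \<Longrightarrow> \<tau> ` {..n} \<subseteq> {1..} \<Longrightarrow>
     (\<Sum>i=1..n. \<bar>OU_kernel Q B (\<tau> i) x u - OU_kernel Q B (\<tau> (i - 1)) x u\<bar>) \<le> C0 * exp (rho2 x / 2) * Psi x u"
    using OU_kernel_variation by blast
  have main: "rho_variation \<rho> {1..} (\<lambda>t. OU_semigroup Q B t f x) \<le> ennreal ((C0 + 1) * exp (rho2 x / 2) * Phi f x)"
    if \<rho>: "\<rho> \<ge> 1" and f: "integrable \<gamma> f" for \<rho> f x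
    unfolding rho_variation_def
  proof (rule SUP_least, clarify)
    fix N and \<tau> :: "nat \<Rightarrow> real" assume \<tau>: "strict_mono_on {..N} \<tau>" "\<tau> ` {..N} \<subseteq> {1..}"
    define H where "H = (\<lambda>t. OU_semigroup Q B t f x)"
    define k where "k = (\<lambda>i u. OU_kernel Q B (\<tau> i) x u)"
    have int: "integrable \<gamma> (\<lambda>u. k i u * f u)" if "i \<le> N" for i
      unfolding k_def using \<tau>(2) that by (intro OU_kernel_integrable f) auto
    have intd: "integrable \<gamma> (\<lambda>u. \<bar>k i u - k (i - 1) u\<bar> * \<bar>f u\<bar>)" if "i \<in> {1..N}" for i
    proof -
      have "i \<le> N" "i - 1 \<le> N" using that by auto
      from integrable_abs[OF Bochner_Integration.integrable_diff[OF int[OF this(1)] int[OF this(2)]]]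
      show ?thesis by (simp add: left_diff_distrib[symmetric] abs_mult)
    qed
    have "(\<Sum>i=1..N. \<bar>H (\<tau> i) - H (\<tau> (i - 1))\<bar> powr \<rho>) powr (1 / \<rho>) \<le> (\<Sum>i=1..N. \<bar>H (\<tau> i) - H (\<tau> (i - 1))\<bar>)"
      by (rule powr_sum_le_sum) (use \<rho> in auto)
    also have "\<dots> \<le> (\<Sum>i=1..N. \<integral>u. \<bar>k i u - k (i - 1) u\<bar> * \<bar>f u\<bar> \<partial>\<gamma>)"
    proof (rule sum_mono)
      fix i assume i: "i \<in> {1..N}"
      have "H (\<tau> i) - H (\<tau> (i - 1)) = (\<integral>u. k i u * f u - k (i - 1) u * f u \<partial>\<gamma>)"
        unfolding H_def OU_semigroup_def k_def[symmetric]
        using int[of i] int[of "i - 1"] i by (subst Bochner_Integration.integral_diff) (auto simp: k_def)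
      also have "\<bar>\<dots>\<bar> \<le> (\<integral>u. \<bar>k i u * f u - k (i - 1) u * f u\<bar> \<partial>\<gamma>)" by (rule integral_abs_bound)
      finally show "\<bar>H (\<tau> i) - H (\<tau> (i - 1))\<bar> \<le> (\<integral>u. \<bar>k i u - k (i - 1) u\<bar> * \<bar>f u\<bar> \<partial>\<gamma>)"
        by (simp add: left_diff_distrib[symmetric] abs_mult)
    qed
    also have "\<dots> = (\<integral>u. (\<Sum>i=1..N. \<bar>k i u - k (i - 1) u\<bar> * \<bar>f u\<bar>) \<partial>\<gamma>)"
      by (rule Bochner_Integration.integral_sum[symmetric]) (rule intd)
    also have "\<dots> \<le> (\<integral>u. ((C0 + 1) * exp (rho2 x / 2)) * (Psi x u * \<bar>f u\<bar>) \<partial>\<gamma>)"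
    proof (rule integral_mono)
      show "integrable \<gamma> (\<lambda>u. \<Sum>i=1..N. \<bar>k i u - k (i - 1) u\<bar> * \<bar>f u\<bar>)"
        by (rule Bochner_Integration.integrable_sum) (rule intd)
      show "integrable \<gamma> (\<lambda>u. ((C0 + 1) * exp (rho2 x / 2)) * (Psi x u * \<bar>f u\<bar>))"
        using Psi_integrable[OF f] by simp
      fix u
      have "(\<Sum>i=1..N. \<bar>k i u - k (i - 1) u\<bar>) \<le> C0 * exp (rho2 x / 2) * Psi x u"
        unfolding k_def by (rule C0(2)[OF \<tau>])
      also have "\<dots> \<le> (C0 + 1) * exp (rho2 x / 2) * Psi x u"
        using Psi_pos[of x u] by (intro mult_right_mono) auto
      finally have "(\<Sum>i=1..N. \<bar>k i u - k (i - 1) u\<bar>) * \<bar>f u\<bar> \<le> (C0 + 1) * exp (rho2 x / 2) * Psi x u * \<bar>f u\<bar>"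
        by (rule mult_right_mono) simp
      then show "(\<Sum>i=1..N. \<bar>k i u - k (i - 1) u\<bar> * \<bar>f u\<bar>) \<le> ((C0 + 1) * exp (rho2 x / 2)) * (Psi x u * \<bar>f u\<bar>)"
        by (simp add: sum_distrib_right mult.assoc)
    qed
    also have "\<dots> = (C0 + 1) * exp (rho2 x / 2) * Phi f x" by (simp add: Phi_def)
    finally show "ennreal ((\<Sum>i=1..N. \<bar>OU_semigroup Q B (\<tau> i) f x - OU_semigroup Q B (\<tau> (i - 1)) f x\<bar> powr \<rho>) powr (1 / \<rho>))
        \<le> ennreal ((C0 + 1) * exp (rho2 x / 2) * Phi f x)"
      unfolding H_def by (rule ennreal_leI)
  qed
  show ?thesis
    by (rule exI[of _ "C0 + 1"], intro conjI allI impI main) (use C0(1) in auto)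
qed

section \<open>The weak type estimate\<close>

lemma exp_le_inverse_sqrt: "L > 0 \<Longrightarrow> exp (- (3 / 2) * L) \<le> 1 / (exp L * sqrt L)" for L :: real
proof -
  assume L: "L > 0"
  have "0 \<le> (sqrt L - 1)\<^sup>2" by simp
  then have "2 * sqrt L \<le> L + 1" using L by (simp add: power2_eq_square algebra_simps)
  then have "sqrt L \<le> 1 + L / 2" using L by simp
  also have "\<dots> \<le> exp (L / 2)" by (rule exp_ge_add_one_self)
  finally have "exp L * sqrt L \<le> exp L * exp (L / 2)" by (intro mult_left_mono) auto
  also have "\<dots> = exp ((3 / 2) * L)" by (simp flip: exp_add)
  finally have "inverse (exp ((3 / 2) * L)) \<le> inverse (exp L * sqrt L)"
    using L by (intro le_imp_inverse_le) auto
  then show ?thesis by (simp add: exp_minus inverse_eq_divide)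
qed

text \<open>The level set avoids the ball where the weight \<open>exp (rho2 x / 2)\<close> is too small. The part far
  outside is negligible by the Gaussian tail, and the rest lies between two comparable levels of
  \<open>rho\<close>. The radius of this region is of order \<open>sqrt (ln \<alpha>)\<close>.\<close>

lemma Phi_level_set:
  assumes C0: "C0 \<ge> 1"
  shows "\<exists>C>0. \<forall>f \<alpha>. integrable \<gamma> f \<longrightarrow> (\<integral>u. \<bar>f u\<bar> \<partial>\<gamma>) = 1 \<longrightarrow> \<alpha> > 2 \<longrightarrow>
    emeasure \<gamma> {x. \<alpha> < C0 * exp (rho2 x / 2) * Phi f x} \<le> ennreal (C / (\<alpha> * sqrt (ln \<alpha>)))"
proof -
  obtain C1 where C1: "C1 > 0" "\<And>r \<alpha> \<Phi>. r \<ge> 2 \<Longrightarrow> \<alpha> > 0 \<Longrightarrow> \<Phi> \<in> borel_measurable borel \<Longrightarrow> (\<And>x. 0 \<le> \<Phi> x) \<Longrightarrow>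
    (\<And>x s. 0 \<le> s \<Longrightarrow> \<Phi> x \<le> \<Phi> (E s *v x)) \<Longrightarrow>
    (\<integral>\<^sup>+x. ennreal (exp (- (rho2 x / 2))) * indicator {x. r < rho x \<and> rho x \<le> 2 * r \<and> \<alpha> < exp (rho2 x / 2) * \<Phi> x} x \<partial>lborel)
      \<le> ennreal (C1 / (\<alpha> * r)) * (\<integral>\<^sup>+y. ennreal (\<Phi> y) * indicator (shell r) y \<partial>lborel)"
    using level_set_bound by blast
  obtain C2 where C2: "C2 > 0" "\<And>r f. integrable \<gamma> f \<Longrightarrow>
     (\<integral>\<^sup>+y. ennreal (Phi f y) * indicator (shell r) y \<partial>lborel) \<le> ennreal (C2 * (\<integral>u. \<bar>f u\<bar> \<partial>\<gamma>))"
    using Phi_shell_integral by blast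
  define I where "I = enn2real (\<integral>\<^sup>+x. ennreal (exp (- (1/4) * rho2 x)) \<partial>lborel)"
  have I: "(\<integral>\<^sup>+x. ennreal (exp (- (1/4) * rho2 x)) \<partial>lborel) = ennreal I"
    unfolding I_def using gaussian_rho2_finite[of "1/4"] by simp
  have I0: "0 \<le> I" by (simp add: I_def)
  define d where "d = dens_const"
  have d: "d \<ge> 0" unfolding d_def by (rule dens_const_nonneg)
  \<comment> \<open>For \<open>L \<ge> L0\<close> the radius satisfies \<open>r\<^sup>2 \<ge> 3 L / 2\<close>, which makes the tail small, and \<open>r \<ge> 2\<close>.\<close>
  define L0 where "L0 = 4 + 4 * ln C0"
  have L0: "L0 \<ge> 4" using C0 by (simp add: L0_def)
  define C3 where "C3 = d * (C1 * C0 * C2 + I)"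
  have C3: "C3 \<ge> 0" using d C1(1) C0 C2(1) I0 by (simp add: C3_def)
  define C4 where "C4 = measure \<gamma> UNIV * (exp L0 * sqrt L0)"
  have C4: "C4 \<ge> 0" using L0 by (simp add: C4_def)
  have "emeasure \<gamma> {x. \<alpha> < C0 * exp (rho2 x / 2) * Phi f x} \<le> ennreal ((C3 + C4 + 1) / (\<alpha> * sqrt (ln \<alpha>)))"
    if f: "integrable \<gamma> f" and f1: "(\<integral>u. \<bar>f u\<bar> \<partial>\<gamma>) = 1" and \<alpha>: "\<alpha> > 2" for f \<alpha>
  proof -
    note [measurable] = measurable_Phi[OF f]
    define L where "L = ln \<alpha>"
    have L: "L > 0" using \<alpha> by (simp add: L_def)
    have \<alpha>L: "\<alpha> = exp L" using \<alpha> by (simp add: L_def)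
    define A where "A = {x. \<alpha> < C0 * exp (rho2 x / 2) * Phi f x}"
    have A[measurable]: "A \<in> sets borel" unfolding A_def by measurable
    show ?thesis
    proof (cases "L < L0")
      case True
      have "\<alpha> * sqrt L \<le> exp L0 * sqrt L0"
        unfolding \<alpha>L using True L by (intro mult_mono) auto
      then have "measure \<gamma> UNIV * (\<alpha> * sqrt L) \<le> C4" unfolding C4_def by (intro mult_left_mono) auto
      then have "measure \<gamma> UNIV * (\<alpha> * sqrt L) \<le> C3 + C4 + 1" using C3 by simp
      then have le: "measure \<gamma> UNIV \<le> (C3 + C4 + 1) / (\<alpha> * sqrt L)" using \<alpha> L by (simp add: pos_le_divide_eq)
      have "emeasure \<gamma> A \<le> emeasure \<gamma> UNIV" by (intro emeasure_mono) auto
      also have "\<dots> = ennreal (measure \<gamma> UNIV)" by (rule G.emeasure_eq_measure)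
      also have "\<dots> \<le> ennreal ((C3 + C4 + 1) / (\<alpha> * sqrt L))" by (rule ennreal_leI[OF le])
      finally show ?thesis by (simp add: A_def L_def)
    next
      case False
      define r where "r = sqrt (2 * (L - ln C0))"
      have lnC0: "0 \<le> ln C0" using C0 by simp
      have r2: "r\<^sup>2 = 2 * L - 2 * ln C0" "r\<^sup>2 \<ge> (3 / 2) * L"
        using False lnC0 by (auto simp: r_def L0_def)
      have r_ge: "2 \<le> r" "sqrt L \<le> r"
        using False lnC0 L unfolding r_def L0_def by (auto intro!: real_le_rsqrt simp: power2_eq_square)
      define A1 where "A1 = {x. r < rho x \<and> rho x \<le> 2 * r \<and> \<alpha> / C0 < exp (rho2 x / 2) * Phi f x}"
      define A2 where "A2 = {x. 2 * r < rho x}"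
      have A12[measurable]: "A1 \<in> sets borel" "A2 \<in> sets borel" unfolding A1_def A2_def by measurable
      have sub: "A \<subseteq> A1 \<union> A2"
      proof
        fix x assume "x \<in> A"
        then have x: "\<alpha> < C0 * exp (rho2 x / 2) * Phi f x" by (simp add: A_def)
        also have "\<dots> \<le> C0 * exp (rho2 x / 2) * 1"
          using Phi_le[OF f, of x] C0 by (intro mult_left_mono) (auto simp: f1)
        also have "\<dots> = exp (ln C0 + rho2 x / 2)" using C0 by (simp add: exp_add)
        finally have "r\<^sup>2 < (rho x)\<^sup>2" by (simp add: \<alpha>L r2)
        then have "r < rho x" by (rule power2_less_imp_less) simp
        moreover have "\<alpha> / C0 < exp (rho2 x / 2) * Phi f x" using x C0 by (simp add: field_simps)
        ultimately show "x \<in> A1 \<union> A2" by (auto simp: A1_def A2_def)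
      qed
      have 1: "emeasure \<gamma> A1 \<le> ennreal (d * (C1 * C0 * C2) / (\<alpha> * sqrt L))"
      proof -
        have "(\<integral>\<^sup>+x. ennreal (exp (- (rho2 x / 2))) * indicator A1 x \<partial>lborel)
            \<le> ennreal (C1 / (\<alpha> / C0 * r)) * (\<integral>\<^sup>+y. ennreal (Phi f y) * indicator (shell r) y \<partial>lborel)"
          unfolding A1_def using r_ge(1) \<alpha> C0 Phi_nonneg Phi_flow[OF f]
          by (intro C1(2)) auto
        also have "\<dots> \<le> ennreal (C1 / (\<alpha> / C0 * r)) * ennreal C2"
          using C2(2)[OF f, of r] by (intro mult_left_mono) (auto simp: f1)
        also have "\<dots> = ennreal (C1 * C0 * C2 / (\<alpha> * r))"
          using C1(1) C2(1) C0 \<alpha> r_ge(1) by (simp add: mult_ac flip: ennreal_mult)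
        also have "\<dots> \<le> ennreal (C1 * C0 * C2 / (\<alpha> * sqrt L))"
          using C1(1) C2(1) C0 \<alpha> L r_ge by (intro ennreal_leI divide_left_mono mult_left_mono mult_pos_pos mult_nonneg_nonneg) auto
        finally have "emeasure \<gamma> A1 \<le> ennreal d * ennreal (C1 * C0 * C2 / (\<alpha> * sqrt L))"
          unfolding d_def emeasure_OU_measure[OF A12(1)] by (rule mult_left_mono) simp
        also have "\<dots> = ennreal (d * (C1 * C0 * C2 / (\<alpha> * sqrt L)))"
          using C1(1) C2(1) C0 \<alpha> L d by (intro ennreal_mult[symmetric]) auto
        finally show ?thesis by simp
      qed
      have 2: "emeasure \<gamma> A2 \<le> ennreal (d * I / (\<alpha> * sqrt L))"
      proof -
        have "(\<integral>\<^sup>+x. ennreal (exp (- (rho2 x / 2))) * indicator A2 x \<partial>lborel)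
            \<le> (\<integral>\<^sup>+x. ennreal (1 / (\<alpha> * sqrt L)) * ennreal (exp (- (1/4) * rho2 x)) \<partial>lborel)"
        proof (rule nn_integral_mono)
          fix x
          show "ennreal (exp (- (rho2 x / 2))) * indicator A2 x \<le> ennreal (1 / (\<alpha> * sqrt L)) * ennreal (exp (- (1/4) * rho2 x))"
          proof (cases "x \<in> A2")
            case True
            then have "(2 * r)\<^sup>2 \<le> (rho x)\<^sup>2" using r_ge(1) by (intro power_mono) (auto simp: A2_def)
            then have "(3 / 2) * L \<le> rho2 x / 4" using r2(2) by (simp add: power_mult_distrib)
            then have "exp (- (rho2 x / 2)) \<le> exp (- (3 / 2) * L + - (1/4) * rho2 x)" by simp
            also have "\<dots> = exp (- (3 / 2) * L) * exp (- (1/4) * rho2 x)" by (rule exp_add)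
            also have "\<dots> \<le> 1 / (\<alpha> * sqrt L) * exp (- (1/4) * rho2 x)"
              unfolding \<alpha>L by (intro mult_right_mono exp_le_inverse_sqrt[OF L]) simp
            finally show ?thesis using True \<alpha> L by (simp flip: ennreal_mult add: ennreal_leI)
          qed simp
        qed
        also have "\<dots> = ennreal (1 / (\<alpha> * sqrt L)) * ennreal I"
          by (subst nn_integral_cmult) (simp_all only: I, measurable)
        also have "\<dots> = ennreal (I / (\<alpha> * sqrt L))"
          using I0 \<alpha> L by (simp flip: ennreal_mult)
        finally have "emeasure \<gamma> A2 \<le> ennreal d * ennreal (I / (\<alpha> * sqrt L))"
          unfolding d_def emeasure_OU_measure[OF A12(2)] by (rule mult_left_mono) simp
        also have "\<dots> = ennreal (d * (I / (\<alpha> * sqrt L)))"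
          using I0 \<alpha> L d by (intro ennreal_mult[symmetric]) auto
        finally show ?thesis by simp
      qed
      have "emeasure \<gamma> A \<le> emeasure \<gamma> (A1 \<union> A2)" using sub by (intro emeasure_mono) auto
      also have "\<dots> \<le> emeasure \<gamma> A1 + emeasure \<gamma> A2" by (intro emeasure_subadditive) auto
      also have "\<dots> \<le> ennreal (d * (C1 * C0 * C2) / (\<alpha> * sqrt L)) + ennreal (d * I / (\<alpha> * sqrt L))"
        using 1 2 by (rule add_mono)
      also have "\<dots> = ennreal (C3 / (\<alpha> * sqrt L))"
        using d C1(1) C0 C2(1) I0 \<alpha> L
        by (subst ennreal_plus[symmetric]) (auto simp: C3_def add_divide_distrib distrib_left)
      also have "\<dots> \<le> ennreal ((C3 + C4 + 1) / (\<alpha> * sqrt L))"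
        using C4 \<alpha> L by (intro ennreal_leI divide_right_mono) auto
      finally show ?thesis by (simp add: A_def L_def)
    qed
  qed
  moreover have "C3 + C4 + 1 > 0" using C3 C4 by simp
  ultimately show ?thesis by blast
qed

lemma variation_level_set:
  "\<exists>C>0. \<forall>\<rho>\<ge>1. \<forall>f \<alpha>. integrable \<gamma> f \<longrightarrow> (\<integral>u. \<bar>f u\<bar> \<partial>\<gamma>) = 1 \<longrightarrow> \<alpha> > 2 \<longrightarrow>
    emeasure \<gamma> {x. rho_variation \<rho> {1..} (\<lambda>t. OU_semigroup Q B t f x) > ennreal \<alpha>}
      \<le> ennreal (C / (\<alpha> * sqrt (ln \<alpha>)))"
proof -
  obtain C0 where C0: "C0 \<ge> 1" "\<And>\<rho> f x. \<rho> \<ge> 1 \<Longrightarrow> integrable \<gamma> f \<Longrightarrow>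
     rho_variation \<rho> {1..} (\<lambda>t. OU_semigroup Q B t f x) \<le> ennreal (C0 * exp (rho2 x / 2) * Phi f x)"
    using rho_variation_le_Phi by blast
  obtain C where C: "C > 0" "\<And>f \<alpha>. integrable \<gamma> f \<Longrightarrow> (\<integral>u. \<bar>f u\<bar> \<partial>\<gamma>) = 1 \<Longrightarrow> \<alpha> > 2 \<Longrightarrow>
    emeasure \<gamma> {x. \<alpha> < C0 * exp (rho2 x / 2) * Phi f x} \<le> ennreal (C / (\<alpha> * sqrt (ln \<alpha>)))"
    using Phi_level_set[OF C0(1)] by blast
  have "emeasure \<gamma> {x. rho_variation \<rho> {1..} (\<lambda>t. OU_semigroup Q B t f x) > ennreal \<alpha>}
      \<le> ennreal (C / (\<alpha> * sqrt (ln \<alpha>)))"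
    if \<rho>: "\<rho> \<ge> 1" and f: "integrable \<gamma> f" "(\<integral>u. \<bar>f u\<bar> \<partial>\<gamma>) = 1" and \<alpha>: "\<alpha> > 2" for \<rho> f \<alpha>
  proof (rule order_trans[OF emeasure_mono C(2)[OF f \<alpha>]])
    note [measurable] = measurable_Phi[OF f(1)]
    show "{x. rho_variation \<rho> {1..} (\<lambda>t. OU_semigroup Q B t f x) > ennreal \<alpha>} \<subseteq> {x. \<alpha> < C0 * exp (rho2 x / 2) * Phi f x}"
    proof safe
      fix x assume "ennreal \<alpha> < rho_variation \<rho> {1..} (\<lambda>t. OU_semigroup Q B t f x)"
      also have "\<dots> \<le> ennreal (C0 * exp (rho2 x / 2) * Phi f x)" by (rule C0(2)[OF \<rho> f(1)])
      finally show "\<alpha> < C0 * exp (rho2 x / 2) * Phi f x" using \<alpha> by (simp add: ennreal_less_iff)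
    qed
    show "{x. \<alpha> < C0 * exp (rho2 x / 2) * Phi f x} \<in> sets \<gamma>" by measurable
  qed
  with C(1) show ?thesis by blast
qed

lemma rho_variation_scale:
  assumes c: "c > 0" and \<rho>: "\<rho> \<ge> 1"
  shows "rho_variation \<rho> I (\<lambda>t. c * \<phi> t) = ennreal c * rho_variation \<rho> I \<phi>"
proof -
  have "((\<Sum>i=1..N. \<bar>c * \<phi> (t i) - c * \<phi> (t (i - 1))\<bar> powr \<rho>) powr (1 / \<rho>))
      = c * ((\<Sum>i=1..N. \<bar>\<phi> (t i) - \<phi> (t (i - 1))\<bar> powr \<rho>) powr (1 / \<rho>))" for N and t :: "nat \<Rightarrow> real"
  proof -
    have "\<bar>c * \<phi> (t i) - c * \<phi> (t (i - 1))\<bar> powr \<rho> = c powr \<rho> * \<bar>\<phi> (t i) - \<phi> (t (i - 1))\<bar> powr \<rho>" for i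
      using c by (simp add: abs_mult powr_mult flip: right_diff_distrib)
    then show ?thesis
      using c \<rho> by (simp add: powr_mult powr_powr sum_nonneg flip: sum_distrib_left)
  qed
  then show ?thesis
    unfolding rho_variation_def
    using c by (simp add: ennreal_mult SUP_mult_left_ennreal case_prod_beta)
qed

text \<open>By homogeneity \<open>f\<close> can be normalised. Heights above twice the norm of \<open>f\<close> are covered by the
  sharper estimate, and below them the total mass of the measure suffices.\<close>

lemma variation_weak_type:
  assumes \<rho>: "\<rho> \<ge> 1"
  shows "weak_type_1_1 \<gamma> (\<lambda>f x. rho_variation \<rho> {1..} (\<lambda>t. OU_semigroup Q B t f x))"
  unfolding weak_type_1_1_def
proof
  show "\<forall>f. integrable \<gamma> f \<longrightarrow> (\<lambda>x. rho_variation \<rho> {1..} (\<lambda>t. OU_semigroup Q B t f x)) \<in> borel_measurable \<gamma>"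
  proof (intro allI impI)
    fix f :: "real ^ 'n \<Rightarrow> real" assume f: "integrable \<gamma> f"
    show "(\<lambda>x. rho_variation \<rho> {1..} (\<lambda>t. OU_semigroup Q B t f x)) \<in> borel_measurable \<gamma>"
      using measurable_OU_semigroup[OF _ f] continuous_on_OU_semigroup[OF f] \<rho>
      by (intro borel_measurable_rho_variation) simp_all
  qed
  define V where "V = (\<lambda>f x. rho_variation \<rho> {1..} (\<lambda>t. OU_semigroup Q B t f x))"
  obtain C where C: "C > 0" "\<And>f \<alpha>. integrable \<gamma> f \<Longrightarrow> (\<integral>u. \<bar>f u\<bar> \<partial>\<gamma>) = 1 \<Longrightarrow> \<alpha> > 2 \<Longrightarrow>
    emeasure \<gamma> {x. V f x > ennreal \<alpha>} \<le> ennreal (C / (\<alpha> * sqrt (ln \<alpha>)))"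
    using variation_level_set \<rho> unfolding V_def by blast
  obtain C0 where C0: "\<And>f x. integrable \<gamma> f \<Longrightarrow> V f x \<le> ennreal (C0 * exp (rho2 x / 2) * Phi f x)"
    using rho_variation_le_Phi \<rho> unfolding V_def by blast
  define C' where "C' = C / sqrt (ln 2) + 2 * measure \<gamma> UNIV"
  have C'_ge: "C / sqrt (ln 2) \<le> C'" "2 * measure \<gamma> UNIV \<le> C'" using C(1) by (auto simp: C'_def)
  have "emeasure \<gamma> {x. V f x > ennreal \<alpha>} \<le> ennreal (C' / \<alpha> * (\<integral>x. \<bar>f x\<bar> \<partial>\<gamma>))"
    if \<alpha>: "\<alpha> > 0" and f: "integrable \<gamma> f" for \<alpha> f
  proof -
    define m where "m = (\<integral>x. \<bar>f x\<bar> \<partial>\<gamma>)"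
    have m0: "m \<ge> 0" by (simp add: m_def)
    consider "m = 0" | "m > 0" "\<alpha> / m \<le> 2" | "m > 0" "\<alpha> / m > 2" using m0 by fastforce
    then show ?thesis
    proof cases
      case 1
      have "Phi f x = 0" for x using Phi_le[OF f, of x] Phi_nonneg[of f x] 1 by (simp add: m_def)
      then have "V f x = 0" for x using C0[OF f, of x] by simp
      then show ?thesis using \<alpha> by simp
    next
      case 2
      then have "1 \<le> 2 / \<alpha> * m" using \<alpha> by (simp add: field_simps)
      then have "measure \<gamma> UNIV * 1 \<le> measure \<gamma> UNIV * (2 / \<alpha> * m)" by (intro mult_left_mono) auto
      also have "\<dots> = 2 * measure \<gamma> UNIV / \<alpha> * m" by simp
      also have "\<dots> \<le> C' / \<alpha> * m" using C'_ge(2) \<alpha> m0 by (intro mult_right_mono divide_right_mono) auto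
      finally have le: "measure \<gamma> UNIV \<le> C' / \<alpha> * m" by simp
      have "emeasure \<gamma> {x. V f x > ennreal \<alpha>} \<le> emeasure \<gamma> UNIV" by (intro emeasure_mono) auto
      also have "\<dots> = ennreal (measure \<gamma> UNIV)" by (rule G.emeasure_eq_measure)
      also have "\<dots> \<le> ennreal (C' / \<alpha> * m)" by (rule ennreal_leI[OF le])
      finally show ?thesis by (simp add: m_def)
    next
      case 3
      define g where "g = (\<lambda>x. f x / m)"
      have g: "integrable \<gamma> g" "(\<integral>x. \<bar>g x\<bar> \<partial>\<gamma>) = 1"
        using f 3(1) by (simp_all add: g_def m_def)
      have fg: "f = (\<lambda>x. m * g x)" using 3(1) by (simp add: g_def fun_eq_iff)
      have "OU_semigroup Q B t f x = m * OU_semigroup Q B t g x" for t x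
        unfolding OU_semigroup_def fg by (simp add: mult.left_commute)
      then have V: "V f x = ennreal m * V g x" for x
        unfolding V_def using rho_variation_scale[OF 3(1) \<rho>] by simp
      have "ennreal \<alpha> < V f x \<longleftrightarrow> ennreal (\<alpha> / m) < V g x" for x
      proof -
        have "ennreal \<alpha> = ennreal m * ennreal (\<alpha> / m)" using 3(1) \<alpha> by (simp flip: ennreal_mult)
        then show ?thesis unfolding V using 3(1) by (simp add: ennreal_mult_le_mult_iff flip: not_le)
      qed
      then have "emeasure \<gamma> {x. V f x > ennreal \<alpha>} \<le> ennreal (C / (\<alpha> / m * sqrt (ln (\<alpha> / m))))"
        using C(2)[OF g 3(2)] by simp
      also have "\<dots> \<le> ennreal (C' / \<alpha> * m)"
      proof (rule ennreal_leI)
        have "sqrt (ln 2) \<le> sqrt (ln (\<alpha> / m))" using 3 by simp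
        moreover have "0 < sqrt (ln (2 :: real))" by simp
        ultimately have "C / sqrt (ln (\<alpha> / m)) \<le> C / sqrt (ln 2)"
          using C(1) by (intro frac_le) auto
        then have "C / sqrt (ln (\<alpha> / m)) \<le> C'" using C'_ge(1) by linarith
        then have "C / sqrt (ln (\<alpha> / m)) * (m / \<alpha>) \<le> C' * (m / \<alpha>)"
          using 3(1) \<alpha> by (intro mult_right_mono) auto
        then show "C / (\<alpha> / m * sqrt (ln (\<alpha> / m))) \<le> C' / \<alpha> * m" by (simp add: mult_ac)
      qed
      finally show ?thesis by (simp add: m_def)
    qed
  qed
  then show "\<exists>C :: real. \<forall>\<alpha>>0. \<forall>f. integrable \<gamma> f \<longrightarrow>
      emeasure \<gamma> {x \<in> space \<gamma>. rho_variation \<rho> {1..} (\<lambda>t. OU_semigroup Q B t f x) > ennreal \<alpha>}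
        \<le> ennreal (C / \<alpha> * (\<integral>x. \<bar>f x\<bar> \<partial>\<gamma>))"
    unfolding V_def by (intro exI[of _ C']) simp
qed

end

theorem theorem4p3:
  fixes Q B :: "real ^ 'n ^ 'n"
  assumes "symmetric_matrix Q"
    and "positive_definite Q"
    and "\<And>z. complex_eigenvalue B z \<Longrightarrow> Re z < 0"
  shows "(\<forall>\<rho>\<ge>1. weak_type_1_1 (OU_measure Q B)
            (\<lambda>f x. rho_variation \<rho> {1..} (\<lambda>t. OU_semigroup Q B t f x))) \<and>
         (\<exists>C :: real. \<forall>\<rho>\<ge>1. \<forall>f. integrable (OU_measure Q B) f \<longrightarrow>
            (\<integral>x. \<bar>f x\<bar> \<partial>OU_measure Q B) = 1 \<longrightarrow>
            (\<forall>\<alpha>>2. emeasure (OU_measure Q B)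
               {x. rho_variation \<rho> {1..} (\<lambda>t. OU_semigroup Q B t f x) > ennreal \<alpha>}
               \<le> ennreal (C / (\<alpha> * sqrt (ln \<alpha>)))))"
proof -
  interpret stable_pair Q B by unfold_locales (fact assms)+
  show ?thesis using variation_weak_type variation_level_set by blast
qed

end
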